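(* Let $H:E^{*}=J^{1*}(\mathcal{T},M)\to\mathbb{R}$ be a Kronecker $h$-regular multi-time Hamiltonian function, with $\frac12\frac{\partial^2H}{\partial p_i^a\partial p_j^b}=h_{ab}g^{ij}$, and let $g_{ij}$ be the inverse of $g^{ij}$ and $h^{ab}$ the inverse of $h_{ab}$. Then the pair of local functions $N=(\underset{1}{N}{}_{(i)b}^{(a)},\underset{2}{N}{}_{(i)j}^{(a)})$ on $E^{*}$ given by $$\underset{1}{N}{}_{(i)b}^{(a)}=\varkappa_{cb}^a\,p_i^c,$$ $$\underset{2}{N}{}_{(i)j}^{(a)}=\frac{h^{ab}}{4}\left[\frac{\partial g_{ij}}{\partial x^k}\frac{\partial H}{\partial p_k^b}-\frac{\partial g_{ij}}{\partial p_k^b}\frac{\partial H}{\partial x^k}+g_{ik}\frac{\partial^2H}{\partial x^j\partial p_k^b}+g_{jk}\frac{\partial^2H}{\partial x^i\partial p_k^b}\right]$$ is a nonlinear connection on $E^{*}$, where $\varkappa_{bc}^a$ are the Christoffel symbols of the metric $h_{ab}(t)$.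
   Context: Everything is $C^\infty$ and repeated indices are summed. $\mathcal{T}$ and $M$ are smooth real manifolds of dimensions $m$ and $n$, with local coordinates $(t^a)_{a=1}^m$ and $(x^i)_{i=1}^n$; $h=(h_{ab}(t))$ is a fixed semi-Riemannian metric on $\mathcal{T}$. $E^{*}=J^{1*}(\mathcal{T},M)\to\mathcal{T}\times M$ is the dual of the first jet vector bundle $J^1(\mathcal{T},M)\to\mathcal{T}\times M$ (whose fibre at $(t,x)$ is the vector space of $1$-jets at $t$ of maps sending $t$ to $x$, with fibre coordinates $x^i_a=\partial x^i/\partial t^a$). It has induced coordinates $(t^a,x^i,p_i^a)$, and coordinate changes on $\mathcal{T}\times M$ of the form $\tilde t^a=\tilde t^a(t^b)$, $\tilde x^i=\tilde x^i(x^j)$ induce on $E^{*}$ the change with $$\tilde p_i^a=\frac{\partial x^j}{\partial\tilde x^i}\frac{\partial\tilde t^a}{\partial t^b}p_j^b .$$ Local functions on $E^{*}$ below are given in every such induced chart. Partial derivatives such as $\partial\tilde p_j^b/\partial t^a$, $\partial\tilde p_j^b/\partial x^i$ are taken in the coordinates $(t,x,p)$. A smooth function $H:E^{*}\to\mathbb{R}$ is a Kronecker $h$-regular multi-time Hamiltonian function if $$\frac12\frac{\partial^2H}{\partial p_i^a\partial p_j^b}=h_{ab}(t^c)\,g^{ij}(t^c,x^k,p_k^c),$$ where $g^{ij}$ is a d-tensor on $E^{*}$ (i.e. $g^{ij}=\tilde g^{pq}\frac{\partial x^i}{\partial\tilde x^p}\frac{\partial x^j}{\partial\tilde x^q}$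 under the coordinate changes above) which is symmetric, of rank $n$ and of constant signature. The pair $(E^{*},H)$ is then called a multi-time Hamilton space, and the $N$ of the claim is called its canonical nonlinear connection. A nonlinear connection on $E^{*}$ is a pair of families of local functions $N=(\underset{1}{N}{}_{(k)a}^{(c)},\underset{2}{N}{}_{(k)i}^{(c)})$ which transform by $$\underset{1}{\widetilde N}{}_{(j)d}^{(b)}=\underset{1}{N}{}_{(k)a}^{(c)}\frac{\partial\tilde t^b}{\partial t^c}\frac{\partial x^k}{\partial\tilde x^j}\frac{\partial t^a}{\partial\tilde t^d}-\frac{\partial t^a}{\partial\tilde t^d}\frac{\partial\tilde p_j^b}{\partial t^a},\qquad \underset{2}{\widetilde N}{}_{(j)r}^{(b)}=\underset{2}{N}{}_{(k)i}^{(c)}\frac{\partial\tilde t^b}{\partial t^c}\frac{\partial x^k}{\partial\tilde x^j}\frac{\partial x^i}{\partial\tilde x^r}-\frac{\partial x^i}{\partial\tilde x^r}\frac{\partial\tilde p_j^b}{\partial x^i}.$$ *)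

theory Defs
  imports "HOL-Analysis.Analysis"
begin

section \<open>Smooth maps between open subsets of Euclidean spaces\<close>

fun k_smooth_on :: "nat \<Rightarrow> 'a::euclidean_space set \<Rightarrow> ('a \<Rightarrow> 'b::real_normed_vector) \<Rightarrow> bool"
  where
    "k_smooth_on 0 S f \<longleftrightarrow> continuous_on S f"
  | "k_smooth_on (Suc k) S f \<longleftrightarrow>
       (\<forall>x\<in>S. f differentiable (at x)) \<and>
       (\<forall>v. k_smooth_on k S (\<lambda>x. frechet_derivative f (at x) v))"

text \<open>This is the usual notion of a smooth map only if \<open>S\<close> is open, which is the case wherever it
  is used below.\<close>

definition smooth_on :: "'a::euclidean_space set \<Rightarrow> ('a \<Rightarrow> 'b::real_normed_vector) \<Rightarrow> bool"
  where "smooth_on S f \<longleftrightarrow> (\<forall>k. k_smooth_on k S f)"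


section \<open>Charts and smooth manifolds\<close>

text \<open>A chart is a pair of its domain and its coordinate map; the values of the coordinate map outside
  the domain are irrelevant.\<close>

type_synonym ('p, 'e) chart = "'p set \<times> ('p \<Rightarrow> 'e)"

definition chart_inv :: "('p, 'e) chart \<Rightarrow> 'e \<Rightarrow> 'p"
  where "chart_inv c = inv_into (fst c) (snd c)"

definition smooth_in :: "('p, 'e::euclidean_space) chart \<Rightarrow> ('p \<Rightarrow> real) \<Rightarrow> bool"
  where "smooth_in c f \<longleftrightarrow> smooth_on (snd c ` fst c) (f \<circ> chart_inv c)"

text \<open>The partial derivative of a function \<open>f\<close> in the coordinates of the chart \<open>c\<close>, in the
  coordinate direction \<open>v\<close>, at the point \<open>p\<close> of the domain of \<open>c\<close>.\<close>

definition pd :: "('p, 'e::euclidean_space) chart \<Rightarrow> 'e \<Rightarrow> ('p \<Rightarrow> real) \<Rightarrow> 'p \<Rightarrow> real"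
  where "pd c v f p = frechet_derivative (f \<circ> chart_inv c) (at (snd c p)) v"

definition is_chart :: "'p topology \<Rightarrow> ('p, 'e::euclidean_space) chart \<Rightarrow> bool"
  where "is_chart X c \<longleftrightarrow>
    openin X (fst c) \<and> open (snd c ` fst c) \<and>
    homeomorphic_map (subtopology X (fst c)) (top_of_set (snd c ` fst c)) (snd c)"

definition smooth_transition :: "('p, 'e::euclidean_space) chart \<Rightarrow> ('p, 'e) chart \<Rightarrow> bool"
  where "smooth_transition c c' \<longleftrightarrow>
    smooth_on (snd c ` (fst c \<inter> fst c')) (snd c' \<circ> chart_inv c)"

record ('p, 'e) manifold =
  mtop :: "'p topology"
  atlas :: "('p, 'e) chart set"

text \<open>A Hausdorff second countable space with a maximal smooth atlas; the dimension is that of the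
  model space \<open>'e\<close>.\<close>

definition smooth_manifold :: "('p, 'e::euclidean_space) manifold \<Rightarrow> bool"
  where "smooth_manifold X \<longleftrightarrow>
    Hausdorff_space (mtop X) \<and> second_countable (mtop X) \<and>
    (\<Union>c\<in>atlas X. fst c) = topspace (mtop X) \<and>
    (\<forall>c\<in>atlas X. is_chart (mtop X) c) \<and>
    (\<forall>c\<in>atlas X. \<forall>c'\<in>atlas X. smooth_transition c c') \<and>
    (\<forall>c. is_chart (mtop X) c \<and> (\<forall>c'\<in>atlas X. smooth_transition c c' \<and> smooth_transition c' c)
          \<longrightarrow> c \<in> atlas X)"

text \<open>\<open>jac c c' p $ b $ a\<close> is the derivative of the \<open>b\<close>-th coordinate of \<open>c'\<close> with respect to the
  \<open>a\<close>-th coordinate of \<open>c\<close>.\<close>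

definition jac :: "('p, real^'k) chart \<Rightarrow> ('p, real^'k) chart \<Rightarrow> 'p \<Rightarrow> real^'k^'k"
  where "jac c c' p = (\<chi> b a. pd c (axis a 1) (\<lambda>s. snd c' s $ b) p)"


section \<open>Semi-Riemannian metrics\<close>

text \<open>The maximal dimensions of a positive and of a negative definite subspace of the quadratic form
  of a symmetric matrix.\<close>

definition signature :: "real^'k^'k \<Rightarrow> nat \<times> nat"
  where "signature A =
    (Max {dim W | W. subspace W \<and> (\<forall>w\<in>W - {0}. w \<bullet> (A *v w) > 0)},
     Max {dim W | W. subspace W \<and> (\<forall>w\<in>W - {0}. w \<bullet> (A *v w) < 0)})"

text \<open>\<open>h c t $ a $ b\<close> is the component \<open>h\<^sub>a\<^sub>b\<close>, in the chart \<open>c\<close>, at the point \<open>t\<close>.\<close>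

definition semi_riemannian_metric ::
    "('p, real^'k) manifold \<Rightarrow> (('p, real^'k) chart \<Rightarrow> 'p \<Rightarrow> real^'k^'k) \<Rightarrow> bool"
  where "semi_riemannian_metric X h \<longleftrightarrow>
    (\<forall>c\<in>atlas X. \<forall>a b. smooth_in c (\<lambda>t. h c t $ a $ b)) \<and>
    (\<forall>c\<in>atlas X. \<forall>c'\<in>atlas X. \<forall>t\<in>fst c \<inter> fst c'. \<forall>a b.
       h c' t $ a $ b =
         (\<Sum>e\<in>UNIV. \<Sum>f\<in>UNIV. h c t $ e $ f * jac c' c t $ e $ a * jac c' c t $ f $ b)) \<and>
    (\<forall>c\<in>atlas X. \<forall>t\<in>fst c. transpose (h c t) = h c t \<and> invertible (h c t)) \<and>
    (\<exists>s. \<forall>c\<in>atlas X. \<forall>t\<in>fst c. signature (h c t) = s)"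

text \<open>\<open>christoffel h c a b e t\<close> is the symbol with upper index \<open>a\<close> and lower indices \<open>b\<close>, \<open>e\<close>.\<close>

definition christoffel ::
    "(('p, real^'k) chart \<Rightarrow> 'p \<Rightarrow> real^'k^'k) \<Rightarrow> ('p, real^'k) chart \<Rightarrow> 'k \<Rightarrow> 'k \<Rightarrow> 'k \<Rightarrow> 'p \<Rightarrow> real"
  where "christoffel h c a b e t =
    (\<Sum>d\<in>UNIV. matrix_inv (h c t) $ a $ d / 2 *
      (pd c (axis e 1) (\<lambda>s. h c s $ d $ b) t
       + pd c (axis b 1) (\<lambda>s. h c s $ d $ e) t
       - pd c (axis d 1) (\<lambda>s. h c s $ b $ e) t))"


section \<open>The first jet bundle and its dual\<close>

definition smooth_near ::
    "('a, 'e::euclidean_space) manifold \<Rightarrow> ('b, 'f::euclidean_space) manifold \<Rightarrow> ('a \<Rightarrow> 'b) \<Rightarrow> 'a \<Rightarrow> bool"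
  where "smooth_near T M f t \<longleftrightarrow>
    (\<exists>c\<in>atlas T. \<exists>d\<in>atlas M. \<exists>W. openin (mtop T) W \<and> t \<in> W \<and> W \<subseteq> fst c \<and> f ` W \<subseteq> fst d \<and>
       smooth_on (snd c ` W) (snd d \<circ> f \<circ> chart_inv c))"

definition map_deriv ::
    "('a, real^'m) chart \<Rightarrow> ('b, real^'n) chart \<Rightarrow> 'a \<Rightarrow> ('a \<Rightarrow> 'b) \<Rightarrow> real^'m^'n"
  where "map_deriv c d t f = (\<chi> i a. pd c (axis a 1) (\<lambda>s. snd d (f s) $ i) t)"

text \<open>The 1-jet of \<open>f\<close> at \<open>t\<close>, as an equivalence class of maps.\<close>

definition jet ::
    "('a, real^'m) manifold \<Rightarrow> ('b, real^'n) manifold \<Rightarrow> 'a \<Rightarrow> ('a \<Rightarrow> 'b) \<Rightarrow> ('a \<Rightarrow> 'b) set"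
  where "jet T M t f =
    {g. smooth_near T M g t \<and> g t = f t \<and>
        (\<forall>c\<in>atlas T. \<forall>d\<in>atlas M. t \<in> fst c \<longrightarrow> f t \<in> fst d \<longrightarrow>
           map_deriv c d t g = map_deriv c d t f)}"

definition jet_fibre ::
    "('a, real^'m) manifold \<Rightarrow> ('b, real^'n) manifold \<Rightarrow> 'a \<Rightarrow> 'b \<Rightarrow> ('a \<Rightarrow> 'b) set set"
  where "jet_fibre T M t x = {jet T M t f | f. smooth_near T M f t \<and> f t = x}"

text \<open>The fibre coordinates \<open>x\<^sup>i\<^sub>a\<close> of a jet.\<close>

definition jet_coord ::
    "('a, real^'m) chart \<Rightarrow> ('b, real^'n) chart \<Rightarrow> 'a \<Rightarrow> ('a \<Rightarrow> 'b) set \<Rightarrow> real^'m^'n"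
  where "jet_coord c d t j = map_deriv c d t (SOME f. f \<in> j)"

text \<open>The vector space structure of a fibre of the jet bundle is the one for which the fibre coordinates
  are linear. The dual of a fibre consists of its linear functionals, made unique as HOL functions
  by \<^const>\<open>extensional\<close>.\<close>

definition dual_fibre ::
    "('a, real^'m) manifold \<Rightarrow> ('b, real^'n) manifold \<Rightarrow> 'a \<Rightarrow> 'b \<Rightarrow> (('a \<Rightarrow> 'b) set \<Rightarrow> real) set"
  where "dual_fibre T M t x =
    {\<alpha> \<in> extensional (jet_fibre T M t x).
       \<forall>c\<in>atlas T. \<forall>d\<in>atlas M. t \<in> fst c \<longrightarrow> x \<in> fst d \<longrightarrow>
         (\<forall>j\<in>jet_fibre T M t x. \<forall>k\<in>jet_fibre T M t x. \<forall>l\<in>jet_fibre T M t x. \<forall>r s.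
            jet_coord c d t l = r *\<^sub>R jet_coord c d t j + s *\<^sub>R jet_coord c d t k
              \<longrightarrow> \<alpha> l = r * \<alpha> j + s * \<alpha> k)}"

type_synonym ('a, 'b) jet_dual_point = "'a \<times> 'b \<times> (('a \<Rightarrow> 'b) set \<Rightarrow> real)"

definition jet_dual ::
    "('a, real^'m) manifold \<Rightarrow> ('b, real^'n) manifold \<Rightarrow> ('a, 'b) jet_dual_point set"
  where "jet_dual T M =
    {(t, x, \<alpha>). t \<in> topspace (mtop T) \<and> x \<in> topspace (mtop M) \<and> \<alpha> \<in> dual_fibre T M t x}"

text \<open>\<open>momentum T M c d (t, x, \<alpha>) $ i $ a\<close> is \<open>p\<close> with lower index \<open>i\<close> and upper index \<open>a\<close>: the
  coordinates of \<open>\<alpha>\<close> dual to the fibre coordinates of the jet bundle.\<close>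

definition momentum ::
    "('a, real^'m) manifold \<Rightarrow> ('b, real^'n) manifold \<Rightarrow> ('a, real^'m) chart \<Rightarrow> ('b, real^'n) chart
      \<Rightarrow> ('a, 'b) jet_dual_point \<Rightarrow> real^'m^'n"
  where "momentum T M c d q = (case q of (t, x, \<alpha>) \<Rightarrow>
    THE p. \<forall>j\<in>jet_fibre T M t x.
      \<alpha> j = (\<Sum>i\<in>UNIV. \<Sum>a\<in>UNIV. p $ i $ a * jet_coord c d t j $ i $ a))"

definition induced_chart ::
    "('a, real^'m) manifold \<Rightarrow> ('b, real^'n) manifold \<Rightarrow> ('a, real^'m) chart \<Rightarrow> ('b, real^'n) chart
      \<Rightarrow> (('a, 'b) jet_dual_point, (real^'m) \<times> (real^'n) \<times> (real^'m^'n)) chart"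
  where "induced_chart T M c d =
    ({q \<in> jet_dual T M. fst q \<in> fst c \<and> fst (snd q) \<in> fst d},
     \<lambda>q. (snd c (fst q), snd d (fst (snd q)), momentum T M c d q))"

text \<open>The coordinate directions of \<open>t\<^sup>a\<close>, \<open>x\<^sup>i\<close> and of \<open>p\<close> with lower index \<open>i\<close> and upper
  index \<open>a\<close>.\<close>

definition dir_t :: "'m \<Rightarrow> (real^'m) \<times> (real^'n) \<times> (real^'m^'n)"
  where "dir_t a = (axis a 1, 0, 0)"

definition dir_x :: "'n \<Rightarrow> (real^'m) \<times> (real^'n) \<times> (real^'m^'n)"
  where "dir_x i = (0, axis i 1, 0)"

definition dir_p :: "'n \<Rightarrow> 'm \<Rightarrow> (real^'m) \<times> (real^'n) \<times> (real^'m^'n)"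
  where "dir_p i a = (0, 0, axis i (axis a 1))"

definition smooth_function ::
    "('a, real^'m) manifold \<Rightarrow> ('b, real^'n) manifold \<Rightarrow> (('a, 'b) jet_dual_point \<Rightarrow> real) \<Rightarrow> bool"
  where "smooth_function T M H \<longleftrightarrow>
    (\<forall>c\<in>atlas T. \<forall>d\<in>atlas M. smooth_in (induced_chart T M c d) H)"


section \<open>Kronecker regular Hamiltonians and nonlinear connections\<close>

text \<open>\<open>g c d q $ i $ j\<close> is the component \<open>g\<^sup>i\<^sup>j\<close>, in the chart induced by \<open>c\<close> and \<open>d\<close>, at the
  point \<open>q\<close>.\<close>

definition d_tensor ::
    "('a, real^'m) manifold \<Rightarrow> ('b, real^'n) manifold
      \<Rightarrow> (('a, real^'m) chart \<Rightarrow> ('b, real^'n) chart \<Rightarrow> ('a, 'b) jet_dual_point \<Rightarrow> real^'n^'n) \<Rightarrow> bool"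
  where "d_tensor T M g \<longleftrightarrow>
    (\<forall>c\<in>atlas T. \<forall>d\<in>atlas M. \<forall>i j. smooth_in (induced_chart T M c d) (\<lambda>q. g c d q $ i $ j)) \<and>
    (\<forall>c\<in>atlas T. \<forall>d\<in>atlas M. \<forall>c'\<in>atlas T. \<forall>d'\<in>atlas M.
     \<forall>q \<in> fst (induced_chart T M c d) \<inter> fst (induced_chart T M c' d'). \<forall>i j.
       g c d q $ i $ j =
         (\<Sum>k\<in>UNIV. \<Sum>l\<in>UNIV. g c' d' q $ k $ l
            * jac d' d (fst (snd q)) $ i $ k * jac d' d (fst (snd q)) $ j $ l))"

definition vertical_metric ::
    "('a, real^'m) manifold \<Rightarrow> ('b, real^'n) manifold
      \<Rightarrow> (('a, real^'m) chart \<Rightarrow> 'a \<Rightarrow> real^'m^'m)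
      \<Rightarrow> (('a, 'b) jet_dual_point \<Rightarrow> real)
      \<Rightarrow> (('a, real^'m) chart \<Rightarrow> ('b, real^'n) chart \<Rightarrow> ('a, 'b) jet_dual_point \<Rightarrow> real^'n^'n) \<Rightarrow> bool"
  where "vertical_metric T M h H g \<longleftrightarrow>
    d_tensor T M g \<and>
    (\<forall>c\<in>atlas T. \<forall>d\<in>atlas M. \<forall>q\<in>fst (induced_chart T M c d).
       transpose (g c d q) = g c d q \<and> rank (g c d q) = CARD('n)) \<and>
    (\<exists>s. \<forall>c\<in>atlas T. \<forall>d\<in>atlas M. \<forall>q\<in>fst (induced_chart T M c d). signature (g c d q) = s) \<and>
    (\<forall>c\<in>atlas T. \<forall>d\<in>atlas M. \<forall>q\<in>fst (induced_chart T M c d). \<forall>i j a b.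
       1/2 * pd (induced_chart T M c d) (dir_p i a) (pd (induced_chart T M c d) (dir_p j b) H) q
         = h c (fst q) $ a $ b * g c d q $ i $ j)"

definition kronecker_regular ::
    "('a, real^'m) manifold \<Rightarrow> ('b, real^'n) manifold
      \<Rightarrow> (('a, real^'m) chart \<Rightarrow> 'a \<Rightarrow> real^'m^'m)
      \<Rightarrow> (('a, 'b) jet_dual_point \<Rightarrow> real) \<Rightarrow> bool"
  where "kronecker_regular T M h H \<longleftrightarrow>
    smooth_function T M H \<and> (\<exists>g. vertical_metric T M h H g)"

text \<open>\<open>N1 c d q a i b\<close> and \<open>N2 c d q a i j\<close> are the components with upper index \<open>a\<close> and lower
  indices \<open>(i) b\<close> and \<open>(i) j\<close>, in the chart induced by \<open>c\<close> and \<open>d\<close>, at the point \<open>q\<close>. In the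
  transformation laws, primed charts are the ones carrying a tilde in the classical notation.\<close>

type_synonym ('a, 'b, 'm, 'n) temporal_components =
  "('a, real^'m) chart \<Rightarrow> ('b, real^'n) chart \<Rightarrow> ('a, 'b) jet_dual_point \<Rightarrow> 'm \<Rightarrow> 'n \<Rightarrow> 'm \<Rightarrow> real"

type_synonym ('a, 'b, 'm, 'n) spatial_components =
  "('a, real^'m) chart \<Rightarrow> ('b, real^'n) chart \<Rightarrow> ('a, 'b) jet_dual_point \<Rightarrow> 'm \<Rightarrow> 'n \<Rightarrow> 'n \<Rightarrow> real"

definition nonlinear_connection ::
    "('a, real^'m) manifold \<Rightarrow> ('b, real^'n) manifold
      \<Rightarrow> ('a, 'b, 'm, 'n) temporal_components \<Rightarrow> ('a, 'b, 'm, 'n) spatial_components \<Rightarrow> bool"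
  where "nonlinear_connection T M N1 N2 \<longleftrightarrow>
    (\<forall>c\<in>atlas T. \<forall>d\<in>atlas M.
       (\<forall>a i b. smooth_in (induced_chart T M c d) (\<lambda>q. N1 c d q a i b)) \<and>
       (\<forall>a i j. smooth_in (induced_chart T M c d) (\<lambda>q. N2 c d q a i j))) \<and>
    (\<forall>c\<in>atlas T. \<forall>d\<in>atlas M. \<forall>c'\<in>atlas T. \<forall>d'\<in>atlas M.
     \<forall>q \<in> fst (induced_chart T M c d) \<inter> fst (induced_chart T M c' d').
       (\<forall>b j e.
          N1 c' d' q b j e =
            (\<Sum>k\<in>UNIV. \<Sum>f\<in>UNIV. \<Sum>a\<in>UNIV. N1 c d q f k a
               * jac c c' (fst q) $ b $ f * jac d' d (fst (snd q)) $ k $ j * jac c' c (fst q) $ a $ e)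
            - (\<Sum>a\<in>UNIV. jac c' c (fst q) $ a $ e
               * pd (induced_chart T M c d) (dir_t a) (\<lambda>q. momentum T M c' d' q $ j $ b) q)) \<and>
       (\<forall>b j r.
          N2 c' d' q b j r =
            (\<Sum>k\<in>UNIV. \<Sum>f\<in>UNIV. \<Sum>i\<in>UNIV. N2 c d q f k i
               * jac c c' (fst q) $ b $ f * jac d' d (fst (snd q)) $ k $ j
               * jac d' d (fst (snd q)) $ i $ r)
            - (\<Sum>i\<in>UNIV. jac d' d (fst (snd q)) $ i $ r
               * pd (induced_chart T M c d) (dir_x i) (\<lambda>q. momentum T M c' d' q $ j $ b) q)))"

definition canonical_N1 ::
    "('a, real^'m) manifold \<Rightarrow> ('b, real^'n) manifold
      \<Rightarrow> (('a, real^'m) chart \<Rightarrow> 'a \<Rightarrow> real^'m^'m)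
      \<Rightarrow> ('a, 'b, 'm, 'n) temporal_components"
  where "canonical_N1 T M h c d q a i b =
    (\<Sum>e\<in>UNIV. christoffel h c a e b (fst q) * momentum T M c d q $ i $ e)"

definition canonical_N2 ::
    "('a, real^'m) manifold \<Rightarrow> ('b, real^'n) manifold
      \<Rightarrow> (('a, real^'m) chart \<Rightarrow> 'a \<Rightarrow> real^'m^'m)
      \<Rightarrow> (('a, 'b) jet_dual_point \<Rightarrow> real)
      \<Rightarrow> (('a, real^'m) chart \<Rightarrow> ('b, real^'n) chart \<Rightarrow> ('a, 'b) jet_dual_point \<Rightarrow> real^'n^'n)
      \<Rightarrow> ('a, 'b, 'm, 'n) spatial_components"
  where "canonical_N2 T M h H g c d q a i j =
    (let e = induced_chart T M c d;
         ginv = (\<lambda>i j q. matrix_inv (g c d q) $ i $ j)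
     in \<Sum>b\<in>UNIV. \<Sum>k\<in>UNIV. matrix_inv (h c (fst q)) $ a $ b / 4 *
          (pd e (dir_x k) (ginv i j) q * pd e (dir_p k b) H q
           - pd e (dir_p k b) (ginv i j) q * pd e (dir_x k) H q
           + ginv i k q * pd e (dir_x j) (pd e (dir_p k b) H) q
           + ginv j k q * pd e (dir_x i) (pd e (dir_p k b) H) q))"

end

theory Submission
  imports Defs
begin

text \<open>Both transformation laws are compared at one point of the overlap of two induced charts. There,
  with \<open>J\<close>, \<open>K\<close> the mutually inverse Jacobian matrices in time and \<open>A\<close>, \<open>B\<close> those in space, the
  momenta are related by \<open>p' = B\<^sup>T p J\<^sup>T\<close> (\<open>momentum_law\<close>), and a coordinate derivative \<open>\<partial>/\<partial>x\<^sup>i\<close> differs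
  from its tensorial image by a vertical derivative with coefficients \<open>S = \<partial>p'/\<partial>x\<close> (\<open>pd_dir_x\<close>).

  Temporal components. The inhomogeneous term in the law of the Christoffel symbols
  (\<open>christoffel_law\<close>) consists of the second derivatives of \<open>t\<close> with respect to \<open>t'\<close>. Contracted with
  the momenta, and because \<open>J K = 1\<close> may be differentiated, it is exactly the term
  \<open>- \<partial>t/\<partial>t' \<partial>p'/\<partial>t\<close> demanded of a nonlinear connection (\<open>canonical_N1_law\<close>).

  Spatial components. The bracketed expression is the bracket
  \<open>{g\<^sub>i\<^sub>j, H}\<^sub>b = \<partial>g\<^sub>i\<^sub>j/\<partial>x\<^sup>k \<partial>H/\<partial>p\<^sup>b\<^sub>k - \<partial>g\<^sub>i\<^sub>j/\<partial>p\<^sup>b\<^sub>k \<partial>H/\<partial>x\<^sup>k\<close> plus the symmetrized mixed derivatives of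
  \<open>H\<close> with one index lowered. Three things happen when it is carried to another chart.

  First, the vertical derivatives add to the bracket a term that contains \<open>S B\<close> and is antisymmetric
  in \<open>f\<close> and \<open>H\<close>. Since \<open>S B\<close> is a symmetric matrix, this term vanishes if there is one time. If there
  are several, it vanishes for another reason: the Hessian of \<open>H\<close> can factor as \<open>h\<^sub>a\<^sub>b g\<^sup>i\<^sup>j\<close> only if
  \<open>g\<^sup>i\<^sup>j\<close> does not depend on the momenta (\<open>pd_dir_p_g\<close>). So the bracket is tensorial on the components of
  the metric in either case (\<open>bracket_law\<close>).

  Second, the derivatives of the Jacobian matrices that come from \<open>g = A\<^sup>T g' A\<close> cancel those from the
  mixed derivatives of \<open>H\<close> (\<open>bracket_glow\<close>, \<open>mixed_law\<close>).

  Third, the vertical derivatives in the mixed terms produce the Hessian of \<open>H\<close>, which is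
  \<open>2 h\<^sub>a\<^sub>b g\<^sup>i\<^sup>j\<close>; the factors \<open>g\<^sub>i\<^sub>j\<close> and \<open>h\<^sup>a\<^sup>b / 4\<close> reduce it to \<open>A\<^sup>T S\<close>, twice one half of it by the
  symmetry of \<open>A\<^sup>T S\<close> (\<open>quad_law\<close>). This is the inhomogeneous term demanded of a nonlinear connection.

  All of this presupposes that the induced charts are charts: that jets correspond to arbitrary
  matrices (\<open>jet_coord_inj\<close>, \<open>jet_coord_surj\<close>), so that momenta exist, are unique and take all values
  (\<open>momentum_pairing\<close>, \<open>induced_image\<close>).\<close>

section \<open>Calculus of smooth maps on open sets\<close>

lemma k_smooth_on_Suc_imp: "k_smooth_on (Suc k) S f \<Longrightarrow> k_smooth_on k S f"
proof (induction k arbitrary: f)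
  case 0
  then show ?case
    by (auto intro!: differentiable_imp_continuous_on differentiable_at_imp_differentiable_on)
qed auto

lemma k_smooth_on_cong:
  assumes "open S" "\<And>x. x \<in> S \<Longrightarrow> f x = g x" "k_smooth_on k S f"
  shows "k_smooth_on k S g"
  using assms(2,3)
proof (induction k arbitrary: f g)
  case 0
  then show ?case by (simp cong: continuous_on_cong)
next
  case (Suc k)
  have diff: "g differentiable (at x)" if "x \<in> S" for x
    using has_derivative_transform_within_open[where f = f, OF _ assms(1) that Suc.prems(1)]
      Suc.prems(2) that
    unfolding differentiable_def k_smooth_on.simps by blast
  have eq: "frechet_derivative f (at x) = frechet_derivative g (at x)" if "x \<in> S" for x
    using Suc.prems that assms(1) by (intro frechet_derivative_transform_within_open) auto
  show ?case
    using Suc.prems diff eq by (auto intro: Suc.IH[of "\<lambda>x. frechet_derivative f (at x) _"])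
qed

lemma k_smooth_on_const: "k_smooth_on k S (\<lambda>x. c)"
  by (induction k arbitrary: c) auto

lemma frechet_derivative_bounded_linear_compose:
  assumes "bounded_linear L" "f differentiable (at x)"
  shows "frechet_derivative (\<lambda>x. L (f x)) (at x) = (\<lambda>v. L (frechet_derivative f (at x) v))"
  using bounded_linear.has_derivative[OF assms(1)] assms(2)
  by (intro frechet_derivative_at[symmetric]) (simp add: frechet_derivative_works)

lemma k_smooth_on_bounded_linear:
  assumes "bounded_linear L" "open S" "k_smooth_on k S f"
  shows "k_smooth_on k S (\<lambda>x. L (f x))"
  using assms(3)
proof (induction k arbitrary: f)
  case 0
  then show ?case
    using bounded_linear.continuous_on[OF assms(1)] by simp
next
  case (Suc k)
  have "(\<lambda>x. L (f x)) differentiable (at x)" if "x \<in> S" for x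
    using Suc.prems that bounded_linear.has_derivative[OF assms(1)]
    unfolding differentiable_def k_smooth_on.simps by blast
  moreover have "k_smooth_on k S (\<lambda>x. frechet_derivative (\<lambda>x. L (f x)) (at x) v)" for v
    by (rule k_smooth_on_cong[OF assms(2) _ Suc.IH[of "\<lambda>x. frechet_derivative f (at x) v"]])
      (use Suc.prems in \<open>auto simp: frechet_derivative_bounded_linear_compose[OF assms(1)]\<close>)
  ultimately show ?case by simp
qed

lemma k_smooth_on_linear:
  assumes "bounded_linear L"
  shows "k_smooth_on k S L"
proof (cases k)
  case 0
  then show ?thesis using assms by (simp add: linear_continuous_on)
next
  case (Suc l)
  have "frechet_derivative L (at x) = L" for x
    using bounded_linear_imp_has_derivative[OF assms] by (metis frechet_derivative_at)
  then show ?thesis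
    using assms bounded_linear_imp_differentiable
    by (auto simp: Suc k_smooth_on_const)
qed

lemma k_smooth_on_add:
  assumes "open S" "k_smooth_on k S f" "k_smooth_on k S g"
  shows "k_smooth_on k S (\<lambda>x. f x + g x)"
  using assms(2,3)
proof (induction k arbitrary: f g)
  case (Suc k)
  have "k_smooth_on k S (\<lambda>x. frechet_derivative (\<lambda>x. f x + g x) (at x) v)" for v
  proof (rule k_smooth_on_cong[OF assms(1) _ Suc.IH[of "\<lambda>x. frechet_derivative f (at x) v"
          "\<lambda>x. frechet_derivative g (at x) v"]])
    fix x assume "x \<in> S"
    then have "((\<lambda>x. f x + g x) has_derivative
        (\<lambda>v. frechet_derivative f (at x) v + frechet_derivative g (at x) v)) (at x)"
      using Suc.prems by (intro has_derivative_add) (auto simp: frechet_derivative_works)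
    from fun_cong[OF frechet_derivative_at[OF this], of v]
    show "frechet_derivative f (at x) v + frechet_derivative g (at x) v
        = frechet_derivative (\<lambda>x. f x + g x) (at x) v" .
  qed (use Suc.prems in auto)
  with Suc.prems show ?case by (auto intro: differentiable_add)
qed (auto intro: continuous_on_add)

lemma k_smooth_on_mult:
  fixes f g :: "'a::euclidean_space \<Rightarrow> real"
  assumes "open S" "k_smooth_on k S f" "k_smooth_on k S g"
  shows "k_smooth_on k S (\<lambda>x. f x * g x)"
  using assms(2,3)
proof (induction k arbitrary: f g)
  case (Suc k)
  have "k_smooth_on k S (\<lambda>x. frechet_derivative (\<lambda>x. f x * g x) (at x) v)" for v
  proof (rule k_smooth_on_cong[OF assms(1) _ k_smooth_on_add[OF assms(1)
          Suc.IH[of f "\<lambda>x. frechet_derivative g (at x) v"]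
          Suc.IH[of "\<lambda>x. frechet_derivative f (at x) v" g]]])
    fix x assume "x \<in> S"
    then have "((\<lambda>x. f x * g x) has_derivative
        (\<lambda>v. f x * frechet_derivative g (at x) v + frechet_derivative f (at x) v * g x)) (at x)"
      using Suc.prems by (intro has_derivative_mult) (auto simp: frechet_derivative_works)
    from fun_cong[OF frechet_derivative_at[OF this], of v]
    show "f x * frechet_derivative g (at x) v + frechet_derivative f (at x) v * g x
        = frechet_derivative (\<lambda>x. f x * g x) (at x) v" .
  qed (use Suc.prems k_smooth_on_Suc_imp in auto)
  with Suc.prems show ?case by (auto intro: differentiable_mult)
qed (auto intro: continuous_on_mult)

lemma k_smooth_on_inverse:
  fixes f :: "'a::euclidean_space \<Rightarrow> real"
  assumes "open S" "\<And>x. x \<in> S \<Longrightarrow> f x \<noteq> 0" "k_smooth_on k S f"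
  shows "k_smooth_on k S (\<lambda>x. inverse (f x))"
  using assms(3)
proof (induction k)
  case (Suc k)
  have deriv: "((\<lambda>x. inverse (f x)) has_derivative
        (\<lambda>v. - (inverse (f x) * frechet_derivative f (at x) v * inverse (f x)))) (at x)"
    if "x \<in> S" for x
    using Suc.prems that assms(2)
    by (intro Deriv.has_derivative_inverse) (auto simp: frechet_derivative_works)
  have "k_smooth_on k S (\<lambda>x. frechet_derivative (\<lambda>x. inverse (f x)) (at x) v)" for v
  proof (rule k_smooth_on_cong[OF assms(1)])
    show "k_smooth_on k S (\<lambda>x. (-1) * (inverse (f x) * frechet_derivative f (at x) v * inverse (f x)))"
      using Suc k_smooth_on_Suc_imp
      by (intro k_smooth_on_mult[OF assms(1)] k_smooth_on_const) auto
  qed (use frechet_derivative_at[OF deriv] in \<open>auto simp: fun_eq_iff\<close>)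
  with deriv show ?case by (auto simp: differentiable_def)
qed (use assms in \<open>auto intro: continuous_on_inverse\<close>)

lemma k_smooth_on_compose_linear:
  assumes L: "bounded_linear L" and "L ` S' \<subseteq> S" "open S'" "k_smooth_on k S f"
  shows "k_smooth_on k S' (\<lambda>x. f (L x))"
  using assms(4)
proof (induction k arbitrary: f)
  case 0
  then show ?case
    using assms(2) linear_continuous_on[OF L] by (auto intro: continuous_on_compose2)
next
  case (Suc k)
  have deriv: "((\<lambda>x. f (L x)) has_derivative (\<lambda>v. frechet_derivative f (at (L x)) (L v))) (at x)"
    if "x \<in> S'" for x
    using Suc.prems that assms(2)
    by (intro has_derivative_compose[OF bounded_linear_imp_has_derivative[OF L]])
      (auto simp: frechet_derivative_works)
  have "k_smooth_on k S' (\<lambda>x. frechet_derivative (\<lambda>x. f (L x)) (at x) v)" for v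
    by (rule k_smooth_on_cong[OF assms(3) _ Suc.IH[of "\<lambda>x. frechet_derivative f (at x) (L v)"]])
      (use Suc.prems frechet_derivative_at[OF deriv] in \<open>auto simp: fun_eq_iff\<close>)
  with deriv show ?case by (auto simp: differentiable_def)
qed

lemma smooth_on_differentiable: "smooth_on S f \<Longrightarrow> x \<in> S \<Longrightarrow> f differentiable (at x)"
  unfolding smooth_on_def by (auto dest: spec[of _ "Suc 0"])

lemma smooth_on_frechet_derivative:
  "smooth_on S f \<Longrightarrow> smooth_on S (\<lambda>x. frechet_derivative f (at x) v)"
  unfolding smooth_on_def
proof
  fix k
  assume "\<forall>k. k_smooth_on k S f"
  then have "k_smooth_on (Suc k) S f" by blast
  then show "k_smooth_on k S (\<lambda>x. frechet_derivative f (at x) v)" by simp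
qed

lemma smooth_on_cong:
  "open S \<Longrightarrow> (\<And>x. x \<in> S \<Longrightarrow> f x = g x) \<Longrightarrow> smooth_on S f \<Longrightarrow> smooth_on S g"
  unfolding smooth_on_def by (blast intro: k_smooth_on_cong)

lemma smooth_on_const: "smooth_on S (\<lambda>x. c)"
  by (simp add: smooth_on_def k_smooth_on_const)

lemma smooth_on_linear: "bounded_linear L \<Longrightarrow> smooth_on S L"
  by (simp add: smooth_on_def k_smooth_on_linear)

lemma smooth_on_bounded_linear:
  "bounded_linear L \<Longrightarrow> open S \<Longrightarrow> smooth_on S f \<Longrightarrow> smooth_on S (\<lambda>x. L (f x))"
  by (simp add: smooth_on_def k_smooth_on_bounded_linear)

lemma smooth_on_add:
  "open S \<Longrightarrow> smooth_on S f \<Longrightarrow> smooth_on S g \<Longrightarrow> smooth_on S (\<lambda>x. f x + g x)"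
  by (simp add: smooth_on_def k_smooth_on_add)

lemma smooth_on_mult:
  fixes f g :: "'a::euclidean_space \<Rightarrow> real"
  shows "open S \<Longrightarrow> smooth_on S f \<Longrightarrow> smooth_on S g \<Longrightarrow> smooth_on S (\<lambda>x. f x * g x)"
  by (simp add: smooth_on_def k_smooth_on_mult)

lemma smooth_on_inverse:
  fixes f :: "'a::euclidean_space \<Rightarrow> real"
  shows "open S \<Longrightarrow> smooth_on S f \<Longrightarrow> (\<And>x. x \<in> S \<Longrightarrow> f x \<noteq> 0) \<Longrightarrow> smooth_on S (\<lambda>x. inverse (f x))"
  by (simp add: smooth_on_def k_smooth_on_inverse)

lemma smooth_on_compose_linear:
  assumes "bounded_linear L" "L ` S' \<subseteq> S" "open S'" "smooth_on S f"
  shows "smooth_on S' (\<lambda>x. f (L x))"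
  using assms by (auto simp: smooth_on_def intro: k_smooth_on_compose_linear)

lemma smooth_on_continuous_on: "smooth_on S f \<Longrightarrow> continuous_on S f"
  unfolding smooth_on_def by (auto dest: spec[of _ 0])

text \<open>The mean value theorem is applied first in the direction \<open>v\<close>, to the difference of \<open>f\<close> on two
  parallel segments, and then in the direction \<open>w\<close>, to the derivative of \<open>f\<close> along \<open>v\<close>. The left-hand
  side is symmetric in \<open>v\<close> and \<open>w\<close>, which is the source of the symmetry of second derivatives.\<close>

lemma second_difference_mean_value:
  fixes f :: "'a::euclidean_space \<Rightarrow> real"
  assumes S: "\<And>s t. 0 \<le> s \<Longrightarrow> s \<le> r \<Longrightarrow> 0 \<le> t \<Longrightarrow> t \<le> r \<Longrightarrow> x + s *\<^sub>R v + t *\<^sub>R w \<in> S"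
    and f: "smooth_on S f" and "0 < r"
  shows "\<exists>s t. 0 \<le> s \<and> s \<le> r \<and> 0 \<le> t \<and> t \<le> r \<and>
    f (x + r *\<^sub>R v + r *\<^sub>R w) - f (x + r *\<^sub>R v) - f (x + r *\<^sub>R w) + f x
      = r * r * frechet_derivative (\<lambda>y. frechet_derivative f (at y) v) (at (x + s *\<^sub>R v + t *\<^sub>R w)) w"
proof -
  have along: "((\<lambda>s. F (a + s *\<^sub>R u)) has_real_derivative frechet_derivative F (at (a + s *\<^sub>R u)) u) (at s)"
    if "smooth_on S F" "a + s *\<^sub>R u \<in> S" for F :: "'a \<Rightarrow> real" and a u s
  proof -
    have F: "(F has_derivative frechet_derivative F (at (a + s *\<^sub>R u))) (at (a + s *\<^sub>R u))"
      using smooth_on_differentiable[OF that] by (simp add: frechet_derivative_works)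
    have "((\<lambda>s. F (a + s *\<^sub>R u)) has_derivative
        (\<lambda>h. frechet_derivative F (at (a + s *\<^sub>R u)) (h *\<^sub>R u))) (at s)"
      by (rule has_derivative_compose[where f = "\<lambda>s. a + s *\<^sub>R u" and g = F])
        (auto intro!: derivative_eq_intros F)
    moreover have "frechet_derivative F (at (a + s *\<^sub>R u)) (h *\<^sub>R u)
        = frechet_derivative F (at (a + s *\<^sub>R u)) u * h" for h
      using has_derivative_linear[OF F] by (simp add: linear_cmul)
    ultimately show ?thesis by (simp add: has_field_derivative_def mult_commute_abs)
  qed
  define \<phi> where "\<phi> s = f ((x + r *\<^sub>R w) + s *\<^sub>R v) - f (x + s *\<^sub>R v)" for s
  define G where "G = (\<lambda>y. frechet_derivative f (at y) v)"
  have G: "smooth_on S G"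
    unfolding G_def by (rule smooth_on_frechet_derivative[OF f])
  have "(\<phi> has_real_derivative G ((x + r *\<^sub>R w) + s *\<^sub>R v) - G (x + s *\<^sub>R v)) (at s)"
    if "0 \<le> s" "s \<le> r" for s
    unfolding \<phi>_def G_def
    using S[of s r] S[of s 0] that \<open>0 < r\<close>
    by (intro DERIV_diff along[OF f]) (auto simp: algebra_simps)
  from MVT2[OF \<open>0 < r\<close> this] obtain s where s: "0 < s" "s < r"
    "\<phi> r - \<phi> 0 = r * (G ((x + r *\<^sub>R w) + s *\<^sub>R v) - G (x + s *\<^sub>R v))" by auto
  have "((\<lambda>t. G ((x + s *\<^sub>R v) + t *\<^sub>R w)) has_real_derivative
      frechet_derivative G (at ((x + s *\<^sub>R v) + t *\<^sub>R w)) w) (at t)" if "0 \<le> t" "t \<le> r" for t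
    using S[of s t] that s by (intro along[OF G]) auto
  from MVT2[OF \<open>0 < r\<close> this] obtain t where t: "0 < t" "t < r"
    "G ((x + s *\<^sub>R v) + r *\<^sub>R w) - G (x + s *\<^sub>R v)
      = r * frechet_derivative G (at ((x + s *\<^sub>R v) + t *\<^sub>R w)) w" by auto
  show ?thesis
    using s t unfolding G_def \<phi>_def
    by (intro exI[of _ s] exI[of _ t]) (auto simp: algebra_simps)
qed

text \<open>If the two mixed derivatives differed at \<open>x\<close>, their values would stay apart near \<open>x\<close>; but on a
  small parallelogram a value of one equals a value of the other.\<close>

lemma smooth_on_second_derivative_symmetric:
  fixes f :: "'a::euclidean_space \<Rightarrow> real"
  assumes f: "smooth_on S f" and "open S" "x \<in> S"
  shows "frechet_derivative (\<lambda>y. frechet_derivative f (at y) v) (at x) w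
    = frechet_derivative (\<lambda>y. frechet_derivative f (at y) w) (at x) v"
proof (rule ccontr)
  define P where "P = (\<lambda>y. frechet_derivative (\<lambda>y. frechet_derivative f (at y) v) (at y) w)"
  define Q where "Q = (\<lambda>y. frechet_derivative (\<lambda>y. frechet_derivative f (at y) w) (at y) v)"
  assume "\<not> ?thesis"
  then have "P x \<noteq> Q x" by (simp add: P_def Q_def)
  define e where "e = \<bar>P x - Q x\<bar> / 2"
  have "e > 0" using \<open>P x \<noteq> Q x\<close> by (simp add: e_def)
  have "continuous_on S P" "continuous_on S Q"
    unfolding P_def Q_def
    by (intro smooth_on_continuous_on smooth_on_frechet_derivative f)+
  then have "isCont P x" "isCont Q x"
    using assms by (auto simp: continuous_on_eq_continuous_at)
  then obtain d1 d2 where d1: "d1 > 0" "\<And>y. dist y x < d1 \<Longrightarrow> dist (P y) (P x) < e"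
    and d2: "d2 > 0" "\<And>y. dist y x < d2 \<Longrightarrow> dist (Q y) (Q x) < e"
    using \<open>e > 0\<close> unfolding continuous_at_eps_delta by metis
  obtain d3 where d3: "d3 > 0" "ball x d3 \<subseteq> S"
    using assms openE by blast
  \<comment> \<open>The parallelogram with sides \<open>r v\<close> and \<open>r w\<close> has diameter at most \<open>d / 2\<close>; the summand 1 keeps
    the denominator positive if \<open>v = w = 0\<close>.\<close>
  define d where "d = min d1 (min d2 d3)"
  define r where "r = d / (2 * (norm v + norm w + 1))"
  have den: "norm v + norm w + 1 > 0" by (simp add: add_nonneg_pos)
  have "d > 0" using d1 d2 d3 by (simp add: d_def)
  have "r > 0" using \<open>d > 0\<close> den by (simp add: r_def)
  have near: "dist (x + s *\<^sub>R v + t *\<^sub>R w) x < d" if "0 \<le> s" "s \<le> r" "0 \<le> t" "t \<le> r" for s t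
  proof -
    have "dist (x + s *\<^sub>R v + t *\<^sub>R w) x = norm (s *\<^sub>R v + t *\<^sub>R w)"
      by (simp add: dist_norm algebra_simps)
    also have "\<dots> \<le> s * norm v + t * norm w"
      using that by (intro order.trans[OF norm_triangle_ineq]) auto
    also have "\<dots> \<le> r * norm v + r * norm w"
      using that by (intro add_mono mult_right_mono) auto
    also have "\<dots> \<le> r * (norm v + norm w + 1)"
      using \<open>r > 0\<close> by (simp add: algebra_simps)
    also have "\<dots> = d / 2"
      using den by (simp add: r_def field_simps)
    also have "\<dots> < d" using \<open>d > 0\<close> by simp
    finally show ?thesis .
  qed
  have "x + s *\<^sub>R v + t *\<^sub>R w \<in> S" if "0 \<le> s" "s \<le> r" "0 \<le> t" "t \<le> r" for s t
    using near[OF that] d3 by (auto simp: d_def dist_commute)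
  from second_difference_mean_value[OF this f \<open>r > 0\<close>]
  obtain s t where st: "0 \<le> s" "s \<le> r" "0 \<le> t" "t \<le> r"
    "f (x + r *\<^sub>R v + r *\<^sub>R w) - f (x + r *\<^sub>R v) - f (x + r *\<^sub>R w) + f x
      = r * r * P (x + s *\<^sub>R v + t *\<^sub>R w)"
    unfolding P_def by blast
  have "x + s *\<^sub>R w + t *\<^sub>R v \<in> S" if "0 \<le> s" "s \<le> r" "0 \<le> t" "t \<le> r" for s t
    using near[of t s] that d3 by (auto simp: d_def dist_commute add_ac)
  from second_difference_mean_value[OF this f \<open>r > 0\<close>]
  obtain s' t' where st': "0 \<le> s'" "s' \<le> r" "0 \<le> t'" "t' \<le> r"
    "f (x + r *\<^sub>R w + r *\<^sub>R v) - f (x + r *\<^sub>R w) - f (x + r *\<^sub>R v) + f x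
      = r * r * Q (x + s' *\<^sub>R w + t' *\<^sub>R v)"
    unfolding Q_def by blast
  have "r * r * P (x + s *\<^sub>R v + t *\<^sub>R w) = r * r * Q (x + t' *\<^sub>R v + s' *\<^sub>R w)"
    using st(5) st'(5) by (simp add: algebra_simps)
  then have "P (x + s *\<^sub>R v + t *\<^sub>R w) = Q (x + t' *\<^sub>R v + s' *\<^sub>R w)"
    using \<open>r > 0\<close> by simp
  moreover have "dist (P (x + s *\<^sub>R v + t *\<^sub>R w)) (P x) < e"
    using near[of s t] st by (intro d1) (auto simp: d_def)
  moreover have "dist (Q (x + t' *\<^sub>R v + s' *\<^sub>R w)) (Q x) < e"
    using near[of t' s'] st' by (intro d2) (auto simp: d_def)
  ultimately show False
    unfolding e_def dist_real_def by (simp add: abs_real_def split: if_splits)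
qed

section \<open>Partial derivatives in charts\<close>

text \<open>What the calculus of partial derivatives needs to know about a chart. No topology on the points
  is involved, so that the notion applies to the dual jet bundle, which is a bare set.\<close>

definition coord_chart :: "('p, 'e::euclidean_space) chart \<Rightarrow> bool"
  where "coord_chart c \<longleftrightarrow> inj_on (snd c) (fst c) \<and> open (snd c ` fst c)"

definition diff_at :: "('p, 'e::euclidean_space) chart \<Rightarrow> ('p \<Rightarrow> real) \<Rightarrow> 'p \<Rightarrow> bool"
  where "diff_at c f p \<longleftrightarrow> (f \<circ> chart_inv c) differentiable (at (snd c p))"

definition diff_transition :: "('p, 'e::euclidean_space) chart \<Rightarrow> ('p, 'e) chart \<Rightarrow> bool"
  where "diff_transition c c' \<longleftrightarrow>
    coord_chart c \<and> coord_chart c' \<and> open (snd c ` (fst c \<inter> fst c')) \<and>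
    (\<forall>p \<in> fst c \<inter> fst c'. (snd c' \<circ> chart_inv c) differentiable (at (snd c p)))"

lemma chart_inv_snd [simp]: "coord_chart c \<Longrightarrow> p \<in> fst c \<Longrightarrow> chart_inv c (snd c p) = p"
  by (simp add: coord_chart_def chart_inv_def)

lemma chart_inv_in: "y \<in> snd c ` fst c \<Longrightarrow> chart_inv c y \<in> fst c"
  by (simp add: chart_inv_def inv_into_into)

lemma snd_chart_inv: "y \<in> snd c ` fst c \<Longrightarrow> snd c (chart_inv c y) = y"
  by (simp add: chart_inv_def f_inv_into_f)

lemma diff_at_has_derivative:
  "diff_at c f p \<longleftrightarrow> ((f \<circ> chart_inv c) has_derivative (\<lambda>v. pd c v f p)) (at (snd c p))"
  unfolding diff_at_def pd_def by (simp add: frechet_derivative_works)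

lemma pd_eqI:
  "((f \<circ> chart_inv c) has_derivative D) (at (snd c p)) \<Longrightarrow> pd c v f p = D v"
  unfolding pd_def by (metis frechet_derivative_at)

lemma diff_atI:
  "((f \<circ> chart_inv c) has_derivative D) (at (snd c p)) \<Longrightarrow> diff_at c f p"
  unfolding diff_at_def differentiable_def by blast

text \<open>Partial derivatives are local: equations that hold only on the overlap of two charts may be
  differentiated there.\<close>

lemma local_has_derivative_cong:
  assumes "coord_chart c" "U \<subseteq> fst c" "open (snd c ` U)" "p \<in> U" "\<And>s. s \<in> U \<Longrightarrow> f s = g s"
  shows "((f \<circ> chart_inv c) has_derivative D) (at (snd c p))
    \<longleftrightarrow> ((g \<circ> chart_inv c) has_derivative D) (at (snd c p))"
proof -
  have "(f \<circ> chart_inv c) y = (g \<circ> chart_inv c) y" if "y \<in> snd c ` U" for y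
    using that assms by auto
  then show ?thesis
    using has_derivative_transform_within_open[OF _ assms(3), of _ _ "snd c p"] assms(4)
    by (metis (no_types, lifting) imageI)
qed

lemma diff_at_cong:
  assumes "coord_chart c" "U \<subseteq> fst c" "open (snd c ` U)" "p \<in> U" "\<And>s. s \<in> U \<Longrightarrow> f s = g s"
  shows "diff_at c f p \<longleftrightarrow> diff_at c g p"
  unfolding diff_at_def differentiable_def
  using local_has_derivative_cong[OF assms] by simp

lemma pd_cong:
  assumes "coord_chart c" "U \<subseteq> fst c" "open (snd c ` U)" "p \<in> U" "\<And>s. s \<in> U \<Longrightarrow> f s = g s"
  shows "pd c v f p = pd c v g p"
  unfolding pd_def frechet_derivative_def
  using local_has_derivative_cong[OF assms] by simp

lemma diff_at_const [simp, intro]: "diff_at c (\<lambda>s. k) p"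
  by (simp add: diff_at_def o_def)

lemma pd_const [simp]: "pd c v (\<lambda>s. k) p = 0"
  by (simp add: pd_def o_def)

lemma has_derivative_pd_mult:
  assumes "diff_at c f p" "diff_at c g p" "coord_chart c" "p \<in> fst c"
  shows "((\<lambda>s. f s * g s) \<circ> chart_inv c has_derivative
    (\<lambda>v. pd c v f p * g p + f p * pd c v g p)) (at (snd c p))"
  using has_derivative_mult[OF assms(1,2)[unfolded diff_at_has_derivative]] assms(3,4)
  by (simp add: o_def add.commute)

lemma diff_at_mult:
  assumes "coord_chart c" "p \<in> fst c" "diff_at c f p" "diff_at c g p"
  shows "diff_at c (\<lambda>s. f s * g s) p"
  by (rule diff_atI[OF has_derivative_pd_mult[OF assms(3,4,1,2)]])

lemma pd_mult:
  assumes "coord_chart c" "p \<in> fst c" "diff_at c f p" "diff_at c g p"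
  shows "pd c v (\<lambda>s. f s * g s) p = pd c v f p * g p + f p * pd c v g p"
  by (rule pd_eqI[OF has_derivative_pd_mult[OF assms(3,4,1,2)]])

lemma has_derivative_pd_sum:
  assumes "\<And>i. i \<in> I \<Longrightarrow> diff_at c (f i) p"
  shows "((\<lambda>s. \<Sum>i\<in>I. f i s) \<circ> chart_inv c has_derivative (\<lambda>v. \<Sum>i\<in>I. pd c v (f i) p)) (at (snd c p))"
  using has_derivative_sum[of I "\<lambda>i. f i \<circ> chart_inv c"] assms
  unfolding diff_at_has_derivative by (simp add: o_def)

lemma diff_at_sum: "(\<And>i. i \<in> I \<Longrightarrow> diff_at c (f i) p) \<Longrightarrow> diff_at c (\<lambda>s. \<Sum>i\<in>I. f i s) p"
  by (rule diff_atI[OF has_derivative_pd_sum])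

lemma pd_sum:
  "(\<And>i. i \<in> I \<Longrightarrow> diff_at c (f i) p) \<Longrightarrow> pd c v (\<lambda>s. \<Sum>i\<in>I. f i s) p = (\<Sum>i\<in>I. pd c v (f i) p)"
  by (rule pd_eqI[OF has_derivative_pd_sum])

lemma pd_sum_Basis:
  assumes "diff_at c f p"
  shows "pd c v f p = (\<Sum>b\<in>Basis. (v \<bullet> b) * pd c b f p)"
proof -
  have "linear (\<lambda>v. pd c v f p)"
    using assms has_derivative_linear unfolding diff_at_has_derivative by blast
  from linear_sum[OF this, of "\<lambda>b. (v \<bullet> b) *\<^sub>R b" Basis] linear_scale[OF this]
  show ?thesis by (simp add: euclidean_representation)
qed

lemma has_derivative_change_chart:
  assumes cc': "diff_transition c c'" and p: "p \<in> fst c" "p \<in> fst c'" and f: "diff_at c' f p"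
  shows "((f \<circ> chart_inv c) has_derivative
    (\<lambda>v. \<Sum>b\<in>Basis. pd c v (\<lambda>s. snd c' s \<bullet> b) p * pd c' b f p)) (at (snd c p))"
proof -
  let ?U = "fst c \<inter> fst c'"
  let ?\<Phi> = "snd c' \<circ> chart_inv c"
  have c: "coord_chart c" and c': "coord_chart c'" and U: "open (snd c ` ?U)"
    using cc' by (auto simp: diff_transition_def)
  obtain D where D: "(?\<Phi> has_derivative D) (at (snd c p))"
    using cc' p unfolding diff_transition_def differentiable_def by blast
  have "((f \<circ> chart_inv c' \<circ> ?\<Phi>) has_derivative ((\<lambda>v. pd c' v f p) \<circ> D)) (at (snd c p))"
    by (rule diff_chain_at[OF D]) (use f c p in \<open>simp add: diff_at_has_derivative\<close>)
  moreover have "(f \<circ> chart_inv c' \<circ> ?\<Phi>) y = (f \<circ> chart_inv c) y" if "y \<in> snd c ` ?U" for y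
    using that c c' by auto
  ultimately have "((f \<circ> chart_inv c) has_derivative ((\<lambda>v. pd c' v f p) \<circ> D)) (at (snd c p))"
    using U p by (elim has_derivative_transform_within_open) auto
  moreover have "pd c v (\<lambda>s. snd c' s \<bullet> b) p = D v \<bullet> b" for v b
    using has_derivative_inner_left[OF D, of b] by (intro pd_eqI) (simp add: o_def)
  moreover have "pd c' (D v) f p = (\<Sum>b\<in>Basis. (D v \<bullet> b) * pd c' b f p)" for v
    by (rule pd_sum_Basis[OF f])
  ultimately show ?thesis by (simp add: o_def)
qed

lemma diff_at_change_chart:
  "diff_transition c c' \<Longrightarrow> p \<in> fst c \<Longrightarrow> p \<in> fst c' \<Longrightarrow> diff_at c' f p \<Longrightarrow> diff_at c f p"
  by (rule diff_atI[OF has_derivative_change_chart])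

lemma pd_change_chart:
  "diff_transition c c' \<Longrightarrow> p \<in> fst c \<Longrightarrow> p \<in> fst c' \<Longrightarrow> diff_at c' f p \<Longrightarrow>
    pd c v f p = (\<Sum>b\<in>Basis. pd c v (\<lambda>s. snd c' s \<bullet> b) p * pd c' b f p)"
  by (rule pd_eqI[OF has_derivative_change_chart])

section \<open>Smooth functions in a chart\<close>

lemma smooth_in_diff_at: "smooth_in c f \<Longrightarrow> p \<in> fst c \<Longrightarrow> diff_at c f p"
  unfolding smooth_in_def diff_at_def by (simp add: smooth_on_differentiable)

lemma smooth_in_cong:
  assumes "coord_chart c" "\<And>p. p \<in> fst c \<Longrightarrow> f p = g p" "smooth_in c f"
  shows "smooth_in c g"
  using assms chart_inv_in[of _ c] unfolding smooth_in_def coord_chart_def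
  by (intro smooth_on_cong[of _ "f \<circ> chart_inv c" "g \<circ> chart_inv c"]) auto

lemma smooth_in_const: "smooth_in c (\<lambda>p. k)"
  by (simp add: smooth_in_def o_def smooth_on_const)

lemma smooth_in_add:
  "coord_chart c \<Longrightarrow> smooth_in c f \<Longrightarrow> smooth_in c g \<Longrightarrow> smooth_in c (\<lambda>p. f p + g p)"
  unfolding smooth_in_def coord_chart_def
  using smooth_on_add[of _ "f \<circ> chart_inv c" "g \<circ> chart_inv c"] by (simp add: o_def)

lemma smooth_in_mult:
  "coord_chart c \<Longrightarrow> smooth_in c f \<Longrightarrow> smooth_in c g \<Longrightarrow> smooth_in c (\<lambda>p. f p * g p)"
  unfolding smooth_in_def coord_chart_def
  using smooth_on_mult[of _ "f \<circ> chart_inv c" "g \<circ> chart_inv c"] by (simp add: o_def)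

lemma smooth_in_diff:
  "coord_chart c \<Longrightarrow> smooth_in c f \<Longrightarrow> smooth_in c g \<Longrightarrow> smooth_in c (\<lambda>p. f p - g p)"
  using smooth_in_add[of c f "\<lambda>p. (-1) * g p"] smooth_in_mult[of c "\<lambda>p. -1" g] smooth_in_const[of c "-1"]
  by simp

lemma smooth_in_inverse:
  "coord_chart c \<Longrightarrow> smooth_in c f \<Longrightarrow> (\<And>p. p \<in> fst c \<Longrightarrow> f p \<noteq> 0) \<Longrightarrow> smooth_in c (\<lambda>p. inverse (f p))"
  unfolding smooth_in_def coord_chart_def o_def
  by (rule smooth_on_inverse) (auto simp: chart_inv_def)

lemma smooth_in_divide_const:
  "coord_chart c \<Longrightarrow> smooth_in c f \<Longrightarrow> smooth_in c (\<lambda>p. f p / k)"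
  using smooth_in_mult[of c f "\<lambda>p. inverse k"] smooth_in_const[of c "inverse k"]
  by (simp add: divide_inverse)

lemma smooth_in_sum:
  "coord_chart c \<Longrightarrow> (\<And>i. i \<in> I \<Longrightarrow> smooth_in c (f i)) \<Longrightarrow> smooth_in c (\<lambda>p. \<Sum>i\<in>I. f i p)"
  by (induction I rule: infinite_finite_induct) (auto intro: smooth_in_const smooth_in_add)

lemma smooth_in_prod:
  "coord_chart c \<Longrightarrow> (\<And>i. i \<in> I \<Longrightarrow> smooth_in c (f i)) \<Longrightarrow> smooth_in c (\<lambda>p. \<Prod>i\<in>I. f i p)"
  by (induction I rule: infinite_finite_induct) (auto intro: smooth_in_const smooth_in_mult)

lemma smooth_in_pd:
  assumes "coord_chart c" "smooth_in c f"
  shows "smooth_in c (pd c v f)"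
proof -
  have "smooth_on (snd c ` fst c) (\<lambda>y. frechet_derivative (f \<circ> chart_inv c) (at y) v)"
    using assms(2) unfolding smooth_in_def by (rule smooth_on_frechet_derivative)
  then show ?thesis
    unfolding smooth_in_def
  proof (rule smooth_on_cong[rotated 2])
    show "open (snd c ` fst c)" using assms(1) by (simp add: coord_chart_def)
    fix y assume "y \<in> snd c ` fst c"
    then show "frechet_derivative (f \<circ> chart_inv c) (at y) v = (pd c v f \<circ> chart_inv c) y"
      by (simp add: pd_def snd_chart_inv)
  qed
qed

text \<open>The coordinates of one chart are smooth in another only on the overlap, hence the set \<open>U\<close>.\<close>

lemma pd_commute_on:
  assumes c: "coord_chart c" and U: "U \<subseteq> fst c" "open (snd c ` U)" "p \<in> U"
    and f: "smooth_on (snd c ` U) (f \<circ> chart_inv c)"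
  shows "diff_at c (pd c w f) p" "pd c v (pd c w f) p = pd c w (pd c v f) p"
proof -
  define F where "F = f \<circ> chart_inv c"
  have "((pd c w f \<circ> chart_inv c) has_derivative
      frechet_derivative (\<lambda>y. frechet_derivative F (at y) w) (at (snd c p))) (at (snd c p))" for w
  proof (rule has_derivative_transform_within_open[OF _ U(2)])
    show "((\<lambda>y. frechet_derivative F (at y) w) has_derivative
        frechet_derivative (\<lambda>y. frechet_derivative F (at y) w) (at (snd c p))) (at (snd c p))"
      using smooth_on_differentiable[OF smooth_on_frechet_derivative[OF f]] U
      unfolding F_def frechet_derivative_works[symmetric] by blast
    fix y assume "y \<in> snd c ` U"
    then show "frechet_derivative F (at y) w = (pd c w f \<circ> chart_inv c) y"
      using U c by (auto simp: F_def pd_def)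
  qed (use U in auto)
  note der = this
  show "diff_at c (pd c w f) p" by (rule diff_atI[OF der])
  show "pd c v (pd c w f) p = pd c w (pd c v f) p"
    unfolding pd_eqI[OF der]
    using smooth_on_second_derivative_symmetric[OF f U(2)] U(3) unfolding F_def by blast
qed

lemma pd_commute:
  assumes "coord_chart c" "smooth_in c f" "p \<in> fst c"
  shows "pd c v (pd c w f) p = pd c w (pd c v f) p"
  using pd_commute_on(2)[of c "fst c"] assms by (auto simp: coord_chart_def smooth_in_def)

lemma matrix_inv_left_right:
  fixes A :: "real^'k^'k"
  assumes "invertible A"
  shows "matrix_inv A ** A = mat 1" "A ** matrix_inv A = mat 1"
  using someI_ex[OF assms[unfolded invertible_def]] unfolding matrix_inv_def by auto

lemma matrix_inv_unique:
  fixes A :: "real^'k^'k"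
  assumes "A ** B = mat 1"
  shows "matrix_inv A = B"
proof -
  have "invertible A"
    using assms invertible_right_inverse by blast
  then have "matrix_inv A ** (A ** B) = B"
    by (simp add: matrix_mul_assoc matrix_inv_left_right)
  with assms show ?thesis by simp
qed

text \<open>Cramer's rule, as a formula for the inverse matrix that shows it to be a rational function of
  the entries.\<close>

lemma matrix_inv_component:
  fixes A :: "real^'k^'k"
  assumes "invertible A"
  shows "matrix_inv A $ i $ j = det (\<chi> r s. if s = i then axis j 1 $ r else A $ r $ s) * inverse (det A)"
proof -
  let ?x = "matrix_inv A *v axis j 1"
  have "A *v ?x = axis j 1"
    by (simp add: matrix_vector_mul_assoc matrix_inv_left_right[OF assms])
  then have "?x = (\<chi> i. det (\<chi> r s. if s = i then axis j 1 $ r else A $ r $ s) / det A)"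
    using assms cramer[of A ?x "axis j 1"] by (simp add: invertible_det_nz)
  moreover have "?x $ i = matrix_inv A $ i $ j"
    by (simp add: matrix_vector_mult_basis column_def)
  ultimately show ?thesis
    by (simp add: divide_inverse)
qed

lemma smooth_in_det:
  fixes A :: "'p \<Rightarrow> real^'k^'k"
  assumes "coord_chart c" "\<And>i j. smooth_in c (\<lambda>p. A p $ i $ j)"
  shows "smooth_in c (\<lambda>p. det (A p))"
  unfolding det_def
  by (intro smooth_in_sum smooth_in_mult smooth_in_prod smooth_in_const assms)

lemma smooth_in_matrix_inv:
  fixes A :: "'p \<Rightarrow> real^'k^'k"
  assumes c: "coord_chart c" and A: "\<And>i j. smooth_in c (\<lambda>p. A p $ i $ j)"
    and inv: "\<And>p. p \<in> fst c \<Longrightarrow> invertible (A p)"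
  shows "smooth_in c (\<lambda>p. matrix_inv (A p) $ i $ j)"
proof (rule smooth_in_cong[OF c])
  show "smooth_in c (\<lambda>p. det (\<chi> r s. if s = i then axis j 1 $ r else A p $ r $ s) * inverse (det (A p)))"
  proof (intro smooth_in_mult smooth_in_inverse smooth_in_det c A)
    fix r s
    show "smooth_in c (\<lambda>p. (\<chi> r s. if s = i then axis j 1 $ r else A p $ r $ s) $ r $ s)"
      using A by (cases "s = i") (auto simp: smooth_in_const)
  qed (use inv in \<open>simp add: invertible_det_nz\<close>)
qed (use inv in \<open>simp add: matrix_inv_component\<close>)

section \<open>Jacobian matrices of the charts of a manifold\<close>

lemma sum_Basis_vec: "(\<Sum>b\<in>Basis. F b) = (\<Sum>i\<in>UNIV. F (axis i (1::real)))"
  for F :: "real^'k \<Rightarrow> real"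
proof -
  have B: "Basis = (\<lambda>i. axis i (1::real)) ` (UNIV :: 'k set)"
    by (auto simp: Basis_vec_def)
  have "inj (\<lambda>i::'k. axis i (1::real))"
    by (auto simp: inj_on_def axis_eq_axis)
  from sum.reindex[OF this, of F] show ?thesis
    unfolding B by (simp add: o_def)
qed

lemma pd_change_chart_jac:
  assumes "diff_transition c c'" "p \<in> fst c" "p \<in> fst c'" "diff_at c' f p"
  shows "pd c (axis a 1) f p = (\<Sum>b\<in>UNIV. jac c c' p $ b $ a * pd c' (axis b 1) f p)"
  using pd_change_chart[OF assms] by (simp add: sum_Basis_vec jac_def inner_axis)

lemma has_derivative_own_coord:
  assumes "coord_chart c" "p \<in> fst c"
  shows "((\<lambda>s. snd c s $ b) \<circ> chart_inv c has_derivative (\<lambda>v. v $ b)) (at (snd c p))"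
proof -
  have "((\<lambda>y. y $ b) has_derivative (\<lambda>v. v $ b)) (at (snd c p))"
    by (intro bounded_linear_imp_has_derivative bounded_linear_vec_nth)
  then show ?thesis
    using assms snd_chart_inv[of _ c]
    by (elim has_derivative_transform_within_open[where s = "snd c ` fst c"])
      (auto simp: coord_chart_def)
qed

text \<open>The chain rule, applied to the coordinates of \<open>c\<close> themselves.\<close>

lemma jac_inverse:
  assumes "diff_transition c c'" "diff_transition c' c" "p \<in> fst c" "p \<in> fst c'"
  shows "jac c' c p ** jac c c' p = mat 1"
proof -
  have c: "coord_chart c" using assms by (simp add: diff_transition_def)
  have "(\<Sum>b\<in>UNIV. jac c' c p $ i $ b * jac c c' p $ b $ a) = (if i = a then 1 else 0)" for i a
  proof -
    have "diff_at c (\<lambda>s. snd c s $ i) p"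
      by (rule diff_atI[OF has_derivative_own_coord[OF c assms(3)]])
    note pd_change_chart_jac[OF assms(1,3,4) diff_at_change_chart[OF assms(2,4,3) this], of a]
    moreover have "pd c (axis a 1) (\<lambda>s. snd c s $ i) p = axis a 1 $ i"
      by (rule pd_eqI[OF has_derivative_own_coord[OF c assms(3)]])
    ultimately show ?thesis
      by (simp add: jac_def mult.commute axis_def eq_commute)
  qed
  then show ?thesis
    by (simp add: matrix_matrix_mult_def mat_def vec_eq_iff)
qed

lemma is_chart_coord_chart: "is_chart X c \<Longrightarrow> coord_chart c"
  unfolding is_chart_def coord_chart_def
  using homeomorphic_imp_injective_map topspace_subtopology_subset openin_subset by metis

lemma is_chart_open_image:
  assumes "is_chart X c" "openin X U" "U \<subseteq> fst c"
  shows "open (snd c ` U)"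
proof -
  have hm: "homeomorphic_map (subtopology X (fst c)) (top_of_set (snd c ` fst c)) (snd c)"
    and "open (snd c ` fst c)" and "openin X (fst c)"
    using assms(1) by (auto simp: is_chart_def)
  have "openin (subtopology X (fst c)) U"
    using assms \<open>openin X (fst c)\<close> by (simp add: openin_open_subtopology)
  then have "openin (top_of_set (snd c ` fst c)) (snd c ` U)"
    using homeomorphic_map_openness_eq[OF hm] openin_subset by blast
  then show ?thesis
    using \<open>open (snd c ` fst c)\<close> openin_open_trans by blast
qed

lemma is_chart_openin_preimage:
  assumes "is_chart X c" "open V"
  shows "openin X {s \<in> fst c. snd c s \<in> V}"
proof -
  have hm: "homeomorphic_map (subtopology X (fst c)) (top_of_set (snd c ` fst c)) (snd c)"
    and "open (snd c ` fst c)" and o: "openin X (fst c)"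
    using assms(1) by (auto simp: is_chart_def)
  have ts: "topspace (subtopology X (fst c)) = fst c"
    by (rule topspace_subtopology_subset[OF openin_subset[OF o]])
  have "continuous_map (subtopology X (fst c)) (top_of_set (snd c ` fst c)) (snd c)"
    using hm by (rule homeomorphic_imp_continuous_map)
  then have "continuous_map (subtopology X (fst c)) euclidean (snd c)"
    by (simp add: continuous_map_in_subtopology)
  from openin_continuous_map_preimage[OF this, of V] assms(2)
  have "openin (subtopology X (fst c)) {s \<in> fst c. snd c s \<in> V}"
    unfolding ts by simp
  then show ?thesis
    using o by (simp add: openin_open_subtopology)
qed

locale charted_manifold =
  fixes X :: "('p, real^'k) manifold"
  assumes X: "smooth_manifold X"
begin

lemma is_chart: "c \<in> atlas X \<Longrightarrow> is_chart (mtop X) c"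
  using X by (simp add: smooth_manifold_def)

lemma coord_chart: "c \<in> atlas X \<Longrightarrow> coord_chart c"
  using is_chart is_chart_coord_chart by blast

lemma openin_domain: "c \<in> atlas X \<Longrightarrow> openin (mtop X) (fst c)"
  using is_chart by (auto simp: is_chart_def)

lemma open_overlap: "c \<in> atlas X \<Longrightarrow> c' \<in> atlas X \<Longrightarrow> open (snd c ` (fst c \<inter> fst c'))"
  by (rule is_chart_open_image[OF is_chart]) (auto intro: openin_domain)

lemma smooth_transition:
  "c \<in> atlas X \<Longrightarrow> c' \<in> atlas X \<Longrightarrow> smooth_on (snd c ` (fst c \<inter> fst c')) (snd c' \<circ> chart_inv c)"
  using X by (auto simp: smooth_manifold_def smooth_transition_def)

lemma diff_transition:
  assumes "c \<in> atlas X" "c' \<in> atlas X" shows "diff_transition c c'"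
  using assms coord_chart open_overlap smooth_on_differentiable[OF smooth_transition[OF assms]]
  by (auto simp: diff_transition_def)

lemma smooth_coord:
  assumes "c \<in> atlas X" "c' \<in> atlas X"
  shows "smooth_on (snd c ` (fst c \<inter> fst c')) ((\<lambda>s. snd c' s $ b) \<circ> chart_inv c)"
  using smooth_on_bounded_linear[OF bounded_linear_vec_nth open_overlap[OF assms] smooth_transition[OF assms]]
  by (simp add: o_def)

lemma diff_at_jac:
  assumes "c \<in> atlas X" "c' \<in> atlas X" "p \<in> fst c" "p \<in> fst c'"
  shows "diff_at c (\<lambda>s. jac c c' s $ b $ a) p"
  using pd_commute_on(1)[OF coord_chart _ open_overlap _ smooth_coord] assms
  by (simp add: jac_def)

lemma diff_at_jac':
  assumes "c \<in> atlas X" "c' \<in> atlas X" "p \<in> fst c" "p \<in> fst c'"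
  shows "diff_at c (\<lambda>s. jac c' c s $ b $ a) p"
  by (rule diff_at_change_chart[OF diff_transition[OF assms(1,2)] assms(3,4)
        diff_at_jac[OF assms(2,1,4,3)]])

text \<open>Both sides are second derivatives of one coordinate of \<open>c'\<close> in the coordinates of \<open>c\<close>.\<close>

lemma pd_jac_symmetric:
  assumes "c \<in> atlas X" "c' \<in> atlas X" "p \<in> fst c" "p \<in> fst c'"
  shows "pd c (axis e 1) (\<lambda>s. jac c c' s $ b $ a) p = pd c (axis a 1) (\<lambda>s. jac c c' s $ b $ e) p"
  using pd_commute_on(2)[OF coord_chart _ open_overlap _ smooth_coord] assms
  by (simp add: jac_def)

lemma jac_cancel:
  assumes "c \<in> atlas X" "c' \<in> atlas X" "p \<in> fst c" "p \<in> fst c'"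
  shows "(\<Sum>b\<in>UNIV. jac c' c p $ a $ b * jac c c' p $ b $ e) = (if a = e then 1 else 0)"
  using arg_cong[OF jac_inverse[OF diff_transition diff_transition], of c c' p "\<lambda>A. A $ a $ e"] assms
  by (simp add: matrix_matrix_mult_def mat_def)

lemma pd_change:
  assumes "c \<in> atlas X" "c' \<in> atlas X" "p \<in> fst c" "p \<in> fst c'" "diff_at c' f p"
  shows "pd c (axis a 1) f p = (\<Sum>b\<in>UNIV. jac c c' p $ b $ a * pd c' (axis b 1) f p)"
  by (rule pd_change_chart_jac[OF diff_transition[OF assms(1,2)] assms(3-5)])

end

section \<open>Jets and momenta in coordinates\<close>

locale jet_manifolds = T: charted_manifold T + M: charted_manifold M
  for T :: "('a, real^'m) manifold" and M :: "('b, real^'n) manifold"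
begin

text \<open>Smoothness near a point is witnessed by one pair of charts; any other pair of charts around the
  point and its image sees a differentiable map as well. The map is continuous in the witnessing
  charts, so it sends a neighbourhood of \<open>t\<close> into the domain of \<open>d\<close>.\<close>

lemma smooth_near_in_charts:
  assumes f: "smooth_near T M f t" and c: "c \<in> atlas T" "t \<in> fst c" and d: "d \<in> atlas M" "f t \<in> fst d"
  obtains U where "U \<subseteq> fst c" "open (snd c ` U)" "t \<in> U" "f ` U \<subseteq> fst d"
    "(snd d \<circ> f \<circ> chart_inv c) differentiable (at (snd c t))"
proof -
  obtain c0 d0 W where c0: "c0 \<in> atlas T" and d0: "d0 \<in> atlas M" and W: "openin (mtop T) W" "t \<in> W"
    "W \<subseteq> fst c0" "f ` W \<subseteq> fst d0" and sm: "smooth_on (snd c0 ` W) (snd d0 \<circ> f \<circ> chart_inv c0)"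
    using f unfolding smooth_near_def by blast
  define F where "F = snd d0 \<circ> f \<circ> chart_inv c0"
  define V where "V = snd c0 ` W \<inter> F -` (snd d0 ` (fst d0 \<inter> fst d))"
  define U where "U = {s \<in> fst c0. snd c0 s \<in> V} \<inter> (W \<inter> fst c)"
  note ch = T.coord_chart[OF c(1)] T.coord_chart[OF c0] M.coord_chart[OF d(1)] M.coord_chart[OF d0]
  have FW: "F (snd c0 s) = snd d0 (f s)" if "s \<in> W" for s
    using that W ch by (auto simp: F_def)
  have "open (snd c0 ` W)"
    by (rule is_chart_open_image[OF T.is_chart[OF c0] W(1,3)])
  from continuous_open_preimage[OF smooth_on_continuous_on[OF sm] this M.open_overlap[OF d0 d(1)]]
  have "open V" by (simp only: V_def F_def)
  then have "openin (mtop T) U"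
    unfolding U_def
    by (intro openin_Int is_chart_openin_preimage[OF T.is_chart[OF c0]] W(1) T.openin_domain[OF c(1)])
  then have oU: "open (snd c ` U)"
    by (rule is_chart_open_image[OF T.is_chart[OF c(1)]]) (auto simp: U_def)
  have tU: "t \<in> U"
    using W c d FW[of t] by (auto simp: U_def V_def)
  have fU: "f s \<in> fst d" if "s \<in> U" for s
  proof -
    have "s \<in> W" "F (snd c0 s) \<in> snd d0 ` (fst d0 \<inter> fst d)"
      using that by (auto simp: U_def V_def)
    then have "snd d0 (f s) \<in> snd d0 ` (fst d0 \<inter> fst d)"
      using FW by simp
    moreover have "f s \<in> fst d0" using \<open>s \<in> W\<close> W by auto
    ultimately show ?thesis
      using ch(4) unfolding coord_chart_def inj_on_def by auto
  qed
  let ?\<Phi> = "snd c0 \<circ> chart_inv c" and ?\<Psi> = "snd d \<circ> chart_inv d0"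
  have \<Phi>: "?\<Phi> differentiable (at (snd c t))"
    using T.diff_transition[OF c(1) c0] c W by (auto simp: diff_transition_def)
  have "?\<Phi> (snd c t) = snd c0 t" using ch c by simp
  then have F: "F differentiable (at (?\<Phi> (snd c t)))"
    using smooth_on_differentiable[OF sm] W by (simp add: F_def)
  have "F (?\<Phi> (snd c t)) = snd d0 (f t)"
    using \<open>?\<Phi> (snd c t) = snd c0 t\<close> FW W by simp
  then have \<Psi>: "?\<Psi> differentiable (at (F (?\<Phi> (snd c t))))"
    using M.diff_transition[OF d0 d(1)] d W by (auto simp: diff_transition_def)
  have "(?\<Psi> \<circ> (F \<circ> ?\<Phi>)) differentiable (at (snd c t))"
    by (rule differentiable_chain_at[OF differentiable_chain_at[OF \<Phi> F]]) (use \<Psi> in simp)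
  then obtain D where "(?\<Psi> \<circ> (F \<circ> ?\<Phi>) has_derivative D) (at (snd c t))"
    unfolding differentiable_def by blast
  then have "(snd d \<circ> f \<circ> chart_inv c has_derivative D) (at (snd c t))"
  proof (rule has_derivative_transform_within_open[OF _ oU])
    show "snd c t \<in> snd c ` U" using tU by simp
    fix y assume "y \<in> snd c ` U"
    then obtain s where s: "s \<in> U" "y = snd c s" by blast
    then have "s \<in> W" "s \<in> fst c" by (auto simp: U_def)
    then show "(?\<Psi> \<circ> (F \<circ> ?\<Phi>)) y = (snd d \<circ> f \<circ> chart_inv c) y"
      using s(2) ch FW W by auto
  qed
  then have "(snd d \<circ> f \<circ> chart_inv c) differentiable (at (snd c t))"
    unfolding differentiable_def by blast
  with oU tU fU show ?thesis by (intro that[of U]) (auto simp: U_def)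
qed

text \<open>The chain rule, in the target for the change from \<open>d\<close> to \<open>d'\<close> and in the source for the change
  from \<open>c'\<close> to \<open>c\<close>. It makes the coordinates of jets, and therefore the notion of a linear functional
  on a fibre, independent of the charts up to an invertible linear map.\<close>

lemma map_deriv_change:
  assumes f: "smooth_near T M f t" and c: "c \<in> atlas T" "c' \<in> atlas T" "t \<in> fst c" "t \<in> fst c'"
    and d: "d \<in> atlas M" "d' \<in> atlas M" "f t \<in> fst d" "f t \<in> fst d'"
  shows "map_deriv c' d' t f = jac d d' (f t) ** map_deriv c d t f ** jac c' c t"
proof -
  note ch = T.coord_chart[OF c(1)] M.coord_chart[OF d(1)]
  obtain U where U: "U \<subseteq> fst c" "open (snd c ` U)" "t \<in> U" "f ` U \<subseteq> fst d"
    and df: "(snd d \<circ> f \<circ> chart_inv c) differentiable (at (snd c t))"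
    using smooth_near_in_charts[OF f c(1,3) d(1,3)] by blast
  from df obtain D where D: "(snd d \<circ> f \<circ> chart_inv c has_derivative D) (at (snd c t))"
    unfolding differentiable_def by blast
  have "((\<lambda>s. snd d (f s) $ j) \<circ> chart_inv c has_derivative (\<lambda>v. D v $ j)) (at (snd c t))" for j
    using bounded_linear.has_derivative[OF bounded_linear_vec_nth D, of j] by (simp add: o_def)
  from pd_eqI[OF this] have Dj: "D v $ j = pd c v (\<lambda>s. snd d (f s) $ j) t" for v j
    by simp
  have *: "((\<lambda>s. snd d' (f s) $ i) \<circ> chart_inv c has_derivative
      (\<lambda>v. \<Sum>j\<in>UNIV. jac d d' (f t) $ i $ j * D v $ j)) (at (snd c t))" for i
  proof -
    let ?\<phi> = "\<lambda>x. snd d' x $ i"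
    have "(?\<phi> \<circ> chart_inv d) differentiable (at (snd d (f t)))"
      using smooth_on_differentiable[OF M.smooth_coord[OF d(1,2)]] d by blast
    then have \<phi>: "diff_at d ?\<phi> (f t)" by (simp add: diff_at_def)
    have "((?\<phi> \<circ> chart_inv d) \<circ> (snd d \<circ> f \<circ> chart_inv c) has_derivative
        (\<lambda>v. pd d v ?\<phi> (f t)) \<circ> D) (at (snd c t))"
      using \<phi> c ch by (intro diff_chain_at[OF D]) (simp add: diff_at_has_derivative)
    then have "(?\<phi> \<circ> f \<circ> chart_inv c has_derivative (\<lambda>v. pd d v ?\<phi> (f t)) \<circ> D) (at (snd c t))"
    proof (rule has_derivative_transform_within_open[OF _ U(2)])
      show "snd c t \<in> snd c ` U" using U by simp
      fix y assume "y \<in> snd c ` U"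
      then obtain s where "y = snd c s" "s \<in> fst c" "f s \<in> fst d" using U by auto
      then show "((?\<phi> \<circ> chart_inv d) \<circ> (snd d \<circ> f \<circ> chart_inv c)) y = (?\<phi> \<circ> f \<circ> chart_inv c) y"
        using ch by simp
    qed
    moreover have "pd d (D v) ?\<phi> (f t) = (\<Sum>j\<in>UNIV. jac d d' (f t) $ i $ j * D v $ j)" for v
      using pd_sum_Basis[OF \<phi>, of "D v"] by (simp add: sum_Basis_vec jac_def inner_axis mult.commute)
    ultimately show ?thesis by (simp add: o_def)
  qed
  have "pd c' (axis a 1) (\<lambda>s. snd d' (f s) $ i) t
      = (\<Sum>b\<in>UNIV. jac c' c t $ b $ a * pd c (axis b 1) (\<lambda>s. snd d' (f s) $ i) t)" for a i
    by (rule T.pd_change[OF c(2,1,4,3) diff_atI[OF *]])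
  then show ?thesis
    by (simp add: map_deriv_def matrix_matrix_mult_def vec_eq_iff pd_eqI[OF *] Dj mult.commute)
qed

lemma jet_coord_jet:
  assumes "smooth_near T M f t" "c \<in> atlas T" "t \<in> fst c" "d \<in> atlas M" "f t \<in> fst d"
  shows "jet_coord c d t (jet T M t f) = map_deriv c d t f"
proof -
  have "f \<in> jet T M t f" using assms(1) by (simp add: jet_def)
  from someI[of "\<lambda>g. g \<in> jet T M t f", OF this]
  have "(SOME g. g \<in> jet T M t f) \<in> jet T M t f" .
  then show ?thesis
    using assms unfolding jet_coord_def by (simp add: jet_def)
qed

lemma jet_coord_change:
  assumes c: "c \<in> atlas T" "c' \<in> atlas T" "t \<in> fst c" "t \<in> fst c'"
    and d: "d \<in> atlas M" "d' \<in> atlas M" "x \<in> fst d" "x \<in> fst d'"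
    and j: "j \<in> jet_fibre T M t x"
  shows "jet_coord c' d' t j = jac d d' x ** jet_coord c d t j ** jac c' c t"
proof -
  obtain f where f: "smooth_near T M f t" "f t = x" "j = jet T M t f"
    using j unfolding jet_fibre_def by blast
  have "jet_coord c d t j = map_deriv c d t f" "jet_coord c' d' t j = map_deriv c' d' t f"
    using jet_coord_jet[OF f(1) c(1,3) d(1)] jet_coord_jet[OF f(1) c(2,4) d(2)] d f(2,3) by simp_all
  with map_deriv_change[OF f(1) c d(1,2)] d(3,4) f(2) show ?thesis by simp
qed

text \<open>Two jets with the same coordinates in one pair of charts have the same coordinates in all of them,
  so they are the same equivalence class.\<close>

lemma jet_coord_inj:
  assumes c: "c \<in> atlas T" "t \<in> fst c" and d: "d \<in> atlas M" "x \<in> fst d"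
    and j: "j \<in> jet_fibre T M t x" "k \<in> jet_fibre T M t x"
    and eq: "jet_coord c d t j = jet_coord c d t k"
  shows "j = k"
proof -
  obtain f where f: "smooth_near T M f t" "f t = x" "j = jet T M t f"
    using j unfolding jet_fibre_def by blast
  obtain g where g: "smooth_near T M g t" "g t = x" "k = jet T M t g"
    using j unfolding jet_fibre_def by blast
  have "map_deriv c d t f = map_deriv c d t g"
    using eq jet_coord_jet[OF f(1) c d(1)] jet_coord_jet[OF g(1) c d(1)] d(2) f(2,3) g(2,3) by simp
  then have "map_deriv c' d' t f = map_deriv c' d' t g"
    if "c' \<in> atlas T" "t \<in> fst c'" "d' \<in> atlas M" "x \<in> fst d'" for c' d'
    using map_deriv_change[OF f(1) c(1) that(1) c(2) that(2) d(1) that(3)]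
      map_deriv_change[OF g(1) c(1) that(1) c(2) that(2) d(1) that(3)] that(4) d(2) f(2) g(2) by simp
  then show ?thesis
    unfolding f g jet_def using f(2) g(2) by auto
qed

text \<open>Every matrix is the coordinate matrix of a jet: the jet of the map that is affine in the charts.\<close>

lemma jet_coord_surj:
  assumes c: "c \<in> atlas T" "t \<in> fst c" and d: "d \<in> atlas M" "x \<in> fst d"
  obtains j where "j \<in> jet_fibre T M t x" "jet_coord c d t j = A"
proof -
  note ch = T.coord_chart[OF c(1)] M.coord_chart[OF d(1)]
  define \<Lambda> where "\<Lambda> y = snd d x + A *v (y - snd c t)" for y
  define f where "f = (\<lambda>s. chart_inv d (\<Lambda> (snd c s)))"
  define V where "V = \<Lambda> -` (snd d ` fst d)"
  define W where "W = {s \<in> fst c. snd c s \<in> V}"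
  have bl: "bounded_linear (\<lambda>y. A *v y)"
    by (rule matrix_vector_mul_bounded_linear)
  have \<Lambda>_der: "(\<Lambda> has_derivative (\<lambda>v. A *v v)) (at y)" for y
    unfolding \<Lambda>_def by (auto intro!: derivative_eq_intros bounded_linear.has_derivative[OF bl])
  have "continuous_on UNIV \<Lambda>"
    using has_derivative_continuous[OF \<Lambda>_der] by (simp add: continuous_on_eq_continuous_at)
  then have "open V"
    unfolding V_def using ch by (simp add: coord_chart_def open_vimage)
  then have oW: "openin (mtop T) W"
    unfolding W_def by (rule is_chart_openin_preimage[OF T.is_chart[OF c(1)]])
  then have oW': "open (snd c ` W)"
    by (rule is_chart_open_image[OF T.is_chart[OF c(1)]]) (simp add: W_def)
  have tW: "t \<in> W"
    using c d by (simp add: W_def V_def \<Lambda>_def)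
  have fW: "f s \<in> fst d" "snd d (f s) = \<Lambda> (snd c s)" if "s \<in> W" for s
    using that chart_inv_in[of _ d] snd_chart_inv[of _ d] by (auto simp: W_def V_def f_def)
  have eq: "(snd d \<circ> f \<circ> chart_inv c) y = \<Lambda> y" if "y \<in> snd c ` W" for y
    using that fW ch by (auto simp: W_def)
  have "\<Lambda> = (\<lambda>y. A *v y + (snd d x - A *v snd c t))"
    by (simp add: \<Lambda>_def fun_eq_iff matrix_vector_mult_diff_distrib)
  then have "smooth_on (snd c ` W) \<Lambda>"
    using smooth_on_add[OF oW' smooth_on_linear[OF bl] smooth_on_const] by simp
  from smooth_on_cong[OF oW' eq[symmetric] this]
  have "smooth_on (snd c ` W) (snd d \<circ> f \<circ> chart_inv c)" .
  then have sn: "smooth_near T M f t"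
    unfolding smooth_near_def using c d oW tW fW
    by (intro bexI[of _ c] bexI[of _ d] exI[of _ W] conjI) (auto simp: W_def)
  have ft: "f t = x" using ch d by (simp add: f_def \<Lambda>_def)
  have "map_deriv c d t f = A"
  proof -
    have "((\<lambda>s. snd d (f s) $ i) \<circ> chart_inv c has_derivative (\<lambda>v. (A *v v) $ i)) (at (snd c t))" for i
    proof (rule has_derivative_transform_within_open[OF _ oW'])
      show "((\<lambda>y. \<Lambda> y $ i) has_derivative (\<lambda>v. (A *v v) $ i)) (at (snd c t))"
        by (rule bounded_linear.has_derivative[OF bounded_linear_vec_nth \<Lambda>_der])
      show "\<Lambda> y $ i = ((\<lambda>s. snd d (f s) $ i) \<circ> chart_inv c) y" if "y \<in> snd c ` W" for y
        using eq[OF that] by simp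
    qed (use tW in simp)
    from pd_eqI[OF this] show ?thesis
      by (simp add: map_deriv_def vec_eq_iff matrix_vector_mult_basis column_def)
  qed
  then show ?thesis
    using that[of "jet T M t f"] jet_coord_jet[OF sn c d(1)] ft d sn
    by (auto simp: jet_fibre_def)
qed

lemma momentum_eqI:
  assumes c: "c \<in> atlas T" "t \<in> fst c" and d: "d \<in> atlas M" "x \<in> fst d"
    and p: "\<And>j. j \<in> jet_fibre T M t x \<Longrightarrow> \<alpha> j = p \<bullet> jet_coord c d t j"
  shows "momentum T M c d (t, x, \<alpha>) = p"
proof -
  have inner: "(\<Sum>i\<in>UNIV. \<Sum>a\<in>UNIV. p' $ i $ a * X $ i $ a) = p' \<bullet> X" for p' X :: "real^'m^'n"
    by (simp add: inner_vec_def)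
  show ?thesis
    unfolding momentum_def prod.case inner
  proof (rule the_equality)
    fix p' assume p': "\<forall>j\<in>jet_fibre T M t x. \<alpha> j = p' \<bullet> jet_coord c d t j"
    have "p' \<bullet> A = p \<bullet> A" for A
      using jet_coord_surj[OF c d, of A] p p' by metis
    then show "p' = p"
      by (metis vector_eq_rdot)
  qed (use p in blast)
qed

text \<open>Since the fibre coordinates identify the fibre with the space of all matrices, an element of the
  dual fibre is a linear functional on matrices, and such a functional is the inner product with the
  matrix of its values on the standard basis.\<close>

lemma momentum_pairing:
  assumes c: "c \<in> atlas T" "t \<in> fst c" and d: "d \<in> atlas M" "x \<in> fst d"
    and \<alpha>: "\<alpha> \<in> dual_fibre T M t x" and j: "j \<in> jet_fibre T M t x"
  shows "\<alpha> j = momentum T M c d (t, x, \<alpha>) \<bullet> jet_coord c d t j"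
proof -
  have "\<exists>k. k \<in> jet_fibre T M t x \<and> jet_coord c d t k = A" for A
    using jet_coord_surj[OF c d] by blast
  then obtain J where J: "\<And>A. J A \<in> jet_fibre T M t x" "\<And>A. jet_coord c d t (J A) = A"
    by metis
  have lin: "\<alpha> l = r * \<alpha> j + s * \<alpha> k"
    if "j \<in> jet_fibre T M t x" "k \<in> jet_fibre T M t x" "l \<in> jet_fibre T M t x"
      "jet_coord c d t l = r *\<^sub>R jet_coord c d t j + s *\<^sub>R jet_coord c d t k" for j k l r s
    using \<alpha> c d that unfolding dual_fibre_def by blast
  have add: "\<alpha> (J (A + B)) = \<alpha> (J A) + \<alpha> (J B)" for A B
    using lin[of "J A" "J B" "J (A + B)" 1 1] J by simp
  have scale: "\<alpha> (J (r *\<^sub>R A)) = r * \<alpha> (J A)" for r A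
    using lin[of "J A" "J A" "J (r *\<^sub>R A)" r 0] J by simp
  have linear: "linear (\<lambda>A. \<alpha> (J A))"
    using add scale by (intro linearI) simp_all
  define p where "p = (\<Sum>b\<in>Basis. \<alpha> (J b) *\<^sub>R b)"
  have J_inner: "\<alpha> (J A) = p \<bullet> A" for A
  proof -
    have "\<alpha> (J A) = \<alpha> (J (\<Sum>b\<in>Basis. (A \<bullet> b) *\<^sub>R b))"
      by (simp add: euclidean_representation)
    also have "\<dots> = (\<Sum>b\<in>Basis. (A \<bullet> b) * \<alpha> (J b))"
      using linear_sum[OF linear, of "\<lambda>b. (A \<bullet> b) *\<^sub>R b" Basis] by (simp add: scale)
    also have "\<dots> = p \<bullet> A"
      by (simp add: p_def inner_sum_left inner_commute[of A] mult.commute)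
    finally show ?thesis .
  qed
  have p: "\<alpha> k = p \<bullet> jet_coord c d t k" if "k \<in> jet_fibre T M t x" for k
  proof -
    have "J (jet_coord c d t k) = k"
      by (rule jet_coord_inj[OF c d J(1) that]) (simp add: J)
    then show ?thesis using J_inner by metis
  qed
  with momentum_eqI[OF c d] j show ?thesis by metis
qed

text \<open>The \<open>(j, b)\<close> component of the new momentum is the value of \<open>\<alpha>\<close> at the jet whose new coordinate
  matrix is the elementary matrix at \<open>(j, b)\<close>.\<close>

lemma momentum_change:
  assumes c: "c \<in> atlas T" "c' \<in> atlas T" "t \<in> fst c" "t \<in> fst c'"
    and d: "d \<in> atlas M" "d' \<in> atlas M" "x \<in> fst d" "x \<in> fst d'"
    and \<alpha>: "\<alpha> \<in> dual_fibre T M t x"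
  shows "momentum T M c' d' (t, x, \<alpha>) $ j $ b
    = (\<Sum>k\<in>UNIV. \<Sum>f\<in>UNIV. jac d' d x $ k $ j * jac c c' t $ b $ f * momentum T M c d (t, x, \<alpha>) $ k $ f)"
proof -
  obtain l where l: "l \<in> jet_fibre T M t x" "jet_coord c' d' t l = axis j (axis b 1)"
    using jet_coord_surj[OF c(2,4) d(2,4)] by blast
  have "momentum T M c' d' (t, x, \<alpha>) $ j $ b = \<alpha> l"
    using momentum_pairing[OF c(2,4) d(2,4) \<alpha> l(1)] by (simp add: l(2) inner_axis)
  also have "\<dots> = momentum T M c d (t, x, \<alpha>) \<bullet> (jac d' d x ** axis j (axis b 1) ** jac c c' t)"
    using momentum_pairing[OF c(1,3) d(1,3) \<alpha> l(1)]
      jet_coord_change[OF c(2,1,4,3) d(2,1,4,3) l(1)] by (simp add: l(2))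
  also have "\<dots> = (\<Sum>k\<in>UNIV. \<Sum>f\<in>UNIV. jac d' d x $ k $ j * jac c c' t $ b $ f * momentum T M c d (t, x, \<alpha>) $ k $ f)"
  proof -
    have "(\<Sum>i\<in>UNIV. jac d' d x $ k $ i * axis j (axis b 1) $ i $ a)
        = (if a = b then jac d' d x $ k $ j else 0)" for k a
    proof -
      have "(\<Sum>i\<in>UNIV. jac d' d x $ k $ i * axis j (axis b 1) $ i $ a)
          = (\<Sum>i\<in>UNIV. if i = j then jac d' d x $ k $ i * axis b 1 $ a else 0)"
        by (intro sum.cong) (auto simp: axis_def)
      then show ?thesis by (auto simp: axis_def)
    qed
    then have "(jac d' d x ** axis j (axis b 1) ** jac c c' t) $ k $ f = jac d' d x $ k $ j * jac c c' t $ b $ f" for k f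
      by (simp add: matrix_matrix_mult_def if_distrib[where f = "\<lambda>x. x * _"] cong: if_cong)
    then show ?thesis by (simp add: inner_vec_def mult_ac)
  qed
  finally show ?thesis .
qed

text \<open>Every matrix is the momentum of a functional. Linearity has to be checked in all pairs of charts;
  the change of coordinates is linear, so one pair is enough.\<close>

lemma dual_fibreI:
  assumes c: "c \<in> atlas T" "t \<in> fst c" and d: "d \<in> atlas M" "x \<in> fst d"
  shows "restrict (\<lambda>j. p \<bullet> jet_coord c d t j) (jet_fibre T M t x) \<in> dual_fibre T M t x"
proof -
  have "p \<bullet> jet_coord c d t l = r * (p \<bullet> jet_coord c d t j) + s * (p \<bullet> jet_coord c d t k)"
    if c': "c' \<in> atlas T" "t \<in> fst c'" and d': "d' \<in> atlas M" "x \<in> fst d'"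
      and jkl: "j \<in> jet_fibre T M t x" "k \<in> jet_fibre T M t x" "l \<in> jet_fibre T M t x"
      and eq: "jet_coord c' d' t l = r *\<^sub>R jet_coord c' d' t j + s *\<^sub>R jet_coord c' d' t k"
    for c' d' j k l r s
  proof -
    have linear: "A ** (r *\<^sub>R X + s *\<^sub>R Y) ** B = r *\<^sub>R (A ** X ** B) + s *\<^sub>R (A ** Y ** B)"
      for A :: "real^'n^'n" and X Y :: "real^'m^'n" and B :: "real^'m^'m"
      by (simp add: matrix_matrix_mult_def vec_eq_iff sum_distrib_left sum_distrib_right
          sum.distrib distrib_left distrib_right mult_ac)
    have "jet_coord c d t l = r *\<^sub>R jet_coord c d t j + s *\<^sub>R jet_coord c d t k"
      using jet_coord_change[OF c'(1) c(1) c'(2) c(2) d'(1) d(1) d'(2) d(2)] jkl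
      by (simp add: eq linear)
    then show ?thesis by (simp add: inner_add_right)
  qed
  then show ?thesis
    unfolding dual_fibre_def by (auto simp: restrict_extensional)
qed

end

section \<open>The induced charts of the dual jet bundle\<close>

lemma sum_Basis_dir:
  fixes F :: "(real^'m) \<times> (real^'n) \<times> (real^'m^'n) \<Rightarrow> real"
  shows "(\<Sum>b\<in>Basis. F b)
    = (\<Sum>a\<in>UNIV. F (dir_t a)) + (\<Sum>i\<in>UNIV. F (dir_x i)) + (\<Sum>i\<in>UNIV. \<Sum>a\<in>UNIV. F (dir_p i a))"
proof -
  have vv: "(\<Sum>b\<in>Basis. G b) = (\<Sum>i\<in>UNIV. \<Sum>a\<in>UNIV. G (axis i (axis a 1)))" for G :: "real^'m^'n \<Rightarrow> real"
  proof -
    have B: "Basis = (\<lambda>(i, a). axis i (axis a (1::real))) ` (UNIV :: ('n \<times> 'm) set)"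
      by (auto simp: Basis_vec_def)
    have "inj (\<lambda>(i, a). axis i (axis a 1) :: real^'m^'n)"
      by (auto simp: inj_on_def axis_eq_axis)
    from sum.reindex[OF this, of G] show ?thesis
      unfolding B by (simp add: o_def case_prod_unfold sum.cartesian_product UNIV_Times_UNIV)
  qed
  have pairs: "(\<Sum>b\<in>Basis. G b) = (\<Sum>u\<in>Basis. G (u, 0)) + (\<Sum>v\<in>Basis. G (0, v))"
    for G :: "'c::euclidean_space \<times> 'd::euclidean_space \<Rightarrow> real"
    unfolding Basis_prod_def
    by (subst sum.union_disjoint) (auto simp: sum.reindex inj_on_def)
  show ?thesis
    by (simp add: pairs sum_Basis_vec vv dir_t_def dir_x_def dir_p_def add.assoc zero_prod_def)
qed

lemma pd_zero_dir: "diff_at c f p \<Longrightarrow> pd c 0 f p = 0"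
  unfolding diff_at_has_derivative using has_derivative_linear linear_0 by fast

context jet_manifolds
begin

abbreviation "E \<equiv> induced_chart T M"

lemma in_induced_chart:
  "q \<in> fst (E c d) \<longleftrightarrow> q \<in> jet_dual T M \<and> fst q \<in> fst c \<and> fst (snd q) \<in> fst d"
  by (simp add: induced_chart_def)

lemma snd_induced_chart: "snd (E c d) q = (snd c (fst q), snd d (fst (snd q)), momentum T M c d q)"
  by (simp add: induced_chart_def)

text \<open>The fibres are full vector spaces in every induced chart. With \<open>U\<close> and \<open>V\<close> the chart domains this
  says that the image of the chart is open, and with \<open>U\<close> and \<open>V\<close> the overlaps of two chart domains it
  says the same of the overlap.\<close>

lemma induced_image:
  assumes c: "c \<in> atlas T" "U \<subseteq> fst c" and d: "d \<in> atlas M" "V \<subseteq> fst d"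
  shows "snd (E c d) ` {q \<in> jet_dual T M. fst q \<in> U \<and> fst (snd q) \<in> V} = snd c ` U \<times> snd d ` V \<times> UNIV"
proof (intro equalityI subsetI)
  fix y assume "y \<in> snd c ` U \<times> snd d ` V \<times> (UNIV :: (real^'m^'n) set)"
  then obtain t x p where y: "y = (snd c t, snd d x, p)" and tx: "t \<in> U" "x \<in> V" by auto
  define \<alpha> where "\<alpha> = restrict (\<lambda>j. p \<bullet> jet_coord c d t j) (jet_fibre T M t x)"
  have tx': "t \<in> fst c" "x \<in> fst d" using c d tx by auto
  have "\<alpha> \<in> dual_fibre T M t x"
    unfolding \<alpha>_def by (rule dual_fibreI[OF c(1) tx'(1) d(1) tx'(2)])
  then have "(t, x, \<alpha>) \<in> jet_dual T M"
    using tx' openin_subset[OF T.openin_domain[OF c(1)]] openin_subset[OF M.openin_domain[OF d(1)]]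
    by (auto simp: jet_dual_def)
  moreover have "momentum T M c d (t, x, \<alpha>) = p"
    by (rule momentum_eqI[OF c(1) tx'(1) d(1) tx'(2)]) (simp add: \<alpha>_def)
  ultimately show "y \<in> snd (E c d) ` {q \<in> jet_dual T M. fst q \<in> U \<and> fst (snd q) \<in> V}"
    using tx y by (intro image_eqI[of _ _ "(t, x, \<alpha>)"]) (auto simp: snd_induced_chart)
qed (auto simp: snd_induced_chart)

lemma induced_coord_chart:
  assumes c: "c \<in> atlas T" and d: "d \<in> atlas M"
  shows "coord_chart (E c d)"
proof -
  have "inj_on (snd (E c d)) (fst (E c d))"
  proof (rule inj_onI)
    fix q q' assume q: "q \<in> fst (E c d)" "q' \<in> fst (E c d)" and eq: "snd (E c d) q = snd (E c d) q'"
    obtain t x \<alpha> where q1: "q = (t, x, \<alpha>)" by (cases q)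
    obtain t' x' \<alpha>' where q2: "q' = (t', x', \<alpha>')" by (cases q')
    have tx: "t \<in> fst c" "x \<in> fst d" "t' \<in> fst c" "x' \<in> fst d"
      using q by (auto simp: q1 q2 in_induced_chart)
    have "t' = t" "x' = x"
      using eq tx T.coord_chart[OF c] M.coord_chart[OF d]
      by (auto simp: q1 q2 snd_induced_chart coord_chart_def inj_on_def)
    moreover have \<alpha>: "\<alpha> \<in> dual_fibre T M t x" "\<alpha>' \<in> dual_fibre T M t x"
      using q \<open>t' = t\<close> \<open>x' = x\<close> by (auto simp: q1 q2 in_induced_chart jet_dual_def)
    moreover have "\<alpha> = \<alpha>'"
    proof (rule extensionalityI)
      show "\<alpha> \<in> extensional (jet_fibre T M t x)" "\<alpha>' \<in> extensional (jet_fibre T M t x)"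
        using \<alpha> by (simp_all add: dual_fibre_def)
      fix j assume j: "j \<in> jet_fibre T M t x"
      have "momentum T M c d (t, x, \<alpha>) = momentum T M c d (t, x, \<alpha>')"
        using eq \<open>t' = t\<close> \<open>x' = x\<close> by (simp add: q1 q2 snd_induced_chart)
      then show "\<alpha> j = \<alpha>' j"
        using momentum_pairing[OF c tx(1) d tx(2) \<alpha>(1) j] momentum_pairing[OF c tx(1) d tx(2) \<alpha>(2) j]
        by simp
    qed
    ultimately show "q = q'" by (simp add: q1 q2)
  qed
  moreover have "open (snd (E c d) ` fst (E c d))"
    using induced_image[OF c subset_refl d subset_refl] T.coord_chart[OF c] M.coord_chart[OF d]
    by (auto simp: induced_chart_def coord_chart_def intro!: open_Times)
  ultimately show ?thesis by (simp add: coord_chart_def)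
qed

lemma open_induced_overlap:
  assumes "c \<in> atlas T" "c' \<in> atlas T" "d \<in> atlas M" "d' \<in> atlas M"
  shows "open (snd (E c d) ` (fst (E c d) \<inter> fst (E c' d')))"
proof -
  have "fst (E c d) \<inter> fst (E c' d')
      = {q \<in> jet_dual T M. fst q \<in> fst c \<inter> fst c' \<and> fst (snd q) \<in> fst d \<inter> fst d'}"
    by (auto simp: in_induced_chart)
  then show ?thesis
    using induced_image[OF assms(1) Int_lower1 assms(3) Int_lower1, of "fst c'" "fst d'"] assms
    by (auto intro!: open_Times T.open_overlap M.open_overlap)
qed

text \<open>In an induced chart, the pullback of a function from one of the base manifolds, and likewise a
  momentum component, factors through a projection of the coordinate space. This gives its derivatives
  and its smoothness.\<close>

lemma induced_pullback_t:
  assumes "c \<in> atlas T" "d \<in> atlas M" "y \<in> snd (E c d) ` fst (E c d)"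
  shows "fst (chart_inv (E c d) y) = chart_inv c (fst y)"
proof -
  obtain q where q: "q \<in> fst (E c d)" "y = snd (E c d) q" using assms(3) by blast
  then show ?thesis
    using chart_inv_snd[OF induced_coord_chart[OF assms(1,2)] q(1)] T.coord_chart[OF assms(1)]
    by (simp add: snd_induced_chart in_induced_chart)
qed

lemma induced_pullback_x:
  assumes "c \<in> atlas T" "d \<in> atlas M" "y \<in> snd (E c d) ` fst (E c d)"
  shows "fst (snd (chart_inv (E c d) y)) = chart_inv d (fst (snd y))"
proof -
  obtain q where q: "q \<in> fst (E c d)" "y = snd (E c d) q" using assms(3) by blast
  then show ?thesis
    using chart_inv_snd[OF induced_coord_chart[OF assms(1,2)] q(1)] M.coord_chart[OF assms(2)]
    by (simp add: snd_induced_chart in_induced_chart)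
qed

lemma induced_pullback_p:
  assumes "y \<in> snd (E c d) ` fst (E c d)"
  shows "momentum T M c d (chart_inv (E c d) y) = snd (snd y)"
  using snd_chart_inv[OF assms] by (metis snd_induced_chart snd_conv)

lemma has_derivative_pullback_t:
  assumes cd: "c \<in> atlas T" "d \<in> atlas M" and q: "q \<in> fst (E c d)" and \<phi>: "diff_at c \<phi> (fst q)"
  shows "((\<lambda>q. \<phi> (fst q)) \<circ> chart_inv (E c d) has_derivative (\<lambda>v. pd c (fst v) \<phi> (fst q))) (at (snd (E c d) q))"
proof (rule has_derivative_transform_within_open)
  show "((\<lambda>y. (\<phi> \<circ> chart_inv c) (fst y)) has_derivative (\<lambda>v. pd c (fst v) \<phi> (fst q))) (at (snd (E c d) q))"
    by (rule has_derivative_compose[of fst fst _ _ "\<phi> \<circ> chart_inv c" "\<lambda>v. pd c v \<phi> (fst q)"])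
      (use \<phi> in \<open>auto simp: diff_at_has_derivative snd_induced_chart
        intro: bounded_linear_imp_has_derivative bounded_linear_fst\<close>)
  show "open (snd (E c d) ` fst (E c d))"
    using induced_coord_chart[OF cd] by (simp add: coord_chart_def)
qed (use q cd in \<open>simp_all add: induced_pullback_t\<close>)

lemma has_derivative_pullback_x:
  assumes cd: "c \<in> atlas T" "d \<in> atlas M" and q: "q \<in> fst (E c d)" and \<phi>: "diff_at d \<phi> (fst (snd q))"
  shows "((\<lambda>q. \<phi> (fst (snd q))) \<circ> chart_inv (E c d) has_derivative (\<lambda>v. pd d (fst (snd v)) \<phi> (fst (snd q))))
    (at (snd (E c d) q))"
proof (rule has_derivative_transform_within_open)
  show "((\<lambda>y. (\<phi> \<circ> chart_inv d) (fst (snd y))) has_derivative (\<lambda>v. pd d (fst (snd v)) \<phi> (fst (snd q))))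
      (at (snd (E c d) q))"
    by (rule has_derivative_compose[of "\<lambda>y. fst (snd y)" "\<lambda>y. fst (snd y)" _ _ "\<phi> \<circ> chart_inv d" "\<lambda>v. pd d v \<phi> (fst (snd q))"])
      (use \<phi> in \<open>auto simp: diff_at_has_derivative snd_induced_chart
        intro: bounded_linear_imp_has_derivative bounded_linear_fst_comp bounded_linear_snd\<close>)
  show "open (snd (E c d) ` fst (E c d))"
    using induced_coord_chart[OF cd] by (simp add: coord_chart_def)
qed (use q cd in \<open>simp_all add: induced_pullback_x\<close>)

lemma bounded_linear_momentum:
  "bounded_linear (\<lambda>y :: (real^'m) \<times> (real^'n) \<times> (real^'m^'n). snd (snd y) $ i $ a)"
  by (intro bounded_linear_compose[OF bounded_linear_vec_nth] bounded_linear_snd_comp bounded_linear_snd)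

lemma has_derivative_momentum:
  assumes cd: "c \<in> atlas T" "d \<in> atlas M" and q: "q \<in> fst (E c d)"
  shows "((\<lambda>q. momentum T M c d q $ i $ a) \<circ> chart_inv (E c d) has_derivative (\<lambda>v. snd (snd v) $ i $ a))
    (at (snd (E c d) q))"
proof (rule has_derivative_transform_within_open)
  show "((\<lambda>y. snd (snd y) $ i $ a) has_derivative (\<lambda>v. snd (snd v) $ i $ a)) (at (snd (E c d) q))"
    by (rule bounded_linear_imp_has_derivative[OF bounded_linear_momentum])
  show "open (snd (E c d) ` fst (E c d))"
    using induced_coord_chart[OF cd] by (simp add: coord_chart_def)
qed (use q in \<open>simp_all add: induced_pullback_p\<close>)

lemma smooth_in_pullback_t:
  assumes cd: "c \<in> atlas T" "d \<in> atlas M" and \<phi>: "smooth_in c \<phi>"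
  shows "smooth_in (E c d) (\<lambda>q. \<phi> (fst q))"
  unfolding smooth_in_def
proof (rule smooth_on_cong)
  show o: "open (snd (E c d) ` fst (E c d))"
    using induced_coord_chart[OF cd] by (simp add: coord_chart_def)
  show "smooth_on (snd (E c d) ` fst (E c d)) (\<lambda>y. (\<phi> \<circ> chart_inv c) (fst y))"
    by (rule smooth_on_compose_linear[OF bounded_linear_fst _ o \<phi>[unfolded smooth_in_def]])
      (auto simp: snd_induced_chart in_induced_chart)
qed (simp add: induced_pullback_t cd)

lemma smooth_in_momentum:
  assumes cd: "c \<in> atlas T" "d \<in> atlas M"
  shows "smooth_in (E c d) (\<lambda>q. momentum T M c d q $ i $ a)"
  unfolding smooth_in_def
proof (rule smooth_on_cong)
  show "open (snd (E c d) ` fst (E c d))"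
    using induced_coord_chart[OF cd] by (simp add: coord_chart_def)
  show "smooth_on (snd (E c d) ` fst (E c d)) (\<lambda>y. snd (snd y) $ i $ a)"
    by (rule smooth_on_linear[OF bounded_linear_momentum])
qed (simp add: induced_pullback_p)

end

text \<open>Two induced charts; the primed one carries the tilde of the classical notation. In this notation,
  the letters \<open>J\<close>, \<open>K\<close> and \<open>A\<close>, \<open>B\<close> stand for \<open>\<partial>t'/\<partial>t\<close>, \<open>\<partial>t/\<partial>t'\<close> and \<open>\<partial>x'/\<partial>x\<close>, \<open>\<partial>x/\<partial>x'\<close>.\<close>

locale two_induced_charts = jet_manifolds T M
  for T :: "('a, real^'m) manifold" and M :: "('b, real^'n) manifold" +
  fixes c c' :: "('a, real^'m) chart" and d d' :: "('b, real^'n) chart"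
  assumes c: "c \<in> atlas T" and c': "c' \<in> atlas T" and d: "d \<in> atlas M" and d': "d' \<in> atlas M"
begin

abbreviation "e \<equiv> E c d"
abbreviation "e' \<equiv> E c' d'"
abbreviation "overlap \<equiv> fst e \<inter> fst e'"
abbreviation "p q i a \<equiv> momentum T M c d q $ i $ a"
abbreviation "p' q i a \<equiv> momentum T M c' d' q $ i $ a"
abbreviation "J q a b \<equiv> jac c c' (fst q) $ a $ b"
abbreviation "K q a b \<equiv> jac c' c (fst q) $ a $ b"
abbreviation "A q i j \<equiv> jac d d' (fst (snd q)) $ i $ j"
abbreviation "B q i j \<equiv> jac d' d (fst (snd q)) $ i $ j"

lemma coord_chart_e: "coord_chart e" and coord_chart_e': "coord_chart e'"
  using induced_coord_chart c c' d d' by auto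

lemma overlapD:
  assumes "q \<in> overlap"
  shows "q \<in> fst e" "q \<in> fst e'" "fst q \<in> fst c" "fst q \<in> fst c'"
    "fst (snd q) \<in> fst d" "fst (snd q) \<in> fst d'"
  using assms by (auto simp: in_induced_chart)

lemma momentum_law:
  assumes "q \<in> overlap"
  shows "p' q j b = (\<Sum>k\<in>UNIV. \<Sum>f\<in>UNIV. B q k j * J q b f * p q k f)"
proof -
  obtain t x \<alpha> where q: "q = (t, x, \<alpha>)" by (cases q)
  have "\<alpha> \<in> dual_fibre T M t x"
    using assms by (auto simp: q in_induced_chart jet_dual_def)
  from momentum_change[OF c c' _ _ d d' _ _ this, of j b] overlapD[OF assms] show ?thesis
    by (simp add: q)
qed

lemma pd_overlap_cong:
  assumes "q \<in> overlap" "\<And>s. s \<in> overlap \<Longrightarrow> f s = g s"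
  shows "pd e v f q = pd e v g q"
  by (rule pd_cong[OF coord_chart_e _ open_induced_overlap[OF c c' d d'] assms]) simp_all

lemma diff_at_overlap_cong:
  assumes "q \<in> overlap" "\<And>s. s \<in> overlap \<Longrightarrow> f s = g s"
  shows "diff_at e f q \<longleftrightarrow> diff_at e g q"
  by (rule diff_at_cong[OF coord_chart_e _ open_induced_overlap[OF c c' d d'] assms]) simp_all

lemma diff_at_t: "q \<in> fst e \<Longrightarrow> diff_at c \<phi> (fst q) \<Longrightarrow> diff_at e (\<lambda>q. \<phi> (fst q)) q"
  by (rule diff_atI[OF has_derivative_pullback_t[OF c d]])

lemma pd_t: "q \<in> fst e \<Longrightarrow> diff_at c \<phi> (fst q) \<Longrightarrow> pd e v (\<lambda>q. \<phi> (fst q)) q = pd c (fst v) \<phi> (fst q)"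
  by (rule pd_eqI[OF has_derivative_pullback_t[OF c d]])

lemma diff_at_x: "q \<in> fst e \<Longrightarrow> diff_at d \<phi> (fst (snd q)) \<Longrightarrow> diff_at e (\<lambda>q. \<phi> (fst (snd q))) q"
  by (rule diff_atI[OF has_derivative_pullback_x[OF c d]])

lemma pd_x:
  "q \<in> fst e \<Longrightarrow> diff_at d \<phi> (fst (snd q)) \<Longrightarrow>
    pd e v (\<lambda>q. \<phi> (fst (snd q))) q = pd d (fst (snd v)) \<phi> (fst (snd q))"
  by (rule pd_eqI[OF has_derivative_pullback_x[OF c d]])

lemma diff_at_p: "q \<in> fst e \<Longrightarrow> diff_at e (\<lambda>q. p q i a) q"
  by (rule diff_atI[OF has_derivative_momentum[OF c d]])

lemma pd_p: "q \<in> fst e \<Longrightarrow> pd e v (\<lambda>q. p q i a) q = snd (snd v) $ i $ a"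
  by (rule pd_eqI[OF has_derivative_momentum[OF c d]])

lemma diff_at_A: "q \<in> overlap \<Longrightarrow> diff_at e (\<lambda>q. A q i j) q"
  using diff_at_x[OF overlapD(1) M.diff_at_jac[OF d d']] overlapD by blast

lemma diff_at_B: "q \<in> overlap \<Longrightarrow> diff_at e (\<lambda>q. B q i j) q"
  using diff_at_x[OF overlapD(1) M.diff_at_jac'[OF d d']] overlapD by blast

lemma diff_at_J: "q \<in> overlap \<Longrightarrow> diff_at e (\<lambda>q. J q i j) q"
  using diff_at_t[OF overlapD(1) T.diff_at_jac[OF c c']] overlapD by blast

lemma diff_at_p':
  assumes q: "q \<in> overlap" shows "diff_at e (\<lambda>q. p' q j b) q"
proof -
  have "diff_at e (\<lambda>q. \<Sum>k\<in>UNIV. \<Sum>f\<in>UNIV. B q k j * J q b f * p q k f) q"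
    using q by (intro diff_at_sum diff_at_mult coord_chart_e diff_at_B diff_at_J diff_at_p) auto
  then show ?thesis
    by - (rule iffD2[OF diff_at_overlap_cong], rule q, erule momentum_law)
qed

lemma pd_p':
  assumes q: "q \<in> overlap"
  shows "pd e v (\<lambda>q. p' q j b) q
    = (\<Sum>k\<in>UNIV. \<Sum>f\<in>UNIV. pd d (fst (snd v)) (\<lambda>x. jac d' d x $ k $ j) (fst (snd q)) * J q b f * p q k f
        + B q k j * pd c (fst v) (\<lambda>t. jac c c' t $ b $ f) (fst q) * p q k f
        + B q k j * J q b f * snd (snd v) $ k $ f)"
proof -
  note ov = overlapD[OF q]
  have B: "pd e v (\<lambda>q. B q k j) q = pd d (fst (snd v)) (\<lambda>x. jac d' d x $ k $ j) (fst (snd q))" for k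
    by (rule pd_x[OF ov(1) M.diff_at_jac'[OF d d' ov(5,6)]])
  have J: "pd e v (\<lambda>q. J q b f) q = pd c (fst v) (\<lambda>t. jac c c' t $ b $ f) (fst q)" for f
    by (rule pd_t[OF ov(1) T.diff_at_jac[OF c c' ov(3,4)]])
  note df = diff_at_B[OF q] diff_at_J[OF q] diff_at_p[OF ov(1)]
  have "pd e v (\<lambda>q. p' q j b) q = pd e v (\<lambda>q. \<Sum>k\<in>UNIV. \<Sum>f\<in>UNIV. B q k j * J q b f * p q k f) q"
    by (rule pd_overlap_cong[OF q momentum_law])
  also have "\<dots> = (\<Sum>k\<in>UNIV. \<Sum>f\<in>UNIV. pd e v (\<lambda>q. B q k j * J q b f * p q k f) q)"
    by (simp add: pd_sum diff_at_sum diff_at_mult coord_chart_e ov df)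
  also have "\<dots> = (\<Sum>k\<in>UNIV. \<Sum>f\<in>UNIV. pd d (fst (snd v)) (\<lambda>x. jac d' d x $ k $ j) (fst (snd q)) * J q b f * p q k f
        + B q k j * pd c (fst v) (\<lambda>t. jac c c' t $ b $ f) (fst q) * p q k f
        + B q k j * J q b f * snd (snd v) $ k $ f)"
    by (simp add: pd_mult[OF coord_chart_e ov(1)] diff_at_mult coord_chart_e ov df B J pd_p[OF ov(1)] algebra_simps)
  finally show ?thesis .
qed

lemma snd_e'_dir:
  "snd e' s \<bullet> dir_t a = snd c' (fst s) $ a"
  "snd e' s \<bullet> dir_x i = snd d' (fst (snd s)) $ i"
  "snd e' s \<bullet> dir_p i a = p' s i a"
  by (simp_all add: snd_induced_chart dir_t_def dir_x_def dir_p_def inner_axis)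

lemma diff_at_coords:
  assumes q: "q \<in> overlap"
  shows "diff_at c (\<lambda>t. snd c' t $ a) (fst q)" "diff_at d (\<lambda>x. snd d' x $ i) (fst (snd q))"
  using smooth_on_differentiable[OF T.smooth_coord[OF c c']] smooth_on_differentiable[OF M.smooth_coord[OF d d']]
    overlapD[OF q] by (auto simp: diff_at_def)

lemma Basis_dir_cases:
  fixes b :: "(real^'m) \<times> (real^'n) \<times> (real^'m^'n)"
  assumes "b \<in> Basis"
  obtains a where "b = dir_t a" | i where "b = dir_x i" | i a where "b = dir_p i a"
  using assms unfolding Basis_prod_def Basis_vec_def dir_t_def dir_x_def dir_p_def
  by (auto simp: zero_prod_def)

lemma diff_transition_e: "diff_transition e e'"
proof -
  have "(snd e' \<circ> chart_inv e) differentiable (at (snd e q))" if q: "q \<in> overlap" for q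
  proof (subst differentiable_componentwise_within, rule ballI)
    fix b :: "(real^'m) \<times> (real^'n) \<times> (real^'m^'n)" assume "b \<in> Basis"
    have "diff_at e (\<lambda>s. snd e' s \<bullet> b) q"
      using \<open>b \<in> Basis\<close>
    proof (cases rule: Basis_dir_cases)
      case (1 a)
      show ?thesis unfolding 1 snd_e'_dir
        by (rule diff_at_t[OF overlapD(1)[OF q] diff_at_coords(1)[OF q]])
    next
      case (2 i)
      show ?thesis unfolding 2 snd_e'_dir
        by (rule diff_at_x[OF overlapD(1)[OF q] diff_at_coords(2)[OF q]])
    next
      case (3 i a)
      show ?thesis unfolding 3 snd_e'_dir by (rule diff_at_p'[OF q])
    qed
    then show "(\<lambda>x. (snd e' \<circ> chart_inv e) x \<bullet> b) differentiable (at (snd e q))"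
      by (simp add: diff_at_def o_def)
  qed
  then show ?thesis
    unfolding diff_transition_def
    using coord_chart_e coord_chart_e' open_induced_overlap[OF c c' d d'] by blast
qed

lemma diff_at_e: "q \<in> overlap \<Longrightarrow> diff_at e' f q \<Longrightarrow> diff_at e f q"
  using diff_at_change_chart[OF diff_transition_e] by blast

text \<open>The chain rule with the three kinds of coordinates separated. The new times depend on the old times
  only and the new positions on the old positions only, but the new momenta depend on everything.\<close>

lemma pd_change_e:
  assumes q: "q \<in> overlap" and f: "diff_at e' f q"
  shows "pd e v f q
    = (\<Sum>a\<in>UNIV. pd c (fst v) (\<lambda>t. snd c' t $ a) (fst q) * pd e' (dir_t a) f q)
      + (\<Sum>i\<in>UNIV. pd d (fst (snd v)) (\<lambda>x. snd d' x $ i) (fst (snd q)) * pd e' (dir_x i) f q)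
      + (\<Sum>i\<in>UNIV. \<Sum>a\<in>UNIV. pd e v (\<lambda>q. p' q i a) q * pd e' (dir_p i a) f q)"
  using pd_change_chart[OF diff_transition_e overlapD(1,2)[OF q] f, of v]
  by (simp add: sum_Basis_dir snd_e'_dir pd_t[OF overlapD(1)[OF q] diff_at_coords(1)[OF q]]
      pd_x[OF overlapD(1)[OF q] diff_at_coords(2)[OF q]])

text \<open>Momentum derivatives are tensorial. Space derivatives are so up to momentum derivatives, because the
  coefficients of the linear law of the momenta depend on the position.\<close>

lemma pd_dir_p:
  assumes q: "q \<in> overlap" and f: "diff_at e' f q"
  shows "pd e (dir_p k a) f q = (\<Sum>j\<in>UNIV. \<Sum>b\<in>UNIV. B q k j * J q b a * pd e' (dir_p j b) f q)"
proof -
  note ov = overlapD[OF q]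
  have "pd e (dir_p k a) (\<lambda>q. p' q j b) q = B q k j * J q b a" for j b
  proof -
    have "pd e (dir_p k a) (\<lambda>q. p' q j b) q
        = (\<Sum>l\<in>UNIV. \<Sum>f\<in>UNIV. if f = a then if l = k then B q k j * J q b a else 0 else 0)"
      unfolding pd_p'[OF q]
      by (intro sum.cong refl) (auto simp: dir_p_def axis_def pd_zero_dir[OF M.diff_at_jac'[OF d d' ov(5,6)]]
          pd_zero_dir[OF T.diff_at_jac[OF c c' ov(3,4)]])
    then show ?thesis by simp
  qed
  then show ?thesis
    unfolding pd_change_e[OF q f]
    by (simp add: dir_p_def pd_zero_dir[OF diff_at_coords(1)[OF q]] pd_zero_dir[OF diff_at_coords(2)[OF q]])
qed

lemma pd_dir_x:
  assumes q: "q \<in> overlap" and f: "diff_at e' f q"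
  shows "pd e (dir_x i) f q = (\<Sum>r\<in>UNIV. A q r i * pd e' (dir_x r) f q)
    + (\<Sum>l\<in>UNIV. \<Sum>b\<in>UNIV. pd e (dir_x i) (\<lambda>q. p' q l b) q * pd e' (dir_p l b) f q)"
  unfolding pd_change_e[OF q f]
  by (simp add: dir_x_def pd_zero_dir[OF diff_at_coords(1)[OF q]] jac_def)

end

section \<open>The Christoffel symbols and the temporal components\<close>

lemma matrix_inv_congruence:
  fixes h J K :: "real^'k^'k"
  assumes "invertible h" "J ** K = mat 1" "h' = transpose K ** h ** K"
  shows "matrix_inv h' = J ** matrix_inv h ** transpose J"
proof (rule matrix_inv_unique)
  have K: "K ** J = mat 1" using assms(2) matrix_left_right_inverse by blast
  have JK: "transpose K ** transpose J = mat 1"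
    using assms(2) by (metis matrix_transpose_mul transpose_mat)
  have "h' ** (J ** matrix_inv h ** transpose J)
      = transpose K ** (h ** ((K ** J) ** matrix_inv h)) ** transpose J"
    by (simp add: assms(3) matrix_mul_assoc)
  also have "\<dots> = mat 1"
    by (simp add: K matrix_inv_left_right[OF assms(1)] JK)
  finally show "h' ** (J ** matrix_inv h ** transpose J) = mat 1" .
qed

locale metric_manifold = charted_manifold X for X :: "('p, real^'k) manifold" +
  fixes h :: "('p, real^'k) chart \<Rightarrow> 'p \<Rightarrow> real^'k^'k"
  assumes h: "semi_riemannian_metric X h"
begin

lemma smooth_h: "c \<in> atlas X \<Longrightarrow> smooth_in c (\<lambda>t. h c t $ a $ b)"
  using h by (simp add: semi_riemannian_metric_def)

lemma h_law:
  assumes "c \<in> atlas X" "c' \<in> atlas X" "t \<in> fst c" "t \<in> fst c'"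
  shows "h c' t $ a $ b =
    (\<Sum>e\<in>UNIV. \<Sum>f\<in>UNIV. h c t $ e $ f * jac c' c t $ e $ a * jac c' c t $ f $ b)"
  using h assms unfolding semi_riemannian_metric_def by blast

lemma h_symmetric: "c \<in> atlas X \<Longrightarrow> t \<in> fst c \<Longrightarrow> h c t $ a $ b = h c t $ b $ a"
proof -
  assume "c \<in> atlas X" "t \<in> fst c"
  then have "transpose (h c t) = h c t"
    using h unfolding semi_riemannian_metric_def by blast
  from arg_cong[OF this, of "\<lambda>A. A $ b $ a"] show ?thesis
    by (simp add: transpose_def)
qed

lemma h_invertible: "c \<in> atlas X \<Longrightarrow> t \<in> fst c \<Longrightarrow> invertible (h c t)"
  using h by (simp add: semi_riemannian_metric_def)

lemma jac_mult:
  assumes "c \<in> atlas X" "c' \<in> atlas X" "t \<in> fst c" "t \<in> fst c'"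
  shows "jac c c' t ** jac c' c t = mat 1"
  using jac_inverse[OF diff_transition diff_transition, of c' c t] assms by simp

lemma h_inv_law:
  assumes "c \<in> atlas X" "c' \<in> atlas X" "t \<in> fst c" "t \<in> fst c'"
  shows "matrix_inv (h c' t) = jac c c' t ** matrix_inv (h c t) ** transpose (jac c c' t)"
proof (rule matrix_inv_congruence[OF h_invertible[OF assms(1,3)] jac_mult[OF assms]])
  have "(\<Sum>e\<in>UNIV. \<Sum>f\<in>UNIV. h c t $ e $ f * jac c' c t $ e $ a * jac c' c t $ f $ b)
      = (\<Sum>f\<in>UNIV. (\<Sum>e\<in>UNIV. jac c' c t $ e $ a * h c t $ e $ f) * jac c' c t $ f $ b)" for a b
    by (subst sum.swap) (simp add: sum_distrib_left sum_distrib_right mult_ac)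
  then show "h c' t = transpose (jac c' c t) ** h c t ** jac c' c t"
    using h_law[OF assms] by (simp add: vec_eq_iff matrix_matrix_mult_def transpose_def)
qed

text \<open>The Christoffel symbols of the first kind.\<close>

definition christoffel1 :: "('p, real^'k) chart \<Rightarrow> 'k \<Rightarrow> 'k \<Rightarrow> 'k \<Rightarrow> 'p \<Rightarrow> real"
  where "christoffel1 c x b e t =
    (pd c (axis e 1) (\<lambda>s. h c s $ x $ b) t + pd c (axis b 1) (\<lambda>s. h c s $ x $ e) t
      - pd c (axis x 1) (\<lambda>s. h c s $ b $ e) t) / 2"

lemma christoffel_eq: "christoffel h c a b e t = (\<Sum>x\<in>UNIV. matrix_inv (h c t) $ a $ x * christoffel1 c x b e t)"
  by (simp add: christoffel_def christoffel1_def)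

text \<open>The derivative of \<open>h' = K\<^sup>T h K\<close> consists of the tensorial part \<open>T\<close> and of two terms \<open>P\<close> that contain
  the second derivatives \<open>L\<close> of the coordinate change. Six such terms occur in the combination that
  defines the symbol; the symmetries of \<open>h\<close> and \<open>L\<close> cancel four of them and make the other two equal.\<close>

lemma christoffel1_law:
  assumes c: "c \<in> atlas X" "c' \<in> atlas X" "t \<in> fst c" "t \<in> fst c'"
  shows "christoffel1 c' x b e t =
    (\<Sum>r\<in>UNIV. jac c' c t $ r $ x *
      ((\<Sum>f\<in>UNIV. (\<Sum>g\<in>UNIV. jac c' c t $ g $ e * christoffel1 c r f g t) * jac c' c t $ f $ b)
       + (\<Sum>f\<in>UNIV. h c t $ r $ f * pd c' (axis e 1) (\<lambda>s. jac c' c s $ f $ b) t)))"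
proof -
  define K where "K = jac c' c t"
  define H where "H = h c t"
  define L where "L f w y = pd c' (axis w 1) (\<lambda>s. jac c' c s $ f $ y) t" for f w y
  define D where "D a b w = pd c (axis w 1) (\<lambda>s. h c s $ a $ b) t" for a b w
  define D' where "D' a b w = pd c' (axis w 1) (\<lambda>s. h c' s $ a $ b) t" for a b w
  have Lsym: "L f w y = L f y w" for f w y
    unfolding L_def by (rule pd_jac_symmetric[OF c(2,1,4,3)])

  define T where "T a b w = (\<Sum>u\<in>UNIV. \<Sum>v\<in>UNIV. \<Sum>z\<in>UNIV. K $ z $ w * D u v z * K $ u $ a * K $ v $ b)" for a b w
  define P where "P a b w = (\<Sum>u\<in>UNIV. \<Sum>v\<in>UNIV. H $ u $ v * L u w a * K $ v $ b)" for a b w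
  have Psym: "P a b w = P w b a" for a b w
    unfolding P_def using Lsym by simp
  have D'_eq: "D' a b w = T a b w + P a b w + P b a w" for a b w
  proof -
    have dh: "diff_at c' (\<lambda>s. h c s $ u $ v) t" for u v
      by (rule diff_at_change_chart[OF diff_transition[OF c(2,1)] c(4,3)
            smooth_in_diff_at[OF smooth_h[OF c(1)] c(3)]])
    have dK: "diff_at c' (\<lambda>s. jac c' c s $ u $ v) t" for u v
      by (rule diff_at_jac[OF c(2,1,4,3)])
    have ph: "pd c' (axis w 1) (\<lambda>s. h c s $ u $ v) t = (\<Sum>z\<in>UNIV. K $ z $ w * D u v z)" for u v
      unfolding K_def D_def by (rule pd_change[OF c(2,1,4,3) smooth_in_diff_at[OF smooth_h[OF c(1)] c(3)]])
    note mult = coord_chart[OF c(2)] c(4)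
    have "D' a b w = pd c' (axis w 1) (\<lambda>s. \<Sum>u\<in>UNIV. \<Sum>v\<in>UNIV. h c s $ u $ v * jac c' c s $ u $ a * jac c' c s $ v $ b) t"
      unfolding D'_def
      by (rule pd_cong[OF coord_chart[OF c(2)] _ open_overlap[OF c(2,1)]]) (use c h_law[OF c(1,2)] in auto)
    also have "\<dots> = (\<Sum>u\<in>UNIV. \<Sum>v\<in>UNIV. (\<Sum>z\<in>UNIV. K $ z $ w * D u v z * K $ u $ a * K $ v $ b)
        + H $ u $ v * L u w a * K $ v $ b + H $ u $ v * K $ u $ a * L v w b)"
      by (simp add: pd_sum diff_at_sum diff_at_mult[OF mult] pd_mult[OF mult] dh dK ph
          flip: K_def H_def L_def) (simp add: sum_distrib_left sum_distrib_right algebra_simps)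
    also have "\<dots> = T a b w + P a b w + (\<Sum>u\<in>UNIV. \<Sum>v\<in>UNIV. H $ u $ v * K $ u $ a * L v w b)"
      by (simp add: sum.distrib T_def P_def)
    also have "(\<Sum>u\<in>UNIV. \<Sum>v\<in>UNIV. H $ u $ v * K $ u $ a * L v w b) = P b a w"
      unfolding P_def H_def
      by (subst sum.swap) (simp add: h_symmetric[OF c(1,3)] mult_ac)
    finally show ?thesis .
  qed
  have T_eq: "(T x b e + T x e b - T b e x) / 2
      = (\<Sum>r\<in>UNIV. \<Sum>f\<in>UNIV. \<Sum>g\<in>UNIV. K $ r $ x * K $ f $ b * K $ g $ e * christoffel1 c r f g t)"
  proof -
    have "T x b e = (\<Sum>r\<in>UNIV. \<Sum>f\<in>UNIV. \<Sum>g\<in>UNIV. K $ r $ x * K $ f $ b * K $ g $ e * D r f g)"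
      by (simp add: T_def mult_ac)
    moreover have "T x e b = (\<Sum>r\<in>UNIV. \<Sum>f\<in>UNIV. \<Sum>g\<in>UNIV. K $ r $ x * K $ f $ b * K $ g $ e * D r g f)"
      unfolding T_def by (subst sum.swap[of _ _ UNIV]) (simp add: mult_ac)
    moreover have "T b e x = (\<Sum>r\<in>UNIV. \<Sum>f\<in>UNIV. \<Sum>g\<in>UNIV. K $ r $ x * K $ f $ b * K $ g $ e * D f g r)"
    proof -
      have "T b e x = (\<Sum>f\<in>UNIV. \<Sum>g\<in>UNIV. \<Sum>r\<in>UNIV. K $ r $ x * K $ f $ b * K $ g $ e * D f g r)"
        by (simp add: T_def mult_ac)
      also have "\<dots> = (\<Sum>f\<in>UNIV. \<Sum>r\<in>UNIV. \<Sum>g\<in>UNIV. K $ r $ x * K $ f $ b * K $ g $ e * D f g r)"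
        by (intro sum.cong refl sum.swap)
      also have "\<dots> = (\<Sum>r\<in>UNIV. \<Sum>f\<in>UNIV. \<Sum>g\<in>UNIV. K $ r $ x * K $ f $ b * K $ g $ e * D f g r)"
        by (rule sum.swap)
      finally show ?thesis .
    qed
    ultimately show ?thesis
      by (simp add: christoffel1_def D_def[symmetric] sum.distrib[symmetric] sum_subtractf[symmetric]
          sum_divide_distrib algebra_simps diff_divide_distrib add_divide_distrib)
  qed
  have "christoffel1 c' x b e t = (D' x b e + D' x e b - D' b e x) / 2"
    by (simp add: christoffel1_def D'_def)
  also have "\<dots> = (T x b e + T x e b - T b e x) / 2 + P b x e"
    unfolding D'_eq using Psym[of x b e] Psym[of x e b] Psym[of b x e] by (simp add: field_simps)
  also have "P b x e = (\<Sum>r\<in>UNIV. \<Sum>f\<in>UNIV. K $ r $ x * (H $ r $ f * L f e b))"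
    unfolding P_def H_def
    by (subst sum.swap) (simp add: h_symmetric[OF c(1,3)] mult_ac)
  finally show ?thesis
    unfolding T_eq
    by (simp add: K_def H_def L_def sum_distrib_left sum_distrib_right sum.distrib distrib_left mult_ac)
qed

text \<open>For a fixed second lower index, the symbols form a matrix, and raising an index is multiplication by
  the inverse metric. In this form the factors \<open>J\<close> and \<open>K\<close> cancel by associativity.\<close>

lemma christoffel_law:
  assumes c: "c \<in> atlas X" "c' \<in> atlas X" "t \<in> fst c" "t \<in> fst c'"
  shows "(\<chi> a b. christoffel h c' a b e t) = jac c c' t **
    ((\<chi> a f. \<Sum>g\<in>UNIV. jac c' c t $ g $ e * christoffel h c a f g t) ** jac c' c t
      + (\<chi> a b. pd c' (axis e 1) (\<lambda>s. jac c' c s $ a $ b) t))"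
proof -
  define J where "J = jac c c' t"
  define K where "K = jac c' c t"
  define L where "L = (\<chi> a b. pd c' (axis e 1) (\<lambda>s. jac c' c s $ a $ b) t)"
  define \<Gamma> where "\<Gamma> = (\<chi> r f. \<Sum>g\<in>UNIV. K $ g $ e * christoffel1 c r f g t)"
  define \<Gamma>' where "\<Gamma>' = (\<chi> x b. christoffel1 c' x b e t)"
  have JK: "transpose J ** transpose K = mat 1"
    using jac_mult[OF c(2,1,4,3)] by (metis J_def K_def matrix_transpose_mul transpose_mat)
  have \<Gamma>': "\<Gamma>' = transpose K ** (\<Gamma> ** K + h c t ** L)"
    by (simp add: \<Gamma>_def \<Gamma>'_def K_def L_def vec_eq_iff matrix_matrix_mult_def transpose_def
        christoffel1_law[OF c])
  have "(\<chi> a b. christoffel h c' a b e t) = matrix_inv (h c' t) ** \<Gamma>'"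
    by (simp add: \<Gamma>'_def vec_eq_iff matrix_matrix_mult_def christoffel_eq)
  also have "\<dots> = J ** (matrix_inv (h c t) ** ((transpose J ** transpose K) ** (\<Gamma> ** K + h c t ** L)))"
    unfolding \<Gamma>' h_inv_law[OF c] by (simp add: J_def matrix_mul_assoc)
  also have "\<dots> = J ** ((matrix_inv (h c t) ** \<Gamma>) ** K + (matrix_inv (h c t) ** h c t) ** L)"
    unfolding JK by (simp add: matrix_add_ldistrib matrix_mul_assoc)
  also have "\<dots> = J ** ((matrix_inv (h c t) ** \<Gamma>) ** K + L)"
    by (simp add: matrix_inv_left_right[OF h_invertible[OF c(1,3)]])
  also have "matrix_inv (h c t) ** \<Gamma> = (\<chi> a f. \<Sum>g\<in>UNIV. K $ g $ e * christoffel h c a f g t)"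
  proof -
    have "(\<Sum>r\<in>UNIV. matrix_inv (h c t) $ a $ r * (\<Sum>g\<in>UNIV. K $ g $ e * christoffel1 c r f g t))
        = (\<Sum>g\<in>UNIV. K $ g $ e * (\<Sum>r\<in>UNIV. matrix_inv (h c t) $ a $ r * christoffel1 c r f g t))" for a f
      unfolding sum_distrib_left by (subst sum.swap) (simp add: mult_ac)
    then show ?thesis
      by (simp add: \<Gamma>_def vec_eq_iff matrix_matrix_mult_def christoffel_eq)
  qed
  finally show ?thesis by (simp add: J_def K_def L_def)
qed

lemma smooth_in_christoffel:
  assumes "c \<in> atlas X" shows "smooth_in c (christoffel h c a b e)"
proof -
  note cc = coord_chart[OF assms]
  have "smooth_in c (\<lambda>t. christoffel h c a b e t)"
    unfolding christoffel_eq christoffel1_def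
    by (intro smooth_in_sum smooth_in_mult smooth_in_add smooth_in_diff smooth_in_divide_const
        smooth_in_matrix_inv smooth_in_pd smooth_h cc assms) (rule h_invertible[OF assms])
  then show ?thesis by simp
qed

end

context two_induced_charts
begin

text \<open>The inhomogeneous part of the Christoffel law is \<open>J L\<close>, with \<open>L\<close> the derivative of \<open>K\<close>. Differentiating
  \<open>J K = 1\<close> turns it into \<open>- DJ K\<close>, where \<open>DJ\<close> is the derivative of \<open>J\<close>, and \<open>K\<close> cancels against the
  factor \<open>J\<close> of the new momenta. What is left is the time derivative of the new momenta, which depend
  on the time through \<open>J\<close> only.\<close>

lemma canonical_N1_law:
  assumes h: "semi_riemannian_metric T h" and q: "q \<in> overlap"
  shows "canonical_N1 T M h c' d' q b j y =
    (\<Sum>k\<in>UNIV. \<Sum>f\<in>UNIV. \<Sum>a\<in>UNIV. canonical_N1 T M h c d q f k a * J q b f * B q k j * K q a y)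
    - (\<Sum>a\<in>UNIV. K q a y * pd e (dir_t a) (\<lambda>q. p' q j b) q)"
proof -
  interpret metric_manifold T h by unfold_locales (rule h)
  note ov = overlapD[OF q]
  note cc = c c' ov(3,4)
  let ?t = "fst q"
  define Jm where "Jm = jac c c' ?t"
  define Km where "Km = jac c' c ?t"
  define P where "P = (\<chi> f. \<Sum>k\<in>UNIV. B q k j * p q k f)"
  define P' where "P' = (\<chi> x. p' q j x)"
  define C where "C = (\<chi> a f. \<Sum>g\<in>UNIV. Km $ g $ y * christoffel h c a f g ?t)"
  define L where "L = (\<chi> a b. pd c' (axis y 1) (\<lambda>s. jac c' c s $ a $ b) ?t)"
  define DJ where "DJ = (\<chi> b f. \<Sum>a\<in>UNIV. Km $ a $ y * pd c (axis a 1) (\<lambda>s. jac c c' s $ b $ f) ?t)"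
  have KJ: "Km ** Jm = mat 1"
    using jac_mult cc by (simp add: Jm_def Km_def)
  have P': "P' = Jm *v P"
    unfolding P'_def P_def Jm_def momentum_law[OF q] matrix_vector_mult_def vec_eq_iff
    by (subst sum.swap) (simp add: sum_distrib_left mult_ac)
  have JL: "Jm ** L = - (DJ ** Km)"
  proof -
    have "(\<Sum>f\<in>UNIV. Jm $ b $ f * L $ f $ x) + (\<Sum>f\<in>UNIV. DJ $ b $ f * Km $ f $ x) = 0" for b x
    proof -
      have dJ: "diff_at c' (\<lambda>s. jac c c' s $ b $ f) ?t" and dK: "diff_at c' (\<lambda>s. jac c' c s $ f $ x) ?t" for f
        using T.diff_at_jac'[OF c' c ov(4,3)] T.diff_at_jac[OF c' c ov(4,3)] by auto
      note mult = T.coord_chart[OF c'] ov(4)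
      have "0 = pd c' (axis y 1) (\<lambda>s. if b = x then 1 else 0) ?t" by simp
      also have "\<dots> = pd c' (axis y 1) (\<lambda>s. \<Sum>f\<in>UNIV. jac c c' s $ b $ f * jac c' c s $ f $ x) ?t"
        by (rule pd_cong[OF mult(1) _ T.open_overlap[OF c' c]]) (use ov T.jac_cancel[OF c' c] in auto)
      also have "\<dots> = (\<Sum>f\<in>UNIV. pd c' (axis y 1) (\<lambda>s. jac c c' s $ b $ f) ?t * Km $ f $ x + Jm $ b $ f * L $ f $ x)"
        by (simp add: pd_sum diff_at_mult[OF mult] pd_mult[OF mult] dJ dK Km_def Jm_def L_def)
      also have "\<dots> = (\<Sum>f\<in>UNIV. DJ $ b $ f * Km $ f $ x + Jm $ b $ f * L $ f $ x)"
        unfolding DJ_def Km_def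
        using T.pd_change[OF c' c ov(4,3) T.diff_at_jac[OF cc]] by simp
      finally show ?thesis by (simp add: sum.distrib add.commute)
    qed
    then show ?thesis
      by (simp add: vec_eq_iff matrix_matrix_mult_def eq_neg_iff_add_eq_0)
  qed
  have "canonical_N1 T M h c' d' q b j y = ((\<chi> a b. christoffel h c' a b y ?t) *v P') $ b"
    by (simp add: canonical_N1_def P'_def matrix_vector_mult_def)
  also have "(\<chi> a b. christoffel h c' a b y ?t) = Jm ** (C ** Km + L)"
    unfolding Jm_def C_def Km_def L_def by (rule christoffel_law[OF cc])
  also have "\<dots> = (Jm ** C) ** Km - DJ ** Km"
    by (simp add: matrix_add_ldistrib matrix_mul_assoc JL)
  also have "\<dots> *v P' = (Jm ** C) *v ((Km ** Jm) *v P) - DJ *v ((Km ** Jm) *v P)"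
    unfolding P' matrix_vector_mult_diff_rdistrib by (simp add: matrix_vector_mul_assoc matrix_mul_assoc)
  also have "\<dots> = (Jm ** C) *v P - DJ *v P"
    by (simp add: KJ)
  also have "((Jm ** C) *v P - DJ *v P) $ b = (Jm *v (C *v P)) $ b - (DJ *v P) $ b"
    by (simp add: matrix_vector_mul_assoc)
  also have "(Jm *v (C *v P)) $ b
      = (\<Sum>k\<in>UNIV. \<Sum>f\<in>UNIV. \<Sum>a\<in>UNIV. canonical_N1 T M h c d q f k a * J q b f * B q k j * K q a y)"
  proof -
    have "(\<Sum>f\<in>UNIV. \<Sum>x\<in>UNIV. \<Sum>k\<in>UNIV. \<Sum>a\<in>UNIV. F f x k a)
        = (\<Sum>k\<in>UNIV. \<Sum>f\<in>UNIV. \<Sum>a\<in>UNIV. \<Sum>x\<in>UNIV. F f x k a)"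
      for F :: "'m \<Rightarrow> 'm \<Rightarrow> 'n \<Rightarrow> 'm \<Rightarrow> real"
      unfolding sum.cartesian_product UNIV_Times_UNIV
      by (rule sum.reindex_bij_witness[of _ "\<lambda>(k, f, a, x). (f, x, k, a)" "\<lambda>(f, x, k, a). (k, f, a, x)"]) auto
    from this[of "\<lambda>f x k a. Jm $ b $ f * (Km $ a $ y * christoffel h c f x a ?t * (B q k j * p q k x))"]
    show ?thesis
      by (simp add: matrix_vector_mult_def C_def P_def canonical_N1_def sum_distrib_left sum_distrib_right
          Jm_def Km_def mult_ac)
  qed
  also have "(DJ *v P) $ b = (\<Sum>a\<in>UNIV. K q a y * pd e (dir_t a) (\<lambda>q. p' q j b) q)"
  proof -
    have pdt: "pd e (dir_t a) (\<lambda>q. p' q j b) q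
        = (\<Sum>k\<in>UNIV. \<Sum>f\<in>UNIV. B q k j * pd c (axis a 1) (\<lambda>t. jac c c' t $ b $ f) ?t * p q k f)" for a
      unfolding pd_p'[OF q] by (simp add: dir_t_def pd_zero_dir[OF M.diff_at_jac'[OF d d' ov(5,6)]])
    have "(\<Sum>f\<in>UNIV. \<Sum>a\<in>UNIV. \<Sum>k\<in>UNIV. F f a k) = (\<Sum>a\<in>UNIV. \<Sum>k\<in>UNIV. \<Sum>f\<in>UNIV. F f a k)"
      for F :: "'m \<Rightarrow> 'm \<Rightarrow> 'n \<Rightarrow> real"
      unfolding sum.cartesian_product UNIV_Times_UNIV
      by (rule sum.reindex_bij_witness[of _ "\<lambda>(a, k, f). (f, a, k)" "\<lambda>(f, a, k). (a, k, f)"]) auto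
    from this[of "\<lambda>f a k. Km $ a $ y * pd c (axis a 1) (\<lambda>s. jac c c' s $ b $ f) ?t * (B q k j * p q k f)"]
    show ?thesis
      by (simp add: pdt matrix_vector_mult_def DJ_def P_def sum_distrib_left sum_distrib_right Km_def mult_ac)
  qed
  finally show ?thesis .
qed

end

section \<open>Kronecker regular Hamiltonians\<close>

locale hamilton_space = jet_manifolds T M
  for T :: "('a, real^'m) manifold" and M :: "('b, real^'n) manifold" +
  fixes h :: "('a, real^'m) chart \<Rightarrow> 'a \<Rightarrow> real^'m^'m"
    and H :: "('a, 'b) jet_dual_point \<Rightarrow> real"
    and g :: "('a, real^'m) chart \<Rightarrow> ('b, real^'n) chart \<Rightarrow> ('a, 'b) jet_dual_point \<Rightarrow> real^'n^'n"
  assumes h: "semi_riemannian_metric T h"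
    and H: "smooth_function T M H"
    and g: "vertical_metric T M h H g"
begin

sublocale metric: metric_manifold T h
  by unfold_locales (rule h)

text \<open>The functions \<open>\<partial>H/\<partial>p\<close> and \<open>g\<^sub>i\<^sub>j\<close>, the bracket \<open>{f, H}\<^sub>b\<close>, the mixed derivatives of \<open>H\<close> with a lowered
  index, and the expression in square brackets in the definition of the spatial components.\<close>

abbreviation dH :: "('a, real^'m) chart \<Rightarrow> ('b, real^'n) chart \<Rightarrow> 'n \<Rightarrow> 'm \<Rightarrow> ('a, 'b) jet_dual_point \<Rightarrow> real"
  where "dH c d k b \<equiv> pd (E c d) (dir_p k b) H"

abbreviation glow :: "('a, real^'m) chart \<Rightarrow> ('b, real^'n) chart \<Rightarrow> 'n \<Rightarrow> 'n \<Rightarrow> ('a, 'b) jet_dual_point \<Rightarrow> real"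
  where "glow c d i j q \<equiv> matrix_inv (g c d q) $ i $ j"

definition bracket :: "('a, real^'m) chart \<Rightarrow> ('b, real^'n) chart \<Rightarrow> 'm \<Rightarrow> (('a, 'b) jet_dual_point \<Rightarrow> real)
    \<Rightarrow> ('a, 'b) jet_dual_point \<Rightarrow> real"
  where "bracket c d b f q = (\<Sum>k\<in>UNIV. pd (E c d) (dir_x k) f q * dH c d k b q)
    - (\<Sum>k\<in>UNIV. pd (E c d) (dir_x k) H q * pd (E c d) (dir_p k b) f q)"

definition mixed :: "('a, real^'m) chart \<Rightarrow> ('b, real^'n) chart \<Rightarrow> 'm \<Rightarrow> 'n \<Rightarrow> 'n \<Rightarrow> ('a, 'b) jet_dual_point \<Rightarrow> real"
  where "mixed c d b i j q = (\<Sum>k\<in>UNIV. glow c d i k q * pd (E c d) (dir_x j) (dH c d k b) q)"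

definition quad :: "('a, real^'m) chart \<Rightarrow> ('b, real^'n) chart \<Rightarrow> 'm \<Rightarrow> 'n \<Rightarrow> 'n \<Rightarrow> ('a, 'b) jet_dual_point \<Rightarrow> real"
  where "quad c d b i j q = bracket c d b (glow c d i j) q + mixed c d b i j q + mixed c d b j i q"

lemma canonical_N2_eq:
  "canonical_N2 T M h H g c d q a i j = (\<Sum>b\<in>UNIV. matrix_inv (h c (fst q)) $ a $ b / 4 * quad c d b i j q)"
  unfolding canonical_N2_def Let_def quad_def bracket_def mixed_def
    sum.distrib[symmetric] sum_subtractf[symmetric] sum_distrib_left
  by (simp add: mult_ac)

lemma smooth_H: "c \<in> atlas T \<Longrightarrow> d \<in> atlas M \<Longrightarrow> smooth_in (E c d) H"
  using H by (simp add: smooth_function_def)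

lemma smooth_dH: "c \<in> atlas T \<Longrightarrow> d \<in> atlas M \<Longrightarrow> smooth_in (E c d) (dH c d k b)"
  by (rule smooth_in_pd[OF induced_coord_chart smooth_H])

lemma smooth_g: "c \<in> atlas T \<Longrightarrow> d \<in> atlas M \<Longrightarrow> smooth_in (E c d) (\<lambda>q. g c d q $ i $ j)"
  using g by (simp add: vertical_metric_def d_tensor_def)

lemma g_law:
  assumes "c \<in> atlas T" "d \<in> atlas M" "c' \<in> atlas T" "d' \<in> atlas M" "q \<in> fst (E c d) \<inter> fst (E c' d')"
  shows "g c d q $ i $ j = (\<Sum>k\<in>UNIV. \<Sum>l\<in>UNIV. g c' d' q $ k $ l
            * jac d' d (fst (snd q)) $ i $ k * jac d' d (fst (snd q)) $ j $ l)"
proof -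
  have "d_tensor T M g" using g by (simp add: vertical_metric_def)
  then show ?thesis
    by (rule conjunct2[OF iffD1[OF d_tensor_def], rule_format, OF _ assms])
qed

lemma g_transpose: "c \<in> atlas T \<Longrightarrow> d \<in> atlas M \<Longrightarrow> q \<in> fst (E c d) \<Longrightarrow> transpose (g c d q) = g c d q"
  using g unfolding vertical_metric_def by blast

lemma g_invertible:
  assumes "c \<in> atlas T" "d \<in> atlas M" "q \<in> fst (E c d)" shows "invertible (g c d q)"
proof -
  have "rank (g c d q) = CARD('n)"
    using g assms unfolding vertical_metric_def by blast
  then show ?thesis by (simp add: invertible_det_nz det_eq_0_rank)
qed

lemma hessian:
  assumes "c \<in> atlas T" "d \<in> atlas M" "q \<in> fst (E c d)"
  shows "pd (E c d) (dir_p i a) (dH c d j b) q = 2 * h c (fst q) $ a $ b * g c d q $ i $ j"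
proof -
  have "1/2 * pd (E c d) (dir_p i a) (dH c d j b) q = h c (fst q) $ a $ b * g c d q $ i $ j"
    using g assms unfolding vertical_metric_def by blast
  then show ?thesis by simp
qed

lemma smooth_glow:
  "c \<in> atlas T \<Longrightarrow> d \<in> atlas M \<Longrightarrow> smooth_in (E c d) (\<lambda>q. glow c d i j q)"
  by (rule smooth_in_matrix_inv[OF induced_coord_chart smooth_g g_invertible])

lemma glow_symmetric:
  assumes "c \<in> atlas T" "d \<in> atlas M" "q \<in> fst (E c d)"
  shows "glow c d i j q = glow c d j i q"
proof -
  have "g c d q ** transpose (matrix_inv (g c d q)) = transpose (matrix_inv (g c d q) ** g c d q)"
    by (simp add: matrix_transpose_mul g_transpose[OF assms])
  then have "matrix_inv (g c d q) = transpose (matrix_inv (g c d q))"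
    by (intro matrix_inv_unique) (simp add: matrix_inv_left_right[OF g_invertible[OF assms]] transpose_mat)
  from arg_cong[OF this, of "\<lambda>A. A $ i $ j"] show ?thesis by (simp add: transpose_def)
qed

lemma glow_g:
  assumes "c \<in> atlas T" "d \<in> atlas M" "q \<in> fst (E c d)"
  shows "(\<Sum>k\<in>UNIV. glow c d i k q * g c d q $ k $ j) = (if i = j then 1 else 0)"
  using arg_cong[OF matrix_inv_left_right(1)[OF g_invertible[OF assms]], of "\<lambda>A. A $ i $ j"]
  by (simp add: matrix_matrix_mult_def mat_def)

lemma g_glow:
  assumes "c \<in> atlas T" "d \<in> atlas M" "q \<in> fst (E c d)"
  shows "(\<Sum>k\<in>UNIV. g c d q $ i $ k * glow c d k j q) = (if i = j then 1 else 0)"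
  using arg_cong[OF matrix_inv_left_right(2)[OF g_invertible[OF assms]], of "\<lambda>A. A $ i $ j"]
  by (simp add: matrix_matrix_mult_def mat_def)

text \<open>The third momentum derivatives of \<open>H\<close> are totally symmetric, so in a derivative of the Hessian the
  factor \<open>h\<^sub>a\<^sub>b\<close> can be exchanged for \<open>h\<^sub>a\<^sub>x\<close> when the momentum indices are permuted accordingly. Tracing
  with the inverse of \<open>h\<close> gives \<open>m D = D'\<close> for two derivatives \<open>D\<close>, \<open>D'\<close> of \<open>g\<close> and, with their roles
  exchanged, \<open>m D' = D\<close>. As \<open>m\<^sup>2 \<noteq> 1\<close>, both vanish.\<close>

lemma pd_dir_p_g:
  assumes c: "c \<in> atlas T" and d: "d \<in> atlas M" and q: "q \<in> fst (E c d)" and card: "CARD('m) \<noteq> 1"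
  shows "pd (E c d) (dir_p k x) (\<lambda>q. g c d q $ i $ j) q = 0"
proof -
  let ?e = "E c d" and ?h = "h c (fst q)"
  note cc = induced_coord_chart[OF c d]
  define D where "D k x i j = pd ?e (dir_p k x) (\<lambda>q. g c d q $ i $ j) q" for k x i j
  have third: "pd ?e (dir_p k x) (pd ?e (dir_p i a) (dH c d j b)) q = 2 * ?h $ a $ b * D k x i j" for k x i a j b
  proof -
    have hconst: "diff_at ?e (\<lambda>q. h c (fst q) $ a $ b) q" "pd ?e (dir_p k x) (\<lambda>q. h c (fst q) $ a $ b) q = 0"
    proof -
      have t: "fst q \<in> fst c" using q by (simp add: in_induced_chart)
      have dh: "diff_at c (\<lambda>t. h c t $ a $ b) (fst q)"
        by (rule smooth_in_diff_at[OF metric.smooth_h[OF c] t])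
      from has_derivative_pullback_t[OF c d q this]
      show "diff_at ?e (\<lambda>q. h c (fst q) $ a $ b) q" by (rule diff_atI)
      show "pd ?e (dir_p k x) (\<lambda>q. h c (fst q) $ a $ b) q = 0"
        using pd_eqI[OF has_derivative_pullback_t[OF c d q dh], of "dir_p k x"]
        by (simp add: dir_p_def pd_zero_dir[OF dh])
    qed
    have dg: "diff_at ?e (\<lambda>q. g c d q $ i $ j) q"
      by (rule smooth_in_diff_at[OF smooth_g[OF c d] q])
    have "pd ?e (dir_p k x) (pd ?e (dir_p i a) (dH c d j b)) q
        = pd ?e (dir_p k x) (\<lambda>q. 2 * h c (fst q) $ a $ b * g c d q $ i $ j) q"
      by (rule pd_cong[OF cc subset_refl _ q hessian[OF c d]]) (use cc in \<open>auto simp: coord_chart_def\<close>)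
    also have "\<dots> = 2 * ?h $ a $ b * D k x i j"
      by (simp add: pd_mult[OF cc q] diff_at_mult[OF cc q] hconst dg D_def)
    finally show ?thesis .
  qed
  have swap: "?h $ a $ b * D k x i j = ?h $ a $ x * D j b i k" for k x i a j b
  proof -
    have 1: "pd ?e v (pd ?e w (dH c d j b)) q = pd ?e w (pd ?e v (dH c d j b)) q" for v w j b
      by (rule pd_commute[OF cc smooth_dH[OF c d] q])
    have 2: "pd ?e v (pd ?e (dir_p k x) (dH c d j b)) q = pd ?e v (pd ?e (dir_p j b) (dH c d k x)) q" for v
      by (rule pd_cong[OF cc subset_refl _ q pd_commute[OF cc smooth_H[OF c d]]])
        (use cc in \<open>auto simp: coord_chart_def\<close>)
    have "2 * ?h $ a $ b * D k x i j = pd ?e (dir_p k x) (pd ?e (dir_p i a) (dH c d j b)) q"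
      by (rule third[symmetric])
    also have "\<dots> = pd ?e (dir_p i a) (pd ?e (dir_p j b) (dH c d k x)) q"
      by (simp only: 1[of "dir_p k x"] 2)
    also have "\<dots> = pd ?e (dir_p j b) (pd ?e (dir_p i a) (dH c d k x)) q"
      by (rule 1)
    also have "\<dots> = 2 * ?h $ a $ x * D j b i k" by (rule third)
    finally show ?thesis by simp
  qed
  have trace: "real CARD('m) * D k x i j = D j x i k" for k x i j
  proof -
    have inv: "(\<Sum>a\<in>UNIV. matrix_inv ?h $ b $ a * ?h $ a $ y) = (if b = y then 1 else 0)" for b y
      using arg_cong[OF matrix_inv_left_right(1)[OF metric.h_invertible[OF c]], of "fst q" "\<lambda>A. A $ b $ y"] q
      by (simp add: matrix_matrix_mult_def mat_def in_induced_chart)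
    have "(\<Sum>b\<in>UNIV. (\<Sum>a\<in>UNIV. matrix_inv ?h $ b $ a * ?h $ a $ b) * D k x i j)
        = (\<Sum>b\<in>UNIV. (\<Sum>a\<in>UNIV. matrix_inv ?h $ b $ a * ?h $ a $ x) * D j b i k)"
      by (simp add: sum_distrib_right mult.assoc swap[of _ _ k x])
    moreover have "(\<Sum>b\<in>UNIV. (\<Sum>a\<in>UNIV. matrix_inv ?h $ b $ a * ?h $ a $ b) * D k x i j)
        = real CARD('m) * D k x i j"
      by (simp only: inv) simp
    moreover have "(\<Sum>b\<in>UNIV. (\<Sum>a\<in>UNIV. matrix_inv ?h $ b $ a * ?h $ a $ x) * D j b i k)
        = (\<Sum>b\<in>UNIV. if b = x then D j b i k else 0)"
      by (intro sum.cong) (simp_all add: inv)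
    ultimately show ?thesis by simp
  qed
  have "real CARD('m) * (real CARD('m) * D k x i j) = D k x i j"
    by (simp only: trace)
  then have "(real CARD('m) - 1) * (real CARD('m) + 1) * D k x i j = 0"
    by (simp add: algebra_simps)
  moreover have "real CARD('m) + 1 \<noteq> 0" by (simp add: add_nonneg_eq_0_iff)
  ultimately show ?thesis
    using card by (auto simp: D_def)
qed

lemma pd_dir_p_glow:
  assumes c: "c \<in> atlas T" and d: "d \<in> atlas M" and q: "q \<in> fst (E c d)" and card: "CARD('m) \<noteq> 1"
  shows "pd (E c d) (dir_p k x) (glow c d i j) q = 0"
proof -
  let ?e = "E c d"
  note cc = induced_coord_chart[OF c d]
  have dg: "diff_at ?e (\<lambda>q. g c d q $ i $ j) q" "diff_at ?e (glow c d i j) q" for i j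
    using smooth_in_diff_at[OF smooth_g[OF c d] q] smooth_in_diff_at[OF smooth_glow[OF c d] q] by auto
  have zero: "(\<Sum>l\<in>UNIV. pd ?e (dir_p k x) (glow c d i l) q * g c d q $ l $ r) = 0" for r
  proof -
    have "0 = pd ?e (dir_p k x) (\<lambda>q. if i = r then 1 else 0) q" by simp
    also have "\<dots> = pd ?e (dir_p k x) (\<lambda>q. \<Sum>l\<in>UNIV. glow c d i l q * g c d q $ l $ r) q"
      by (rule pd_cong[OF cc subset_refl _ q]) (use cc in \<open>auto simp: coord_chart_def glow_g[OF c d]\<close>)
    also have "\<dots> = (\<Sum>l\<in>UNIV. pd ?e (dir_p k x) (glow c d i l) q * g c d q $ l $ r)"
      by (simp add: pd_sum diff_at_mult[OF cc q] pd_mult[OF cc q] dg pd_dir_p_g[OF c d q card])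
    finally show ?thesis by simp
  qed
  have "0 = (\<Sum>r\<in>UNIV. (\<Sum>l\<in>UNIV. pd ?e (dir_p k x) (glow c d i l) q * g c d q $ l $ r) * glow c d r j q)"
    by (simp only: zero) simp
  also have "\<dots> = (\<Sum>l\<in>UNIV. pd ?e (dir_p k x) (glow c d i l) q * (\<Sum>r\<in>UNIV. g c d q $ l $ r * glow c d r j q))"
    unfolding sum_distrib_left sum_distrib_right by (subst sum.swap) (simp add: mult.assoc)
  also have "\<dots> = (\<Sum>l\<in>UNIV. if l = j then pd ?e (dir_p k x) (glow c d i l) q else 0)"
    by (intro sum.cong) (simp_all add: g_glow[OF c d q])
  finally show ?thesis by simp
qed

lemma bracket_mult:
  assumes c: "c \<in> atlas T" and d: "d \<in> atlas M" and q: "q \<in> fst (E c d)"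
    and f: "diff_at (E c d) f q" and f': "diff_at (E c d) f' q"
  shows "bracket c d b (\<lambda>q. f q * f' q) q = bracket c d b f q * f' q + f q * bracket c d b f' q"
  unfolding bracket_def pd_mult[OF induced_coord_chart[OF c d] q f f']
  by (simp add: sum.distrib sum_distrib_left sum_distrib_right algebra_simps)

lemma bracket_sum:
  assumes "\<And>i. i \<in> I \<Longrightarrow> diff_at (E c d) (f i) q"
  shows "bracket c d b (\<lambda>q. \<Sum>i\<in>I. f i q) q = (\<Sum>i\<in>I. bracket c d b (f i) q)"
proof -
  have "pd (E c d) v (\<lambda>q. \<Sum>i\<in>I. f i q) q = (\<Sum>i\<in>I. pd (E c d) v (f i) q)" for v
    by (rule pd_sum[OF assms])
  then show ?thesis
    unfolding bracket_def sum_subtractf sum_distrib_left sum_distrib_right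
    by (simp add: sum.swap[of _ I] sum_distrib_left sum_distrib_right)
qed

lemma smooth_in_canonical_N1:
  assumes "c \<in> atlas T" "d \<in> atlas M"
  shows "smooth_in (E c d) (\<lambda>q. canonical_N1 T M h c d q a i b)"
  unfolding canonical_N1_def
  by (intro smooth_in_sum smooth_in_mult induced_coord_chart assms smooth_in_momentum
      smooth_in_pullback_t metric.smooth_in_christoffel)

lemma smooth_in_canonical_N2:
  assumes "c \<in> atlas T" "d \<in> atlas M"
  shows "smooth_in (E c d) (\<lambda>q. canonical_N2 T M h H g c d q a i j)"
proof -
  have "smooth_in (E c d) (\<lambda>q. matrix_inv (h c (fst q)) $ a $ b)" for b
    by (rule smooth_in_pullback_t[OF assms])
      (rule smooth_in_matrix_inv[OF T.coord_chart[OF assms(1)] metric.smooth_h[OF assms(1)]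
          metric.h_invertible[OF assms(1)]])
  then show ?thesis
    unfolding canonical_N2_eq quad_def bracket_def mixed_def
    by (intro smooth_in_sum smooth_in_mult smooth_in_add smooth_in_diff smooth_in_divide_const
        smooth_in_pd smooth_glow smooth_H induced_coord_chart assms)
qed

end

section \<open>The spatial components\<close>

text \<open>The first factor has the shape of the space derivatives of a function in terms of the other chart,
  namely a covector \<open>u\<close> and a vertical part with coefficients \<open>S\<close>; the second has the shape of its
  momentum derivatives. Both halves of the bracket are such contractions.\<close>

lemma contraction_change:
  fixes A B :: "'n::finite \<Rightarrow> 'n \<Rightarrow> real" and J :: "'m::finite \<Rightarrow> 'm \<Rightarrow> real"
    and S :: "'n \<Rightarrow> 'm \<Rightarrow> 'n \<Rightarrow> real" and u :: "'n \<Rightarrow> real" and U w :: "'n \<Rightarrow> 'm \<Rightarrow> real"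
  assumes AB: "\<And>r j. (\<Sum>k\<in>UNIV. A r k * B k j) = (if r = j then 1 else 0)"
  shows "(\<Sum>k\<in>UNIV. ((\<Sum>r\<in>UNIV. A r k * u r) + (\<Sum>l\<in>UNIV. \<Sum>x\<in>UNIV. S l x k * U l x))
      * (\<Sum>j\<in>UNIV. \<Sum>y\<in>UNIV. B k j * J y b * w j y))
    = (\<Sum>y\<in>UNIV. J y b * ((\<Sum>r\<in>UNIV. u r * w r y)
        + (\<Sum>l\<in>UNIV. \<Sum>x\<in>UNIV. \<Sum>j\<in>UNIV. (\<Sum>k\<in>UNIV. S l x k * B k j) * U l x * w j y)))"
proof -
  define Y where "Y k = (\<Sum>r\<in>UNIV. A r k * u r) + (\<Sum>l\<in>UNIV. \<Sum>x\<in>UNIV. S l x k * U l x)" for k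
  define z where "z j = (\<Sum>y\<in>UNIV. J y b * w j y)" for j
  define C where "C l x j = (\<Sum>k\<in>UNIV. S l x k * B k j)" for l x j
  have YB: "(\<Sum>k\<in>UNIV. Y k * B k j) = u j + (\<Sum>l\<in>UNIV. \<Sum>x\<in>UNIV. (\<Sum>k\<in>UNIV. S l x k * B k j) * U l x)" for j
  proof -
    have "(\<Sum>k\<in>UNIV. (\<Sum>r\<in>UNIV. A r k * u r) * B k j) = (\<Sum>r\<in>UNIV. (\<Sum>k\<in>UNIV. A r k * B k j) * u r)"
      unfolding sum_distrib_right by (subst sum.swap) (simp add: mult_ac)
    also have "\<dots> = (\<Sum>r\<in>UNIV. if r = j then u r else 0)"
      by (intro sum.cong) (simp_all add: AB)
    finally have 1: "(\<Sum>k\<in>UNIV. (\<Sum>r\<in>UNIV. A r k * u r) * B k j) = u j" by simp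
    have "(\<Sum>k\<in>UNIV. \<Sum>l\<in>UNIV. \<Sum>x\<in>UNIV. F k l x) = (\<Sum>l\<in>UNIV. \<Sum>x\<in>UNIV. \<Sum>k\<in>UNIV. F k l x)"
      for F :: "'n \<Rightarrow> 'n \<Rightarrow> 'm \<Rightarrow> real"
      unfolding sum.cartesian_product UNIV_Times_UNIV
      by (rule sum.reindex_bij_witness[of _ "\<lambda>(l, x, k). (k, l, x)" "\<lambda>(k, l, x). (l, x, k)"]) auto
    from this[of "\<lambda>k l x. S l x k * U l x * B k j"]
    have "(\<Sum>k\<in>UNIV. (\<Sum>l\<in>UNIV. \<Sum>x\<in>UNIV. S l x k * U l x) * B k j)
        = (\<Sum>l\<in>UNIV. \<Sum>x\<in>UNIV. (\<Sum>k\<in>UNIV. S l x k * B k j) * U l x)"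
      by (simp add: sum_distrib_left sum_distrib_right mult_ac)
    with 1 show ?thesis by (simp add: Y_def distrib_right sum.distrib)
  qed
  have "(\<Sum>k\<in>UNIV. Y k * (\<Sum>j\<in>UNIV. \<Sum>y\<in>UNIV. B k j * J y b * w j y))
      = (\<Sum>k\<in>UNIV. \<Sum>j\<in>UNIV. Y k * B k j * z j)"
    by (simp add: z_def sum_distrib_left mult_ac)
  also have "\<dots> = (\<Sum>j\<in>UNIV. (\<Sum>k\<in>UNIV. Y k * B k j) * z j)"
    by (subst sum.swap) (simp add: sum_distrib_right)
  also have "\<dots> = (\<Sum>j\<in>UNIV. u j * z j)
      + (\<Sum>j\<in>UNIV. \<Sum>l\<in>UNIV. \<Sum>x\<in>UNIV. (\<Sum>k\<in>UNIV. S l x k * B k j) * U l x * z j)"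
    unfolding YB by (simp add: distrib_right sum.distrib sum_distrib_right)
  also have "(\<Sum>j\<in>UNIV. u j * z j) = (\<Sum>y\<in>UNIV. J y b * (\<Sum>r\<in>UNIV. u r * w r y))"
    unfolding z_def sum_distrib_left by (subst sum.swap) (simp add: mult_ac)
  also have "(\<Sum>j\<in>UNIV. \<Sum>l\<in>UNIV. \<Sum>x\<in>UNIV. (\<Sum>k\<in>UNIV. S l x k * B k j) * U l x * z j)
      = (\<Sum>y\<in>UNIV. J y b * (\<Sum>l\<in>UNIV. \<Sum>x\<in>UNIV. \<Sum>j\<in>UNIV. (\<Sum>k\<in>UNIV. S l x k * B k j) * U l x * w j y))"
  proof -
    have "(\<Sum>j\<in>UNIV. \<Sum>l\<in>UNIV. \<Sum>x\<in>UNIV. \<Sum>y\<in>UNIV. F j l x y) = (\<Sum>y\<in>UNIV. \<Sum>l\<in>UNIV. \<Sum>x\<in>UNIV. \<Sum>j\<in>UNIV. F j l x y)"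
      for F :: "'n \<Rightarrow> 'n \<Rightarrow> 'm \<Rightarrow> 'm \<Rightarrow> real"
      unfolding sum.cartesian_product UNIV_Times_UNIV
      by (rule sum.reindex_bij_witness[of _ "\<lambda>(y, l, x, j). (j, l, x, y)" "\<lambda>(j, l, x, y). (y, l, x, j)"]) auto
    from this[of "\<lambda>j l x y. C l x j * U l x * (J y b * w j y)"]
    show ?thesis unfolding C_def[symmetric] by (simp add: z_def sum_distrib_left mult_ac)
  qed
  finally show ?thesis
    unfolding Y_def by (simp add: distrib_left sum.distrib)
qed

locale hamilton_charts = hamilton_space T M h H g + two_induced_charts T M c c' d d'
  for T :: "('a, real^'m) manifold" and M :: "('b, real^'n) manifold" and h H g c c' d d'
begin

abbreviation "S q l y i \<equiv> pd e (dir_x i) (\<lambda>q. p' q l y) q"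

lemma BA: "q \<in> overlap \<Longrightarrow> (\<Sum>k\<in>UNIV. B q i k * A q k j) = (if i = j then 1 else 0)"
  using M.jac_cancel[OF d d'] overlapD by blast

lemma AB: "q \<in> overlap \<Longrightarrow> (\<Sum>k\<in>UNIV. A q i k * B q k j) = (if i = j then 1 else 0)"
  using M.jac_cancel[OF d' d] overlapD by blast

lemma JK: "q \<in> overlap \<Longrightarrow> (\<Sum>k\<in>UNIV. J q i k * K q k j) = (if i = j then 1 else 0)"
  using T.jac_cancel[OF c' c] overlapD by blast

text \<open>The space derivative of \<open>p'\<close> falls on the factor \<open>B\<close>. By \<open>B A = 1\<close>, in \<open>A\<^sup>T S\<close> it can be moved onto
  \<open>A\<close>, whose derivatives are the symmetric second derivatives of the coordinate change.\<close>

lemma A_S_symmetric: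
  assumes q: "q \<in> overlap"
  shows "(\<Sum>r\<in>UNIV. A q r i * S q r y j) = (\<Sum>r\<in>UNIV. A q r j * S q r y i)"
proof -
  note ov = overlapD[OF q]
  let ?x = "fst (snd q)"
  define V where "V k = (\<Sum>f\<in>UNIV. J q y f * p q k f)" for k
  define DA where "DA r i j = pd d (axis j 1) (\<lambda>x. jac d d' x $ r $ i) ?x" for r i j
  define DB where "DB k r j = pd d (axis j 1) (\<lambda>x. jac d' d x $ k $ r) ?x" for k r j
  have S: "S q r y j = (\<Sum>k\<in>UNIV. DB k r j * V k)" for r j
    unfolding pd_p'[OF q] V_def DB_def
    by (simp add: dir_x_def pd_zero_dir[OF T.diff_at_jac[OF c c' ov(3,4)]] sum_distrib_left mult_ac)
  have BA': "(\<Sum>r\<in>UNIV. DB k r j * A q r i) = - (\<Sum>r\<in>UNIV. B q k r * DA r i j)" for k i j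
  proof -
    note mult = M.coord_chart[OF d] ov(5)
    have "0 = pd d (axis j 1) (\<lambda>x. if k = i then 1 else 0) ?x" by simp
    also have "\<dots> = pd d (axis j 1) (\<lambda>x. \<Sum>r\<in>UNIV. jac d' d x $ k $ r * jac d d' x $ r $ i) ?x"
      by (rule pd_cong[OF mult(1) _ M.open_overlap[OF d d']]) (use ov M.jac_cancel[OF d d'] in auto)
    also have "\<dots> = (\<Sum>r\<in>UNIV. DB k r j * A q r i + B q k r * DA r i j)"
      by (simp add: pd_sum diff_at_mult[OF mult] pd_mult[OF mult] DA_def DB_def
          M.diff_at_jac[OF d d' ov(5,6)] M.diff_at_jac'[OF d d' ov(5,6)])
    finally show ?thesis by (simp add: sum.distrib)
  qed
  have "(\<Sum>r\<in>UNIV. A q r i * S q r y j) = (\<Sum>k\<in>UNIV. (\<Sum>r\<in>UNIV. DB k r j * A q r i) * V k)" for i j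
    unfolding S sum_distrib_left sum_distrib_right by (subst sum.swap) (simp add: mult_ac)
  moreover have "DA r i j = DA r j i" for r i j
    unfolding DA_def by (rule M.pd_jac_symmetric[OF d d' ov(5,6)])
  ultimately show ?thesis by (simp add: BA')
qed

text \<open>The matrix \<open>S B\<close> is \<open>B\<^sup>T (A\<^sup>T S) B\<close>.\<close>

lemma S_B_symmetric:
  assumes q: "q \<in> overlap"
  shows "(\<Sum>k\<in>UNIV. S q l y k * B q k j) = (\<Sum>k\<in>UNIV. S q j y k * B q k l)"
proof -
  define Am where "Am = (\<chi> i j. A q i j)"
  define Bm where "Bm = (\<chi> i j. B q i j)"
  define Sm where "Sm = (\<chi> l k. S q l y k)"
  have AB: "Am ** Bm = mat 1"
    using AB[OF q] by (simp add: Am_def Bm_def matrix_matrix_mult_def mat_def vec_eq_iff)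
  then have BA: "transpose Bm ** transpose Am = mat 1"
    by (metis matrix_transpose_mul transpose_mat)
  have sym: "transpose (transpose Am ** Sm) = transpose Am ** Sm"
    using A_S_symmetric[OF q, where y = y]
    by (simp add: Am_def Sm_def matrix_matrix_mult_def transpose_def vec_eq_iff)
  have "Sm ** Bm = (transpose Bm ** transpose Am) ** Sm ** Bm"
    by (simp add: BA)
  also have "\<dots> = transpose Bm ** transpose (transpose Am ** Sm) ** Bm"
    unfolding sym by (simp add: matrix_mul_assoc)
  also have "\<dots> = transpose (Sm ** Bm) ** (Am ** Bm)"
    by (simp add: matrix_transpose_mul matrix_mul_assoc)
  finally have "Sm ** Bm = transpose (Sm ** Bm)" by (simp add: AB)
  from arg_cong[OF this, of "\<lambda>A. A $ l $ j"] show ?thesis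
    by (simp add: Sm_def Bm_def matrix_matrix_mult_def transpose_def)
qed

lemma diff_at_H: "q \<in> overlap \<Longrightarrow> diff_at e' H q"
  using smooth_in_diff_at[OF smooth_H[OF c' d']] by blast

lemma diff_at_dH': "q \<in> overlap \<Longrightarrow> diff_at e' (dH c' d' l y) q"
  using smooth_in_diff_at[OF smooth_dH[OF c' d']] by blast

lemma diff_at_dH: "q \<in> overlap \<Longrightarrow> diff_at e (dH c d l y) q"
  using smooth_in_diff_at[OF smooth_dH[OF c d]] by blast

lemma diff_at_glow': "q \<in> overlap \<Longrightarrow> diff_at e' (glow c' d' i j) q"
  using smooth_in_diff_at[OF smooth_glow[OF c' d']] by blast

text \<open>The vertical parts \<open>S\<close> of the space derivatives contribute the contraction of \<open>S B\<close> with the momentum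
  derivatives of \<open>f\<close> and \<open>H\<close>, antisymmetrized in \<open>f\<close> and \<open>H\<close>. For one time, exchanging \<open>f\<close> and \<open>H\<close>
  amounts to transposing \<open>S B\<close>. For several times, the exchange also moves the time indices, and the
  term vanishes only because \<open>f\<close> is assumed to have no momentum derivatives.\<close>

lemma bracket_law:
  assumes q: "q \<in> overlap" and f: "diff_at e' f q"
    and vert: "CARD('m) = 1 \<or> (\<forall>l x. pd e' (dir_p l x) f q = 0)"
  shows "bracket c d b f q = (\<Sum>y\<in>UNIV. J q y b * bracket c' d' y f q)"
proof -
  note H = diff_at_H[OF q]
  define C where "C l x j = (\<Sum>k\<in>UNIV. S q l x k * B q k j)" for l x j
  define df where "df l x = pd e' (dir_p l x) f q" for l x
  define dh where "dh l x = dH c' d' l x q" for l x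
  note change = contraction_change[where A = "\<lambda>i j. A q i j" and B = "\<lambda>i j. B q i j"
      and J = "\<lambda>i j. J q i j" and S = "\<lambda>l y i. S q l y i" and b = b, OF AB[OF q]]
  have "bracket c d b f q = (\<Sum>y\<in>UNIV. J q y b * ((\<Sum>r\<in>UNIV. pd e' (dir_x r) f q * dh r y)
          + (\<Sum>l\<in>UNIV. \<Sum>x\<in>UNIV. \<Sum>j\<in>UNIV. C l x j * df l x * dh j y)))
      - (\<Sum>y\<in>UNIV. J q y b * ((\<Sum>r\<in>UNIV. pd e' (dir_x r) H q * df r y)
          + (\<Sum>l\<in>UNIV. \<Sum>x\<in>UNIV. \<Sum>j\<in>UNIV. C l x j * dh l x * df j y)))"
    unfolding bracket_def pd_dir_x[OF q f] pd_dir_x[OF q H] pd_dir_p[OF q f] pd_dir_p[OF q H] C_def df_def dh_def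
    by (rule arg_cong2[where f = minus];
        rule change[where u = "\<lambda>r. pd e' (dir_x r) f q" and U = "\<lambda>l x. pd e' (dir_p l x) f q" and w = "\<lambda>l x. dH c' d' l x q"]
          change[where u = "\<lambda>r. pd e' (dir_x r) H q" and U = "\<lambda>l x. dH c' d' l x q" and w = "\<lambda>l x. pd e' (dir_p l x) f q"])
  moreover have "(\<Sum>l\<in>UNIV. \<Sum>x\<in>UNIV. \<Sum>j\<in>UNIV. C l x j * df l x * dh j y)
      = (\<Sum>l\<in>UNIV. \<Sum>x\<in>UNIV. \<Sum>j\<in>UNIV. C l x j * dh l x * df j y)" for y
  proof (cases "CARD('m) = 1")
    case True
    \<comment> \<open>The summation index \<open>x\<close> can only be \<open>y\<close>, so exchanging \<open>l\<close> and \<open>j\<close> exchanges \<open>f\<close> and \<open>H\<close>.\<close>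
    then obtain u where "(UNIV :: 'm set) = {u}" by (rule card_1_singletonE)
    then have U: "(UNIV :: 'm set) = {y}" by (metis UNIV_I singletonD)
    have "C l y j = C j y l" for l j
      unfolding C_def by (rule S_B_symmetric[OF q])
    then have "(\<Sum>l\<in>UNIV. \<Sum>j\<in>UNIV. C l y j * df l y * dh j y) = (\<Sum>l\<in>UNIV. \<Sum>j\<in>UNIV. C l y j * dh l y * df j y)"
      by (subst sum.swap) (simp add: mult_ac)
    then show ?thesis by (simp add: U)
  next
    case False
    with vert have "df l x = 0" for l x by (simp add: df_def)
    then show ?thesis by simp
  qed
  ultimately show ?thesis
    unfolding bracket_def df_def[symmetric] dh_def[symmetric]
    by (simp add: sum_subtractf[symmetric] right_diff_distrib[symmetric])
qed

lemma bracket_A: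
  assumes q: "q \<in> overlap"
  shows "bracket c d b (\<lambda>q. A q r i) q = (\<Sum>k\<in>UNIV. pd d (axis k 1) (\<lambda>x. jac d d' x $ r $ i) (fst (snd q)) * dH c d k b q)"
proof -
  note df = M.diff_at_jac[OF d d' overlapD(5,6)[OF q]]
  show ?thesis
    unfolding bracket_def pd_x[OF overlapD(1)[OF q] df] by (simp add: dir_x_def dir_p_def pd_zero_dir[OF df])
qed

lemma glow_law:
  assumes q: "q \<in> overlap"
  shows "glow c d i j q = (\<Sum>r\<in>UNIV. \<Sum>u\<in>UNIV. glow c' d' r u q * A q r i * A q u j)"
proof -
  define Am where "Am = jac d d' (fst (snd q))"
  define Bm where "Bm = jac d' d (fst (snd q))"
  have "Am ** Bm = mat 1"
    using AB[OF q] by (simp add: Am_def Bm_def matrix_matrix_mult_def mat_def vec_eq_iff)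
  then have AB: "transpose Bm ** transpose Am = mat 1"
    by (metis matrix_transpose_mul transpose_mat)
  have "(\<Sum>k\<in>UNIV. \<Sum>l\<in>UNIV. g c' d' q $ k $ l * B q i k * B q j l)
      = (\<Sum>l\<in>UNIV. (\<Sum>k\<in>UNIV. B q i k * g c' d' q $ k $ l) * B q j l)" for i j
    unfolding sum_distrib_right by (subst sum.swap) (simp add: mult_ac)
  then have "g c d q = Bm ** g c' d' q ** transpose Bm"
    using g_law[OF c d c' d' q]
    by (simp add: vec_eq_iff matrix_matrix_mult_def transpose_def Bm_def)
  then have "g c d q = transpose (transpose Bm) ** g c' d' q ** transpose Bm" by simp
  from matrix_inv_congruence[OF g_invertible[OF c' d' overlapD(2)[OF q]] _ this, of "transpose Am"]
  have inv: "matrix_inv (g c d q) = transpose Am ** matrix_inv (g c' d' q) ** Am"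
    using AB matrix_left_right_inverse by auto
  show ?thesis
    unfolding inv by (subst sum.swap) (simp add: matrix_matrix_mult_def transpose_def Am_def
        sum_distrib_left sum_distrib_right mult_ac)
qed

lemma A_dH:
  assumes q: "q \<in> overlap"
  shows "(\<Sum>k\<in>UNIV. A q u k * dH c d k b q) = (\<Sum>y\<in>UNIV. J q y b * dH c' d' u y q)"
proof -
  have "(\<Sum>k\<in>UNIV. A q u k * dH c d k b q)
      = (\<Sum>k\<in>UNIV. \<Sum>j\<in>UNIV. A q u k * B q k j * (\<Sum>y\<in>UNIV. J q y b * dH c' d' j y q))"
    unfolding pd_dir_p[OF q diff_at_H[OF q]] by (simp add: sum_distrib_left mult_ac)
  also have "\<dots> = (\<Sum>j\<in>UNIV. (\<Sum>k\<in>UNIV. A q u k * B q k j) * (\<Sum>y\<in>UNIV. J q y b * dH c' d' j y q))"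
    by (subst sum.swap) (simp add: sum_distrib_right)
  also have "\<dots> = (\<Sum>j\<in>UNIV. if j = u then \<Sum>y\<in>UNIV. J q y b * dH c' d' j y q else 0)"
    by (intro sum.cong) (auto simp: AB[OF q])
  finally show ?thesis by simp
qed

text \<open>Differentiating the previous equation avoids the derivatives of \<open>B\<close>. By the symmetry of the second
  derivatives of the coordinate change, the derivatives of \<open>A\<close> that appear instead form the bracket of
  an entry of \<open>A\<close> with \<open>H\<close>.\<close>

lemma A_pd_dH:
  assumes q: "q \<in> overlap"
  shows "(\<Sum>k\<in>UNIV. A q u k * pd e (dir_x j) (dH c d k b) q)
    = (\<Sum>y\<in>UNIV. J q y b * pd e (dir_x j) (dH c' d' u y) q) - bracket c d b (\<lambda>q. A q u j) q"
proof -
  note ov = overlapD[OF q]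
  note mult = coord_chart_e ov(1)
  have pdA: "pd e (dir_x j) (\<lambda>q. A q u k) q = pd d (axis k 1) (\<lambda>x. jac d d' x $ u $ j) (fst (snd q))" for k
    using pd_x[OF ov(1) M.diff_at_jac[OF d d' ov(5,6)]] M.pd_jac_symmetric[OF d d' ov(5,6)]
    by (simp add: dir_x_def)
  have pdJ: "pd e (dir_x j) (\<lambda>q. J q y b) q = 0" for y
    using pd_t[OF ov(1) T.diff_at_jac[OF c c' ov(3,4)]]
    by (simp add: dir_x_def pd_zero_dir[OF T.diff_at_jac[OF c c' ov(3,4)]])
  have dH': "diff_at e (dH c' d' u y) q" for y
    by (rule diff_at_e[OF q diff_at_dH'[OF q]])
  have "(\<Sum>k\<in>UNIV. pd e (dir_x j) (\<lambda>q. A q u k) q * dH c d k b q + A q u k * pd e (dir_x j) (dH c d k b) q)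
      = pd e (dir_x j) (\<lambda>q. \<Sum>k\<in>UNIV. A q u k * dH c d k b q) q"
    by (simp add: pd_sum pd_mult[OF mult] diff_at_mult[OF mult] diff_at_A[OF q] diff_at_dH[OF q])
  also have "\<dots> = pd e (dir_x j) (\<lambda>q. \<Sum>y\<in>UNIV. J q y b * dH c' d' u y q) q"
    by (rule pd_overlap_cong[OF q A_dH])
  also have "\<dots> = (\<Sum>y\<in>UNIV. J q y b * pd e (dir_x j) (dH c' d' u y) q)"
    by (simp add: pd_sum pd_mult[OF mult] diff_at_mult[OF mult] diff_at_J[OF q] dH' pdJ)
  finally show ?thesis
    by (simp add: bracket_A[OF q] pdA sum.distrib)
qed

text \<open>The vertical part of \<open>\<partial>/\<partial>x\<close> meets the Hessian of \<open>H\<close>, in which \<open>g\<^sup>i\<^sup>j\<close> cancels the factor \<open>g\<^sub>i\<^sub>j\<close>.\<close>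

lemma glow_pd_dH:
  assumes q: "q \<in> overlap"
  shows "(\<Sum>u\<in>UNIV. glow c' d' r u q * pd e (dir_x j) (dH c' d' u y) q)
    = (\<Sum>s\<in>UNIV. A q s j * mixed c' d' y r s q) + 2 * (\<Sum>x\<in>UNIV. h c' (fst q) $ y $ x * S q r x j)"
proof -
  have 1: "pd e (dir_x j) (dH c' d' u y) q = (\<Sum>s\<in>UNIV. A q s j * pd e' (dir_x s) (dH c' d' u y) q)
      + (\<Sum>l\<in>UNIV. \<Sum>x\<in>UNIV. S q l x j * (2 * h c' (fst q) $ y $ x * g c' d' q $ u $ l))" for u
    unfolding pd_dir_x[OF q diff_at_dH'[OF q]] hessian[OF c' d' overlapD(2)[OF q]]
    using metric.h_symmetric[OF c' overlapD(4)[OF q]]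
      arg_cong[OF g_transpose[OF c' d' overlapD(2)[OF q]], of "\<lambda>A. A $ u $ _"]
    by (simp add: transpose_def)
  have "(\<Sum>u\<in>UNIV. glow c' d' r u q * (\<Sum>s\<in>UNIV. A q s j * pd e' (dir_x s) (dH c' d' u y) q))
      = (\<Sum>s\<in>UNIV. A q s j * mixed c' d' y r s q)"
    unfolding mixed_def sum_distrib_left by (subst sum.swap) (simp add: mult_ac)
  moreover have "(\<Sum>u\<in>UNIV. glow c' d' r u q * (\<Sum>l\<in>UNIV. \<Sum>x\<in>UNIV. S q l x j * (2 * h c' (fst q) $ y $ x * g c' d' q $ u $ l)))
      = 2 * (\<Sum>x\<in>UNIV. h c' (fst q) $ y $ x * S q r x j)"
  proof -
    define Z where "Z l = (\<Sum>x\<in>UNIV. 2 * h c' (fst q) $ y $ x * S q l x j)" for l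
    have "(\<Sum>u\<in>UNIV. glow c' d' r u q * (\<Sum>l\<in>UNIV. \<Sum>x\<in>UNIV. S q l x j * (2 * h c' (fst q) $ y $ x * g c' d' q $ u $ l)))
        = (\<Sum>u\<in>UNIV. \<Sum>l\<in>UNIV. glow c' d' r u q * g c' d' q $ u $ l * Z l)"
      by (simp add: Z_def sum_distrib_left mult_ac)
    also have "\<dots> = (\<Sum>l\<in>UNIV. (\<Sum>u\<in>UNIV. glow c' d' r u q * g c' d' q $ u $ l) * Z l)"
      by (subst sum.swap) (simp add: sum_distrib_right)
    also have "\<dots> = (\<Sum>l\<in>UNIV. if l = r then Z l else 0)"
      by (intro sum.cong) (auto simp: glow_g[OF c' d' overlapD(2)[OF q]])
    finally show ?thesis by (simp add: Z_def sum_distrib_left mult_ac)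
  qed
  ultimately show ?thesis
    by (simp add: 1 distrib_left sum.distrib)
qed

lemma mixed_law:
  assumes q: "q \<in> overlap"
  shows "mixed c d b i j q
    = (\<Sum>y\<in>UNIV. J q y b * (\<Sum>r\<in>UNIV. A q r i * ((\<Sum>s\<in>UNIV. A q s j * mixed c' d' y r s q)
          + 2 * (\<Sum>x\<in>UNIV. h c' (fst q) $ y $ x * S q r x j))))
      - (\<Sum>r\<in>UNIV. \<Sum>u\<in>UNIV. glow c' d' r u q * A q r i * bracket c d b (\<lambda>q. A q u j) q)"
proof -
  have "mixed c d b i j q = (\<Sum>k\<in>UNIV. \<Sum>r\<in>UNIV. \<Sum>u\<in>UNIV.
      glow c' d' r u q * A q r i * (A q u k * pd e (dir_x j) (dH c d k b) q))"
    unfolding mixed_def glow_law[OF q] by (simp add: sum_distrib_left sum_distrib_right mult_ac)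
  also have "\<dots> = (\<Sum>r\<in>UNIV. \<Sum>k\<in>UNIV. \<Sum>u\<in>UNIV.
      glow c' d' r u q * A q r i * (A q u k * pd e (dir_x j) (dH c d k b) q))"
    by (rule sum.swap)
  also have "\<dots> = (\<Sum>r\<in>UNIV. \<Sum>u\<in>UNIV. \<Sum>k\<in>UNIV.
      glow c' d' r u q * A q r i * (A q u k * pd e (dir_x j) (dH c d k b) q))"
    by (intro sum.cong refl sum.swap)
  also have "\<dots> = (\<Sum>r\<in>UNIV. \<Sum>u\<in>UNIV. glow c' d' r u q * A q r i * (\<Sum>k\<in>UNIV. A q u k * pd e (dir_x j) (dH c d k b) q))"
    by (simp add: sum_distrib_left)
  also have "\<dots> = (\<Sum>r\<in>UNIV. \<Sum>u\<in>UNIV. glow c' d' r u q * A q r i * (\<Sum>y\<in>UNIV. J q y b * pd e (dir_x j) (dH c' d' u y) q))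
      - (\<Sum>r\<in>UNIV. \<Sum>u\<in>UNIV. glow c' d' r u q * A q r i * bracket c d b (\<lambda>q. A q u j) q)"
    unfolding A_pd_dH[OF q] by (simp add: right_diff_distrib sum_subtractf)
  also have "(\<Sum>r\<in>UNIV. \<Sum>u\<in>UNIV. glow c' d' r u q * A q r i * (\<Sum>y\<in>UNIV. J q y b * pd e (dir_x j) (dH c' d' u y) q))
      = (\<Sum>y\<in>UNIV. J q y b * (\<Sum>r\<in>UNIV. A q r i * (\<Sum>u\<in>UNIV. glow c' d' r u q * pd e (dir_x j) (dH c' d' u y) q)))"
  proof -
    have "(\<Sum>r\<in>UNIV. \<Sum>u\<in>UNIV. \<Sum>y\<in>UNIV. F r u y) = (\<Sum>y\<in>UNIV. \<Sum>r\<in>UNIV. \<Sum>u\<in>UNIV. F r u y)"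
      for F :: "'n \<Rightarrow> 'n \<Rightarrow> 'm \<Rightarrow> real"
      unfolding sum.cartesian_product UNIV_Times_UNIV
      by (rule sum.reindex_bij_witness[of _ "\<lambda>(y, r, u). (r, u, y)" "\<lambda>(r, u, y). (y, r, u)"]) auto
    from this[of "\<lambda>r u y. glow c' d' r u q * A q r i * (J q y b * pd e (dir_x j) (dH c' d' u y) q)"]
    show ?thesis by (simp add: sum_distrib_left mult_ac)
  qed
  finally show ?thesis unfolding glow_pd_dH[OF q] .
qed

text \<open>The bracket is a derivation, and it is tensorial on the components of \<open>g'\<close>. The two sums of brackets
  of entries of \<open>A\<close> are those subtracted in the laws of the two mixed terms.\<close>

lemma bracket_glow:
  assumes q: "q \<in> overlap"
  shows "bracket c d b (glow c d i j) q
    = (\<Sum>y\<in>UNIV. J q y b * (\<Sum>r\<in>UNIV. \<Sum>u\<in>UNIV. A q r i * A q u j * bracket c' d' y (glow c' d' r u) q))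
      + (\<Sum>r\<in>UNIV. \<Sum>u\<in>UNIV. glow c' d' r u q * A q r i * bracket c d b (\<lambda>q. A q u j) q)
      + (\<Sum>r\<in>UNIV. \<Sum>u\<in>UNIV. glow c' d' r u q * A q r j * bracket c d b (\<lambda>q. A q u i) q)"
proof -
  note ov = overlapD[OF q]
  note mult = coord_chart_e ov(1)
  have dg: "diff_at e (glow c' d' r u) q" for r u
    by (rule diff_at_e[OF q diff_at_glow'[OF q]])
  note dA = diff_at_A[OF q]
  have law: "bracket c d b (glow c' d' r u) q = (\<Sum>y\<in>UNIV. J q y b * bracket c' d' y (glow c' d' r u) q)" for r u
    by (rule bracket_law[OF q diff_at_glow'[OF q]]) (use pd_dir_p_glow[OF c' d' ov(2)] in blast)
  have "bracket c d b (glow c d i j) q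
      = bracket c d b (\<lambda>q. \<Sum>r\<in>UNIV. \<Sum>u\<in>UNIV. glow c' d' r u q * A q r i * A q u j) q"
    unfolding bracket_def by (simp only: pd_overlap_cong[OF q glow_law])
  also have "\<dots> = (\<Sum>r\<in>UNIV. \<Sum>u\<in>UNIV. bracket c d b (\<lambda>q. glow c' d' r u q * A q r i * A q u j) q)"
    by (simp add: bracket_sum diff_at_sum diff_at_mult[OF mult] dg dA)
  also have "\<dots> = (\<Sum>r\<in>UNIV. \<Sum>u\<in>UNIV. A q r i * A q u j * bracket c d b (glow c' d' r u) q)
      + (\<Sum>r\<in>UNIV. \<Sum>u\<in>UNIV. glow c' d' r u q * A q r i * bracket c d b (\<lambda>q. A q u j) q)
      + (\<Sum>r\<in>UNIV. \<Sum>u\<in>UNIV. glow c' d' r u q * bracket c d b (\<lambda>q. A q r i) q * A q u j)"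
    by (simp add: bracket_mult[OF c d ov(1)] diff_at_mult[OF mult] dg dA sum.distrib[symmetric] algebra_simps)
  also have "(\<Sum>r\<in>UNIV. \<Sum>u\<in>UNIV. glow c' d' r u q * bracket c d b (\<lambda>q. A q r i) q * A q u j)
      = (\<Sum>r\<in>UNIV. \<Sum>u\<in>UNIV. glow c' d' r u q * A q r j * bracket c d b (\<lambda>q. A q u i) q)"
    by (subst sum.swap) (simp add: glow_symmetric[OF c' d' ov(2)] mult_ac)
  also have "(\<Sum>r\<in>UNIV. \<Sum>u\<in>UNIV. A q r i * A q u j * bracket c d b (glow c' d' r u) q)
      = (\<Sum>y\<in>UNIV. J q y b * (\<Sum>r\<in>UNIV. \<Sum>u\<in>UNIV. A q r i * A q u j * bracket c' d' y (glow c' d' r u) q))"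
  proof -
    have "(\<Sum>r\<in>UNIV. \<Sum>u\<in>UNIV. \<Sum>y\<in>UNIV. F r u y) = (\<Sum>y\<in>UNIV. \<Sum>r\<in>UNIV. \<Sum>u\<in>UNIV. F r u y)"
      for F :: "'n \<Rightarrow> 'n \<Rightarrow> 'm \<Rightarrow> real"
      unfolding sum.cartesian_product UNIV_Times_UNIV
      by (rule sum.reindex_bij_witness[of _ "\<lambda>(y, r, u). (r, u, y)" "\<lambda>(r, u, y). (y, r, u)"]) auto
    from this[of "\<lambda>r u y. A q r i * A q u j * (J q y b * bracket c' d' y (glow c' d' r u) q)"]
    show ?thesis by (simp add: law sum_distrib_left mult_ac)
  qed
  finally show ?thesis .
qed

text \<open>The two mixed terms contribute \<open>A\<^sup>T S\<close> and its transpose, each with the factor 2, whence the factor 4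
  that the definition of the spatial components divides by.\<close>

lemma quad_law:
  assumes q: "q \<in> overlap"
  shows "quad c d b i j q = (\<Sum>y\<in>UNIV. J q y b *
    ((\<Sum>r\<in>UNIV. \<Sum>u\<in>UNIV. A q r i * A q u j * quad c' d' y r u q)
      + 4 * (\<Sum>x\<in>UNIV. h c' (fst q) $ y $ x * (\<Sum>r\<in>UNIV. A q r i * S q r x j))))"
proof -
  have S_part: "(\<Sum>r\<in>UNIV. A q r i * (2 * (\<Sum>x\<in>UNIV. h c' (fst q) $ y $ x * S q r x j)))
      = 2 * (\<Sum>x\<in>UNIV. h c' (fst q) $ y $ x * (\<Sum>r\<in>UNIV. A q r i * S q r x j))" for i j y
    unfolding sum_distrib_left by (subst sum.swap) (simp add: mult_ac)
  have sym: "(\<Sum>r\<in>UNIV. A q r j * S q r x i) = (\<Sum>r\<in>UNIV. A q r i * S q r x j)" for x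
    by (rule A_S_symmetric[OF q])
  have four: "4 * z = 2 * z + 2 * z" for z :: real
    by simp
  have m: "(\<Sum>r\<in>UNIV. A q r i * (\<Sum>s\<in>UNIV. A q s j * mixed c' d' y r s q))
      = (\<Sum>r\<in>UNIV. \<Sum>u\<in>UNIV. A q r i * A q u j * mixed c' d' y r u q)" for y
    by (simp add: sum_distrib_left mult_ac)
  have m': "(\<Sum>r\<in>UNIV. A q r j * (\<Sum>s\<in>UNIV. A q s i * mixed c' d' y r s q))
      = (\<Sum>r\<in>UNIV. \<Sum>u\<in>UNIV. A q r i * A q u j * mixed c' d' y u r q)" for y
    unfolding sum_distrib_left by (subst sum.swap) (simp add: mult_ac)
  show ?thesis
    unfolding quad_def bracket_glow[OF q] mixed_law[OF q] add_diff_eq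
    unfolding distrib_left sum.distrib S_part m m' sym four by (simp only: add_ac)
qed

lemma h_inv_J:
  assumes q: "q \<in> overlap"
  shows "(\<Sum>b\<in>UNIV. matrix_inv (h c (fst q)) $ a $ b * J q y b)
    = (\<Sum>x\<in>UNIV. K q a x * matrix_inv (h c' (fst q)) $ x $ y)"
proof -
  note ov = overlapD[OF q]
  let ?J = "jac c c' (fst q)" and ?K = "jac c' c (fst q)"
  have "?K ** matrix_inv (h c' (fst q)) = (?K ** ?J) ** matrix_inv (h c (fst q)) ** transpose ?J"
    unfolding metric.h_inv_law[OF c c' ov(3,4)] by (simp add: matrix_mul_assoc)
  also have "?K ** ?J = mat 1" by (rule metric.jac_mult[OF c' c ov(4,3)])
  finally have "matrix_inv (h c (fst q)) ** transpose ?J = ?K ** matrix_inv (h c' (fst q))" by simp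
  from arg_cong[OF this, of "\<lambda>A. A $ a $ y"] show ?thesis
    by (simp add: matrix_matrix_mult_def transpose_def)
qed

text \<open>The computation is natural in the direction from the primed to the unprimed components, because the
  derivatives in the unprimed chart are those that the chain rule expands.\<close>

lemma canonical_N2_law_inverse:
  assumes q: "q \<in> overlap"
  shows "canonical_N2 T M h H g c d q a i j = (\<Sum>x\<in>UNIV. K q a x *
    ((\<Sum>r\<in>UNIV. \<Sum>u\<in>UNIV. A q r i * A q u j * canonical_N2 T M h H g c' d' q x r u)
      + (\<Sum>r\<in>UNIV. A q r i * S q r x j)))"
proof -
  let ?h' = "h c' (fst q)"
  define Z where "Z y = (\<Sum>r\<in>UNIV. \<Sum>u\<in>UNIV. A q r i * A q u j * quad c' d' y r u q)
      + 4 * (\<Sum>x\<in>UNIV. ?h' $ y $ x * (\<Sum>r\<in>UNIV. A q r i * S q r x j))" for y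
  have "canonical_N2 T M h H g c d q a i j = (\<Sum>b\<in>UNIV. \<Sum>y\<in>UNIV. matrix_inv (h c (fst q)) $ a $ b * J q y b * (Z y / 4))"
    unfolding canonical_N2_eq quad_law[OF q] Z_def[symmetric]
    by (simp add: sum_distrib_left sum_divide_distrib mult_ac)
  also have "\<dots> = (\<Sum>y\<in>UNIV. (\<Sum>b\<in>UNIV. matrix_inv (h c (fst q)) $ a $ b * J q y b) * (Z y / 4))"
    by (subst sum.swap) (simp add: sum_distrib_right sum_divide_distrib)
  also have "\<dots> = (\<Sum>x\<in>UNIV. K q a x * (\<Sum>y\<in>UNIV. matrix_inv ?h' $ x $ y * (Z y / 4)))"
    unfolding h_inv_J[OF q] sum_distrib_left sum_distrib_right by (subst sum.swap) (simp add: mult_ac)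
  finally have "canonical_N2 T M h H g c d q a i j
      = (\<Sum>x\<in>UNIV. K q a x * (\<Sum>y\<in>UNIV. matrix_inv ?h' $ x $ y * (Z y / 4)))" .
  moreover have "(\<Sum>y\<in>UNIV. matrix_inv ?h' $ x $ y * (Z y / 4))
      = (\<Sum>r\<in>UNIV. \<Sum>u\<in>UNIV. A q r i * A q u j * canonical_N2 T M h H g c' d' q x r u)
        + (\<Sum>r\<in>UNIV. A q r i * S q r x j)" for x
  proof -
    define s where "s z = (\<Sum>r\<in>UNIV. A q r i * S q r z j)" for z
    have "(\<Sum>y\<in>UNIV. matrix_inv ?h' $ x $ y * (\<Sum>z\<in>UNIV. ?h' $ y $ z * s z))
        = (\<Sum>z\<in>UNIV. (\<Sum>y\<in>UNIV. matrix_inv ?h' $ x $ y * ?h' $ y $ z) * s z)"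
      unfolding sum_distrib_left sum_distrib_right by (subst sum.swap) (simp add: mult_ac)
    also have "\<dots> = (\<Sum>z\<in>UNIV. if z = x then s z else 0)"
      using arg_cong[OF matrix_inv_left_right(1)[OF metric.h_invertible[OF c' overlapD(4)[OF q]]], of "\<lambda>A. A $ x $ _"]
      by (intro sum.cong) (auto simp: matrix_matrix_mult_def mat_def)
    finally have 1: "(\<Sum>y\<in>UNIV. matrix_inv ?h' $ x $ y * (\<Sum>z\<in>UNIV. ?h' $ y $ z * s z)) = s x" by simp
    have "(\<Sum>y\<in>UNIV. \<Sum>r\<in>UNIV. \<Sum>u\<in>UNIV. F r u y) = (\<Sum>r\<in>UNIV. \<Sum>u\<in>UNIV. \<Sum>y\<in>UNIV. F r u y)"
      for F :: "'n \<Rightarrow> 'n \<Rightarrow> 'm \<Rightarrow> real"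
      unfolding sum.cartesian_product UNIV_Times_UNIV
      by (rule sum.reindex_bij_witness[of _ "\<lambda>(r, u, y). (y, r, u)" "\<lambda>(y, r, u). (r, u, y)"]) auto
    from this[of "\<lambda>r u y. A q r i * A q u j * (matrix_inv ?h' $ x $ y / 4 * quad c' d' y r u q)"]
    have "(\<Sum>y\<in>UNIV. matrix_inv ?h' $ x $ y / 4 * (\<Sum>r\<in>UNIV. \<Sum>u\<in>UNIV. A q r i * A q u j * quad c' d' y r u q))
        = (\<Sum>r\<in>UNIV. \<Sum>u\<in>UNIV. A q r i * A q u j * canonical_N2 T M h H g c' d' q x r u)"
      by (simp add: canonical_N2_eq sum_distrib_left mult_ac)
    with 1 show ?thesis
      by (simp add: Z_def s_def[symmetric] distrib_left sum.distrib add_divide_distrib)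
  qed
  ultimately show ?thesis by simp
qed

text \<open>Solving the previous law for the primed components: multiplication by \<open>J\<close> removes \<open>K\<close>, and \<open>B\<^sup>T\<close> and
  \<open>B\<close> on the two sides remove \<open>A\<^sup>T\<close> and \<open>A\<close>.\<close>

lemma canonical_N2_law:
  assumes q: "q \<in> overlap"
  shows "canonical_N2 T M h H g c' d' q b j r =
    (\<Sum>k\<in>UNIV. \<Sum>f\<in>UNIV. \<Sum>i\<in>UNIV. canonical_N2 T M h H g c d q f k i * J q b f * B q k j * B q i r)
    - (\<Sum>i\<in>UNIV. B q i r * S q j b i)"
proof -
  define Am where "Am = (\<chi> i j. A q i j)"
  define Bm where "Bm = (\<chi> i j. B q i j)"
  define Sm where "Sm = (\<chi> l k. S q l b k)"
  define N where "N = (\<chi> k i. \<Sum>f\<in>UNIV. J q b f * canonical_N2 T M h H g c d q f k i)"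
  define N' where "N' x = (\<chi> k i. canonical_N2 T M h H g c' d' q x k i)" for x
  define F where "F x k i = (\<Sum>r\<in>UNIV. \<Sum>u\<in>UNIV. A q r k * A q u i * canonical_N2 T M h H g c' d' q x r u)
      + (\<Sum>r\<in>UNIV. A q r k * S q r x i)" for x k i
  have AB: "Am ** Bm = mat 1"
    using AB[OF q] by (simp add: Am_def Bm_def matrix_matrix_mult_def mat_def vec_eq_iff)
  then have BA: "transpose Bm ** transpose Am = mat 1"
    by (metis matrix_transpose_mul transpose_mat)
  have "(\<Sum>f\<in>UNIV. J q b f * canonical_N2 T M h H g c d q f k i) = F b k i" for k i
  proof -
    have "(\<Sum>f\<in>UNIV. J q b f * canonical_N2 T M h H g c d q f k i)
        = (\<Sum>x\<in>UNIV. (\<Sum>f\<in>UNIV. J q b f * K q f x) * F x k i)"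
      unfolding canonical_N2_law_inverse[OF q] F_def[symmetric] sum_distrib_left sum_distrib_right
      by (subst sum.swap) (simp add: mult_ac)
    also have "\<dots> = (\<Sum>x\<in>UNIV. if x = b then F x k i else 0)"
      by (intro sum.cong) (auto simp: JK[OF q])
    finally show ?thesis by simp
  qed
  moreover have "(\<Sum>r\<in>UNIV. \<Sum>u\<in>UNIV. A q r k * A q u i * canonical_N2 T M h H g c' d' q b r u)
      = (\<Sum>u\<in>UNIV. (\<Sum>r\<in>UNIV. A q r k * canonical_N2 T M h H g c' d' q b r u) * A q u i)" for k i
    unfolding sum_distrib_right by (subst sum.swap) (simp add: mult_ac)
  ultimately have N: "N = transpose Am ** N' b ** Am + transpose Am ** Sm"
    by (simp add: N_def N'_def F_def Am_def Sm_def vec_eq_iff matrix_matrix_mult_def transpose_def)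
  have add_mult: "(X + Y) ** Bm = X ** Bm + Y ** Bm" for X Y :: "real^'n^'n"
    by (simp add: matrix_matrix_mult_def vec_eq_iff distrib_right sum.distrib)
  from N have "transpose Bm ** N ** Bm
      = (transpose Bm ** transpose Am) ** N' b ** (Am ** Bm) + (transpose Bm ** transpose Am) ** Sm ** Bm"
    by (simp add: matrix_add_ldistrib add_mult matrix_mul_assoc)
  then have "transpose Bm ** N ** Bm = N' b + Sm ** Bm"
    by (simp add: AB BA)
  from arg_cong[OF this, of "\<lambda>A. A $ j $ r"]
  have "canonical_N2 T M h H g c' d' q b j r = (transpose Bm ** N ** Bm) $ j $ r - (\<Sum>i\<in>UNIV. B q i r * S q j b i)"
    by (simp add: N'_def Sm_def Bm_def matrix_matrix_mult_def mult.commute)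
  also have "(transpose Bm ** N ** Bm) $ j $ r
      = (\<Sum>k\<in>UNIV. \<Sum>f\<in>UNIV. \<Sum>i\<in>UNIV. canonical_N2 T M h H g c d q f k i * J q b f * B q k j * B q i r)"
  proof -
    have "(\<Sum>i\<in>UNIV. \<Sum>k\<in>UNIV. \<Sum>f\<in>UNIV. G i k f) = (\<Sum>k\<in>UNIV. \<Sum>f\<in>UNIV. \<Sum>i\<in>UNIV. G i k f)"
      for G :: "'n \<Rightarrow> 'n \<Rightarrow> 'm \<Rightarrow> real"
      unfolding sum.cartesian_product UNIV_Times_UNIV
      by (rule sum.reindex_bij_witness[of _ "\<lambda>(k, f, i). (i, k, f)" "\<lambda>(i, k, f). (k, f, i)"]) auto
    from this[of "\<lambda>i k f. B q k j * (J q b f * canonical_N2 T M h H g c d q f k i) * B q i r"]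
    show ?thesis
      by (simp add: N_def Bm_def matrix_matrix_mult_def transpose_def sum_distrib_left sum_distrib_right mult_ac)
  qed
  finally show ?thesis .
qed

end

section \<open>The canonical nonlinear connection\<close>

theorem theorem4p10:
  fixes T :: "('a, real^'m) manifold"
    and M :: "('b, real^'n) manifold"
    and h :: "('a, real^'m) chart \<Rightarrow> 'a \<Rightarrow> real^'m^'m"
    and H :: "('a, 'b) jet_dual_point \<Rightarrow> real"
    and g :: "('a, real^'m) chart \<Rightarrow> ('b, real^'n) chart \<Rightarrow> ('a, 'b) jet_dual_point \<Rightarrow> real^'n^'n"
  assumes "smooth_manifold T"
    and "smooth_manifold M"
    and "semi_riemannian_metric T h"
    and "kronecker_regular T M h H"
    and "vertical_metric T M h H g"
  shows "nonlinear_connection T M (canonical_N1 T M h) (canonical_N2 T M h H g)"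
proof -
  have "smooth_function T M H" using assms(4) by (simp add: kronecker_regular_def)
  then interpret hamilton_space T M h H g
    using assms by unfold_locales
  show ?thesis
    unfolding nonlinear_connection_def
  proof (intro conjI ballI allI)
    fix c d a i b assume "c \<in> atlas T" "d \<in> atlas M"
    then show "smooth_in (E c d) (\<lambda>q. canonical_N1 T M h c d q a i b)"
      by (rule smooth_in_canonical_N1)
  next
    fix c d a i j assume "c \<in> atlas T" "d \<in> atlas M"
    then show "smooth_in (E c d) (\<lambda>q. canonical_N2 T M h H g c d q a i j)"
      by (rule smooth_in_canonical_N2)
  next
    fix c d c' d' q b j y
    assume *: "c \<in> atlas T" "d \<in> atlas M" "c' \<in> atlas T" "d' \<in> atlas M"
      and q: "q \<in> fst (E c d) \<inter> fst (E c' d')"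
    interpret hamilton_charts T M h H g c c' d d'
      using * by unfold_locales
    show "canonical_N1 T M h c' d' q b j y =
        (\<Sum>k\<in>UNIV. \<Sum>f\<in>UNIV. \<Sum>a\<in>UNIV. canonical_N1 T M h c d q f k a * J q b f * B q k j * K q a y)
        - (\<Sum>a\<in>UNIV. K q a y * pd (E c d) (dir_t a) (\<lambda>q. p' q j b) q)"
      by (rule canonical_N1_law[OF assms(3) q])
  next
    fix c d c' d' q b j r
    assume *: "c \<in> atlas T" "d \<in> atlas M" "c' \<in> atlas T" "d' \<in> atlas M"
      and q: "q \<in> fst (E c d) \<inter> fst (E c' d')"
    interpret hamilton_charts T M h H g c c' d d'
      using * by unfold_locales
    show "canonical_N2 T M h H g c' d' q b j r =
        (\<Sum>k\<in>UNIV. \<Sum>f\<in>UNIV. \<Sum>i\<in>UNIV. canonical_N2 T M h H g c d q f k i * J q b f * B q k j * B q i r)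
        - (\<Sum>i\<in>UNIV. B q i r * S q j b i)"
      by (rule canonical_N2_law[OF q])
  qed
qed

end
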